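(* Let $S$ be an uncountable complete separable metric space, let $\mu$ be a diffuse, $\sigma$-finite, locally finite Borel measure on $S$ with $\mu(S)>0$, and let $W:S^2\to[0,1]$ be a connection kernel (a symmetric measurable function). Let $\xi$ be the edge measure of a Poisson graph process on $S$ with intensity measure $\mu$, connected by $W$. That is, $\xi \overset{a.s.}{=} \sum_{i,j\le N} A_{ij}\,\delta_{(S_i,S_j)}$, where $\sum_{i\le N}\delta_{S_i}$ is a Poisson process on $S$ with intensity measure $\mu$ and, conditionally on $(N,(S_k))$, $A_{ii}=0$, the entries $A_{ij}$ with $i<j$ are independent with $A_{ij}\sim\mathrm{Bernoulli}(W(S_i,S_j))$, and $A_{ji}=A_{ij}$. Then $\xi$ is jointly $\mu$-exchangeable if and only if $W$ is $\mu^{\otimes 2}$-almost everywhere constant.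
   Context: A measure on a metric space is locally finite if it is finite on every bounded Borel set. $N$ takes values in $\{0,1,2,\dots\}\cup\{\infty\}$ and the $S_i$ are almost surely distinct random elements of $S$ enumerating the atoms of the Poisson process. A Poisson process on $S$ with intensity measure $\mu$ is a point process $\nu$ such that $\nu(B_1),\dots,\nu(B_n)$ are independent and Poisson distributed with means $\mu(B_1),\dots,\mu(B_n)$ for all disjoint bounded Borel sets $B_1,\dots,B_n$. A measurable map $T:S\to S$ is a $\mu$-preserving transformation if $\mu(T^{-1}(B))=\mu(B)$ for all Borel $B\subseteq S$. A random measure $\eta$ on $S^2$ is jointly $\mu$-exchangeable if $(T\otimes T)\eta\overset{d}{=}\eta$ for every $\mu$-preserving transformation $T$ of $S$, where $T\otimes T:(x,y)\mapsto(Tx,Ty)$ and $(T\otimes T)\eta$ denotes the pushforward of $\eta$ under $T\otimes T$. The edge measure records only present edges, as ordered pairs of vertices in both orders. *)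

theory Defs
  imports "HOL-Probability.Probability"
begin

section \<open>Measures on metric spaces\<close>

definition locally_finite :: "'b::metric_space measure \<Rightarrow> bool" where
  "locally_finite M \<longleftrightarrow> (\<forall>B\<in>sets borel. bounded B \<longrightarrow> emeasure M B < \<infinity>)"

definition diffuse :: "'b measure \<Rightarrow> bool" where
  "diffuse M \<longleftrightarrow> (\<forall>x. emeasure M {x} = 0)"

definition measure_preserving :: "'b::topological_space measure \<Rightarrow> ('b \<Rightarrow> 'b) \<Rightarrow> bool" where
  "measure_preserving \<mu> T \<longleftrightarrow> T \<in> borel \<rightarrow>\<^sub>M borel \<and>
     (\<forall>B\<in>sets borel. emeasure \<mu> (T -` B) = emeasure \<mu> B)"

text \<open>The measure \<open>\<Sum>i\<in>I. \<delta> (x i)\<close>, written as the image of the counting measure on \<open>I\<close>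
  under \<open>x\<close>; the lemma below shows that this is the sum of Dirac measures.\<close>

definition dirac_sum :: "'i set \<Rightarrow> ('i \<Rightarrow> 'b::topological_space) \<Rightarrow> 'b measure" where
  "dirac_sum I x = distr (count_space I) borel x"

lemma emeasure_dirac_sum:
  assumes "B \<in> sets borel"
  shows "emeasure (dirac_sum I x) B = (\<integral>\<^sup>+i. emeasure (return borel (x i)) B \<partial>count_space I)"
proof -
  have "emeasure (dirac_sum I x) B = emeasure (count_space I) (x -` B \<inter> I)"
    unfolding dirac_sum_def using assms by (subst emeasure_distr) auto
  also have "\<dots> = (\<integral>\<^sup>+i. indicator (x -` B \<inter> I) i \<partial>count_space I)"
    by (subst nn_integral_indicator) auto
  also have "\<dots> = (\<integral>\<^sup>+i. emeasure (return borel (x i)) B \<partial>count_space I)"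
    using assms by (intro nn_integral_cong) (auto simp: indicator_def)
  finally show ?thesis .
qed


section \<open>Random measures\<close>

text \<open>The space of all measures on \<open>K\<close> with the \<open>\<sigma>\<close>-algebra generated by the evaluation maps
  \<open>M \<mapsto> M A\<close>; this is \<^const>\<open>subprob_algebra\<close> without the restriction on the total mass.\<close>

definition measure_algebra :: "'b measure \<Rightarrow> 'b measure measure" where
  "measure_algebra K =
     (SUP A \<in> sets K. vimage_algebra {M. sets M = sets K} (\<lambda>M. emeasure M A) borel)"

text \<open>Local finiteness is required almost surely only, because a push-forward of a random measure
  may fail to be locally finite on a null set.\<close>

definition random_measure :: "'w measure \<Rightarrow> ('w \<Rightarrow> 'b::metric_space measure) \<Rightarrow> bool" where
  "random_measure P \<eta> \<longleftrightarrow> \<eta> \<in> P \<rightarrow>\<^sub>M measure_algebra borel \<and> (AE \<omega> in P. locally_finite (\<eta> \<omega>))"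

definition point_process :: "'w measure \<Rightarrow> ('w \<Rightarrow> 'b::metric_space measure) \<Rightarrow> bool" where
  "point_process P \<nu> \<longleftrightarrow> random_measure P \<nu> \<and>
     (AE \<omega> in P. \<forall>B\<in>sets borel. bounded B \<longrightarrow> emeasure (\<nu> \<omega>) B \<in> \<nat>)"

definition jointly_exchangeable ::
    "'w measure \<Rightarrow> 'a::metric_space measure \<Rightarrow> ('w \<Rightarrow> ('a \<times> 'a) measure) \<Rightarrow> bool" where
  "jointly_exchangeable P \<mu> \<eta> \<longleftrightarrow> random_measure P \<eta> \<and>
     (\<forall>T. measure_preserving \<mu> T \<longrightarrow>
        distr P (measure_algebra borel) (\<lambda>\<omega>. distr (\<eta> \<omega>) borel (map_prod T T)) =
        distr P (measure_algebra borel) \<eta>)"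


section \<open>Poisson processes\<close>

text \<open>The mean \<open>m\<close> may be \<open>0\<close>, which \<^const>\<open>poisson_pmf\<close> excludes.\<close>

definition poisson_distributed :: "'w measure \<Rightarrow> ('w \<Rightarrow> ennreal) \<Rightarrow> real \<Rightarrow> bool" where
  "poisson_distributed P X m \<longleftrightarrow> X \<in> borel_measurable P \<and>
     (\<forall>k::nat. \<P>(\<omega> in P. X \<omega> = of_nat k) = m ^ k / fact k * exp (- m))"

definition poisson_process ::
    "'w measure \<Rightarrow> 'a::metric_space measure \<Rightarrow> ('w \<Rightarrow> 'a measure) \<Rightarrow> bool" where
  "poisson_process P \<mu> \<nu> \<longleftrightarrow> point_process P \<nu> \<and>
     (\<forall>(n::nat) B. (\<forall>i<n. B i \<in> sets borel \<and> bounded (B i)) \<and> disjoint_family_on B {..<n} \<longrightarrow>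
        prob_space.indep_vars P (\<lambda>_. borel) (\<lambda>i \<omega>. emeasure (\<nu> \<omega>) (B i)) {..<n} \<and>
        (\<forall>i<n. poisson_distributed P (\<lambda>\<omega>. emeasure (\<nu> \<omega>) (B i)) (measure \<mu> (B i))))"


section \<open>Poisson graph processes\<close>

definition connection_kernel :: "('a::topological_space \<times> 'a \<Rightarrow> real) \<Rightarrow> bool" where
  "connection_kernel W \<longleftrightarrow> W \<in> borel_measurable borel \<and>
     (\<forall>x y. 0 \<le> W (x, y) \<and> W (x, y) \<le> 1 \<and> W (x, y) = W (y, x))"

text \<open>The vertices are \<open>S i\<close> for the indices \<open>i < N\<close> (counted from \<open>0\<close>); the values of \<open>S i\<close> and
  \<open>A i j\<close> at indices outside this range are irrelevant. Accordingly, the following is the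
  \<open>\<sigma>\<close>-algebra generated by \<open>N\<close> and by the \<open>S k\<close> with \<open>k < N\<close>.\<close>

definition vertex_algebra ::
    "'w measure \<Rightarrow> ('w \<Rightarrow> enat) \<Rightarrow> (nat \<Rightarrow> 'w \<Rightarrow> 'a::topological_space) \<Rightarrow> 'w measure" where
  "vertex_algebra P N S = sigma (space P)
     ({{\<omega> \<in> space P. N \<omega> = n} | n. True} \<union>
      {{\<omega> \<in> space P. enat k < N \<omega> \<and> S k \<omega> \<in> B} | k B. B \<in> sets borel})"

definition cond_prob :: "'w measure \<Rightarrow> 'w measure \<Rightarrow> ('w \<Rightarrow> bool) \<Rightarrow> 'w \<Rightarrow> real" where
  "cond_prob P G Q = real_cond_exp P G (indicator {\<omega> \<in> space P. Q \<omega>})"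

lemma subalgebra_vertex_algebra:
  assumes [measurable]: "N \<in> P \<rightarrow>\<^sub>M count_space UNIV" "\<And>k. S k \<in> P \<rightarrow>\<^sub>M borel"
  shows "subalgebra P (vertex_algebra P N S)"
proof -
  have "{\<omega> \<in> space P. N \<omega> = n} \<in> sets P" for n by measurable
  moreover have "{\<omega> \<in> space P. enat k < N \<omega> \<and> S k \<omega> \<in> B} \<in> sets P" if [measurable]: "B \<in> sets borel" for k B
    by measurable
  ultimately have "{{\<omega> \<in> space P. N \<omega> = n} | n. True} \<union>
      {{\<omega> \<in> space P. enat k < N \<omega> \<and> S k \<omega> \<in> B} | k B. B \<in> sets borel} \<subseteq> sets P" (is "?G \<subseteq> _")
    by blast
  moreover have "?G \<subseteq> Pow (space P)" by blast
  ultimately show ?thesis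
    unfolding subalgebra_def vertex_algebra_def
    by (simp only: space_measure_of sets_measure_of sets.sigma_sets_subset simp_thms)
qed

text \<open>The number of entries \<open>A i j\<close> is itself random, so the last two conditions, on the conditional
  distributions and the conditional independence, are imposed on the event that all indices involved
  are smaller than \<open>N\<close>.\<close>

definition poisson_graph_process ::
    "'w measure \<Rightarrow> 'a::metric_space measure \<Rightarrow> ('a \<times> 'a \<Rightarrow> real) \<Rightarrow>
     ('w \<Rightarrow> enat) \<Rightarrow> (nat \<Rightarrow> 'w \<Rightarrow> 'a) \<Rightarrow> (nat \<Rightarrow> nat \<Rightarrow> 'w \<Rightarrow> bool) \<Rightarrow> bool" where
  "poisson_graph_process P \<mu> W N S A \<longleftrightarrow>
     N \<in> P \<rightarrow>\<^sub>M count_space UNIV \<and>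
     (\<forall>k. S k \<in> P \<rightarrow>\<^sub>M borel) \<and>
     (\<forall>i j. A i j \<in> P \<rightarrow>\<^sub>M count_space UNIV) \<and>
     (AE \<omega> in P. inj_on (\<lambda>i. S i \<omega>) {i. enat i < N \<omega>}) \<and>
     poisson_process P \<mu> (\<lambda>\<omega>. dirac_sum {i. enat i < N \<omega>} (\<lambda>i. S i \<omega>)) \<and>
     (AE \<omega> in P. \<forall>i j. enat i < N \<omega> \<longrightarrow> enat j < N \<omega> \<longrightarrow>
        \<not> A i i \<omega> \<and> (A j i \<omega> \<longleftrightarrow> A i j \<omega>)) \<and>
     (\<forall>i j. i < j \<longrightarrow>
        (AE \<omega> in P. enat j < N \<omega> \<longrightarrow>
           cond_prob P (vertex_algebra P N S) (\<lambda>\<omega>. A i j \<omega>) \<omega> = W (S i \<omega>, S j \<omega>))) \<and>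
     (\<forall>I E. finite I \<and> I \<subseteq> {(i, j). i < j} \<longrightarrow>
        (AE \<omega> in P. (\<forall>(i, j)\<in>I. enat j < N \<omega>) \<longrightarrow>
           cond_prob P (vertex_algebra P N S) (\<lambda>\<omega>. \<forall>(i, j)\<in>I. A i j \<omega> \<in> E i j) \<omega> =
           (\<Prod>(i, j)\<in>I. cond_prob P (vertex_algebra P N S) (\<lambda>\<omega>. A i j \<omega> \<in> E i j) \<omega>)))"

text \<open>The sum of \<open>A i j \<delta> (S i, S j)\<close> over all \<open>i, j < N\<close>.\<close>

definition edge_measure ::
    "('w \<Rightarrow> enat) \<Rightarrow> (nat \<Rightarrow> 'w \<Rightarrow> 'a::topological_space) \<Rightarrow> (nat \<Rightarrow> nat \<Rightarrow> 'w \<Rightarrow> bool) \<Rightarrow>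
     'w \<Rightarrow> ('a \<times> 'a) measure" where
  "edge_measure N S A \<omega> =
     dirac_sum {(i, j). enat i < N \<omega> \<and> enat j < N \<omega> \<and> A i j \<omega>} (\<lambda>(i, j). (S i \<omega>, S j \<omega>))"

end

theory Submission
  imports Defs
begin

text \<open>
  The edge measure \<open>\<xi>\<close> is a point process on pairs without multiple points, and so is its image under
  \<open>T \<otimes> T\<close> for every \<open>\<mu>\<close>-preserving \<open>T\<close>, since \<open>\<mu>\<close> is diffuse and \<open>T\<close> therefore almost surely does not
  merge vertices. The law of such a process is determined by its void probabilities
  (\<open>distr_eq_if_void_probabilities_eq\<close>).

  If \<open>W = c\<close> almost everywhere, then almost surely \<open>W (S i, S j) = c\<close> for all pairs of vertices, because the
  second moment measure of the Poisson process is \<open>\<mu> \<otimes> \<mu>\<close> off the diagonal (\<open>second_moment\<close>). Given the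
  vertices, \<open>\<xi>\<close> misses a set \<open>C\<close> with probability \<open>(1 - c) ^ k\<close>, where \<open>k\<close> is the number of unordered pairs
  of vertices that hit \<open>C\<close> (\<open>edge_measure_void_probability\<close>). For the image of \<open>\<xi>\<close> the same formula holds
  with the vertices \<open>T (S i)\<close>. The point processes \<open>\<Sum> \<delta> (S i)\<close> and \<open>\<Sum> \<delta> (T (S i))\<close> have the same law, again by
  their void probabilities \<open>exp (- \<mu> B)\<close>, and \<open>k\<close> is a functional of the point process
  (\<open>distr_pair_count_image\<close>). So the void probabilities of \<open>\<xi>\<close> and of its image agree. For a
  constant kernel the formula involves the positions of the vertices only through \<open>k\<close>.

  Conversely, the mean of \<open>\<xi>\<close> on \<open>D \<times> B\<close> with disjoint \<open>D\<close> and \<open>B\<close> is the integral of \<open>W\<close> over \<open>D \<times> B\<close>. Any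
  two disjoint sets \<open>D\<close>, \<open>D'\<close> of equal finite mass can be exchanged by a \<open>\<mu>\<close>-preserving map that fixes the
  complement of their union (\<open>ex_measure_preserving_swap\<close>); this rests on a coding of the space by real
  numbers and on quantile functions. Exchangeability thus shows that the degree into \<open>B\<close>, that is
  \<open>\<integral>y\<in>B. W (x, y)\<close>, has the same integral over all sets \<open>D\<close> outside \<open>B\<close> of the same mass. Hence it does not
  depend on \<open>x\<close> outside \<open>B\<close> (\<open>degree_constant\<close>). Letting \<open>B\<close> run through a countable base yields
  \<open>W (x, z) = W (y, z)\<close> almost everywhere, and symmetry turns this into constancy.
\<close>

section \<open>The space of measures\<close>

lemma space_measure_algebra: "space (measure_algebra K) = {M. sets M = sets K}"
  by (auto simp add: measure_algebra_def space_Sup_eq_UN)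

lemma measurable_emeasure_measure_algebra [measurable]:
  "B \<in> sets K \<Longrightarrow> (\<lambda>M. emeasure M B) \<in> borel_measurable (measure_algebra K)"
  by (auto intro!: measurable_Sup1 measurable_vimage_algebra1 simp: measure_algebra_def)

lemma measurable_measure_algebraI:
  assumes "\<And>a. a \<in> space M \<Longrightarrow> sets (f a) = sets K"
    and "\<And>B. B \<in> sets K \<Longrightarrow> (\<lambda>a. emeasure (f a) B) \<in> borel_measurable M"
  shows "f \<in> M \<rightarrow>\<^sub>M measure_algebra K"
  using assms by (auto intro!: measurable_Sup2 measurable_vimage_algebra2 simp: measure_algebra_def)

lemma sets_measure_algebra_value:
  assumes "f \<in> M \<rightarrow>\<^sub>M measure_algebra K" "a \<in> space M"
  shows "sets (f a) = sets K"
  using measurable_space[OF assms] by (simp add: space_measure_algebra)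

lemma measurable_emeasure_kernel:
  assumes "f \<in> M \<rightarrow>\<^sub>M measure_algebra K" "B \<in> sets K"
  shows "(\<lambda>a. emeasure (f a) B) \<in> borel_measurable M"
  using measurable_compose[OF assms(1) measurable_emeasure_measure_algebra[OF assms(2)]] .

lemma emeasure_distr_kernel:
  assumes "f \<in> M \<rightarrow>\<^sub>M measure_algebra K" "T \<in> K \<rightarrow>\<^sub>M L" "B \<in> sets L" "a \<in> space M"
  shows "emeasure (distr (f a) L T) B = emeasure (f a) (T -` B \<inter> space K)"
proof -
  have *: "sets (f a) = sets K" using sets_measure_algebra_value[OF assms(1,4)] .
  then have "T \<in> f a \<rightarrow>\<^sub>M L" using assms(2) by (simp cong: measurable_cong_sets)
  then show ?thesis using assms(3) sets_eq_imp_space_eq[OF *] by (simp add: emeasure_distr)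
qed

lemma measurable_distr_kernel:
  assumes f: "f \<in> M \<rightarrow>\<^sub>M measure_algebra K" and T: "T \<in> K \<rightarrow>\<^sub>M L"
  shows "(\<lambda>a. distr (f a) L T) \<in> M \<rightarrow>\<^sub>M measure_algebra L"
proof (rule measurable_measure_algebraI)
  fix B assume B: "B \<in> sets L"
  have "T -` B \<inter> space K \<in> sets K" using T B by (rule measurable_sets)
  from measurable_emeasure_kernel[OF f this]
  show "(\<lambda>a. emeasure (distr (f a) L T) B) \<in> borel_measurable M"
    by (rule measurable_cong[THEN iffD1, rotated]) (simp add: emeasure_distr_kernel[OF f T B])
qed simp

lemma sets_measure_algebra:
  "sets (measure_algebra K) = sigma_sets (space (measure_algebra K))
     {(\<lambda>M. emeasure M B) -` U \<inter> space (measure_algebra K) | B U. B \<in> sets K \<and> U \<in> sets borel}"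
  (is "_ = sigma_sets ?X ?G")
proof
  have G: "?G \<subseteq> sets (measure_algebra K)"
    using measurable_sets[OF measurable_emeasure_measure_algebra] by blast
  show "sigma_sets ?X ?G \<subseteq> sets (measure_algebra K)"
    by (rule sets.sigma_sets_subset[OF G])
  have *: "?G \<subseteq> Pow ?X" by blast
  have "id \<in> sigma ?X ?G \<rightarrow>\<^sub>M measure_algebra K"
  proof (rule measurable_measure_algebraI)
    show "sets (id M) = sets K" if "M \<in> space (sigma ?X ?G)" for M
      using that * by (simp add: space_measure_of space_measure_algebra)
    show "(\<lambda>M. emeasure (id M) B) \<in> borel_measurable (sigma ?X ?G)" if "B \<in> sets K" for B
      unfolding measurable_def using that *
      by (auto simp: space_measure_of sets_measure_of intro!: sigma_sets.Basic)
  qed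
  then show "sets (measure_algebra K) \<subseteq> sigma_sets ?X ?G"
    using * measurable_sets[of id "sigma ?X ?G" "measure_algebra K"] sets.sets_into_space
    by (fastforce simp: space_measure_of sets_measure_of Int_absorb2)
qed


section \<open>Simple counting measures are determined by their void probabilities\<close>

definition simple_counting :: "'b::topological_space measure \<Rightarrow> bool" where
  "simple_counting M \<longleftrightarrow> (\<exists>(I::nat set) x. inj_on x I \<and> M = dirac_sum I x)"

lemma sets_dirac_sum [simp]: "sets (dirac_sum I x) = sets borel"
  and space_dirac_sum [simp]: "space (dirac_sum I x) = UNIV"
  by (simp_all add: dirac_sum_def)

lemma emeasure_dirac_sum_card:
  assumes "B \<in> sets borel"
  shows "emeasure (dirac_sum I x) B = emeasure (count_space UNIV) {i\<in>I. x i \<in> B}"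
proof -
  have "emeasure (dirac_sum I x) B = emeasure (count_space I) (x -` B \<inter> I)"
    unfolding dirac_sum_def using assms by (subst emeasure_distr) auto
  also have "\<dots> = emeasure (count_space UNIV) {i\<in>I. x i \<in> B}"
    by (subst (1 2) emeasure_count_space) (auto simp: Int_def conj_commute)
  finally show ?thesis .
qed

lemma simple_counting_dirac_sum:
  fixes I :: "'i::countable set"
  assumes "inj_on x I"
  shows "simple_counting (dirac_sum I x)"
proof -
  have "dirac_sum I x = dirac_sum (to_nat ` I) (x \<circ> from_nat)"
  proof (rule measure_eqI)
    fix B assume "B \<in> sets (dirac_sum I x)"
    then have B: "B \<in> sets borel" by simp
    have "bij_betw to_nat {i\<in>I. x i \<in> B} {i\<in>to_nat ` I. (x \<circ> from_nat) i \<in> B}"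
      by (rule bij_betwI[where g=from_nat]) auto
    then show "emeasure (dirac_sum I x) B = emeasure (dirac_sum (to_nat ` I) (x \<circ> from_nat)) B"
      unfolding emeasure_dirac_sum_card[OF B]
      by (subst (1 2) emeasure_count_space) (auto dest: bij_betw_finite bij_betw_same_card)
  qed simp
  moreover have "inj_on (x \<circ> from_nat) (to_nat ` I)"
    using assms by (auto simp: inj_on_def)
  ultimately show ?thesis unfolding simple_counting_def by blast
qed

lemma ex_separating_sequence:
  "\<exists>U :: nat \<Rightarrow> 'b::{second_countable_topology, t1_space} set.
     (\<forall>n. open (U n)) \<and> (\<forall>x y. x \<noteq> y \<longrightarrow> (\<exists>n. x \<in> U n \<and> y \<notin> U n))"
proof -
  obtain B :: "'b set set" where B: "countable B" "topological_basis B"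
    using ex_countable_basis by blast
  have ne: "B \<noteq> {}" using topological_basisE[OF B(2) open_UNIV UNIV_I] by (metis empty_iff)
  show ?thesis
  proof (intro exI[of _ "from_nat_into B"] conjI allI impI)
    show "open (from_nat_into B n)" for n
      using from_nat_into[OF ne] topological_basis_open[OF B(2)] by blast
    fix x y :: 'b assume "x \<noteq> y"
    then obtain V where "open V" "x \<in> V" "y \<notin> V" using t1_space by blast
    then obtain b where "b \<in> B" "x \<in> b" "b \<subseteq> V" using topological_basisE[OF B(2)] by metis
    then show "\<exists>n. x \<in> from_nat_into B n \<and> y \<notin> from_nat_into B n"
      using from_nat_into_surj[OF B(1)] \<open>y \<notin> V\<close> by (metis subsetD)
  qed
qed

lemma ennreal_eq_top_if_of_nat_le:
  fixes a :: ennreal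
  assumes "\<And>k::nat. of_nat k \<le> a"
  shows "a = top"
  using assms ennreal_Ex_less_of_nat[of a] by (metis less_top not_le)

lemma sets_borel_cell:
  fixes U :: "nat \<Rightarrow> 'b::topological_space set"
  assumes [measurable]: "\<And>n. U n \<in> sets borel"
  shows "{x. \<forall>n<m. x \<in> U n \<longleftrightarrow> n \<in> s} \<in> sets borel"
proof -
  have "{x\<in>space borel. \<forall>n<m. x \<in> U n \<longleftrightarrow> n \<in> s} \<in> sets borel" by measurable
  then show ?thesis by simp
qed

text \<open>Finitely many distinct atoms eventually lie in distinct cells of the finite partitions that are
  generated by more and more members of a separating sequence. Therefore the numbers of charged cells,
  which are determined by void events, exhaust the mass.\<close>

lemma emeasure_simple_counting:
  fixes U :: "nat \<Rightarrow> 'b::topological_space set"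
  assumes sep: "\<And>x y. x \<noteq> y \<Longrightarrow> \<exists>n. x \<in> U n \<and> y \<notin> U n" and U: "\<And>n. U n \<in> sets borel"
    and M: "simple_counting M" and B: "B \<in> sets borel"
  shows "emeasure M B = (SUP m. \<Sum>s\<in>Pow {..<m}. if emeasure M (B \<inter> {x. \<forall>n<m. x \<in> U n \<longleftrightarrow> n \<in> s}) = 0 then 0 else 1)"
    (is "_ = (SUP m. ?Z m)")
proof -
  obtain I :: "nat set" and x where inj: "inj_on x I" and Mx: "M = dirac_sum I x"
    using M by (auto simp: simple_counting_def)
  define D where "D m s = {x. \<forall>n<m. x \<in> U n \<longleftrightarrow> n \<in> s}" for m s
  define pat where "pat m y = {n. n < m \<and> y \<in> U n}" for m y
  have D[measurable]: "D m s \<in> sets borel" for m s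
    unfolding D_def using U by (rule sets_borel_cell)
  define J where "J = {i\<in>I. x i \<in> B}"
  have zero: "emeasure M (B \<inter> D m s) = 0 \<longleftrightarrow> \<not> (\<exists>i\<in>J. x i \<in> D m s)" for m s
    unfolding Mx J_def using B
    by (subst emeasure_dirac_sum_card) (auto simp: emeasure_count_space_eq_0)
  have Z: "?Z m = of_nat (card (pat m ` x ` J))" and fin: "finite (pat m ` x ` J)" for m
  proof -
    have eq: "pat m ` x ` J = {s\<in>Pow {..<m}. \<exists>i\<in>J. x i \<in> D m s}"
      by (auto simp: pat_def D_def image_iff)
    show "finite (pat m ` x ` J)" unfolding eq by simp
    have "?Z m = (\<Sum>s\<in>Pow {..<m}. if \<exists>i\<in>J. x i \<in> D m s then 1 else 0)"
      unfolding D_def[symmetric] by (intro sum.cong) (auto simp: zero)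
    also have "\<dots> = of_nat (card (pat m ` x ` J))"
      unfolding eq by (simp add: sum.If_cases Int_def)
    finally show "?Z m = of_nat (card (pat m ` x ` J))" .
  qed
  have MB: "emeasure M B = emeasure (count_space UNIV) J"
    unfolding Mx J_def by (rule emeasure_dirac_sum_card[OF B])
  have lower: "\<exists>m. of_nat (card F) \<le> ?Z m" if F: "finite F" "F \<subseteq> J" for F
  proof -
    have "\<exists>n. i \<noteq> j \<longrightarrow> i \<in> F \<longrightarrow> j \<in> F \<longrightarrow> x i \<in> U n \<and> x j \<notin> U n" for i j
      using sep[of "x i" "x j"] inj F by (auto simp: J_def inj_on_def)
    then obtain n where n: "\<And>i j. i \<noteq> j \<Longrightarrow> i \<in> F \<Longrightarrow> j \<in> F \<Longrightarrow> x i \<in> U (n i j) \<and> x j \<notin> U (n i j)"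
      by metis
    define m where "m = Suc (Max ((\<lambda>(i,j). n i j) ` (F \<times> F)))"
    have m: "n i j < m" if "i \<in> F" "j \<in> F" for i j
    proof -
      have "n i j \<in> (\<lambda>(i,j). n i j) ` (F \<times> F)" using that by (intro image_eqI[of _ _ "(i,j)"]) simp_all
      moreover have "finite ((\<lambda>(i,j). n i j) ` (F \<times> F))" using F(1) by simp
      ultimately show ?thesis unfolding m_def less_Suc_eq_le by (rule Max_ge[rotated])
    qed
    have "inj_on (\<lambda>i. pat m (x i)) F"
    proof (rule inj_onI, rule ccontr)
      fix i j assume ij: "i \<in> F" "j \<in> F" "pat m (x i) = pat m (x j)" "i \<noteq> j"
      have "n i j \<in> pat m (x i)" "n i j \<notin> pat m (x j)"
        using n[OF ij(4,1,2)] m[OF ij(1,2)] by (simp_all add: pat_def)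
      then show False using ij by simp
    qed
    then have "card F = card ((\<lambda>i. pat m (x i)) ` F)" by (simp add: card_image)
    also have "\<dots> \<le> card (pat m ` x ` J)"
      using F by (intro card_mono[OF fin]) auto
    finally show ?thesis unfolding Z by (intro exI[of _ m]) simp
  qed
  show ?thesis
  proof (rule antisym)
    show "(SUP m. ?Z m) \<le> emeasure M B"
    proof (rule SUP_least)
      fix m
      show "?Z m \<le> emeasure M B"
      proof (cases "finite J")
        case True
        then have "card (pat m ` x ` J) \<le> card J"
          by (metis card_image_le finite_imageI le_trans)
        then show ?thesis using True unfolding Z MB by simp
      qed (simp add: MB)
    qed
    show "emeasure M B \<le> (SUP m. ?Z m)"
    proof (cases "finite J")
      case True
      then obtain m where "of_nat (card J) \<le> ?Z m" using lower[of J] by auto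
      then show ?thesis unfolding MB using True by (intro SUP_upper2[OF UNIV_I]) simp_all
    next
      case False
      have "of_nat k \<le> (SUP m. ?Z m)" for k :: nat
      proof -
        obtain F where "F \<subseteq> J" "finite F" "card F = k"
          using infinite_arbitrarily_large[OF False] by blast
        with lower[of F] obtain m where "of_nat k \<le> ?Z m" by blast
        then show ?thesis by (rule SUP_upper2[OF UNIV_I])
      qed
      then have "(SUP m. ?Z m) = top"
        by (rule ennreal_eq_top_if_of_nat_le)
      then show ?thesis by (simp only: top_greatest)
    qed
  qed
qed

text \<open>The events \<open>{M. M C = 0}\<close> are closed under intersection, so the void probabilities
  determine the law on the \<open>\<sigma>\<close>-algebra \<open>\<F>\<close> that they generate. On simple counting measures all
  evaluation maps agree with \<open>\<F>\<close>-measurable functions, so that there \<open>\<F>\<close> has the same trace as the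
  full \<open>\<sigma>\<close>-algebra. The result is due to Renyi and Moench.\<close>

theorem distr_eq_if_void_probabilities_eq:
  fixes \<eta>1 \<eta>2 :: "'w \<Rightarrow> 'b::{second_countable_topology, t1_space} measure"
  assumes P: "prob_space P"
    and \<eta>: "\<eta>1 \<in> P \<rightarrow>\<^sub>M measure_algebra borel" "\<eta>2 \<in> P \<rightarrow>\<^sub>M measure_algebra borel"
    and simple: "AE \<omega> in P. simple_counting (\<eta>1 \<omega>)" "AE \<omega> in P. simple_counting (\<eta>2 \<omega>)"
    and void: "\<And>C. C \<in> sets borel \<Longrightarrow>
      measure P {\<omega>\<in>space P. emeasure (\<eta>1 \<omega>) C = 0} = measure P {\<omega>\<in>space P. emeasure (\<eta>2 \<omega>) C = 0}"
  shows "distr P (measure_algebra borel) \<eta>1 = distr P (measure_algebra borel) \<eta>2"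
proof -
  interpret prob_space P by fact
  define \<Omega> :: "'b measure set" where "\<Omega> = space (measure_algebra borel)"
  define G where "G = {{M\<in>\<Omega>. emeasure M C = 0} | C. C \<in> sets (borel :: 'b measure)}"
  have G_Pow: "G \<subseteq> Pow \<Omega>" by (auto simp: G_def)
  define \<F> where "\<F> = sigma \<Omega> G"
  have sp\<F>: "space \<F> = \<Omega>" and se\<F>: "sets \<F> = sigma_sets \<Omega> G"
    using G_Pow by (simp_all add: \<F>_def)
  let ?L1 = "distr P (measure_algebra borel) \<eta>1" and ?L2 = "distr P (measure_algebra borel) \<eta>2"
  have G_sets: "{M\<in>\<Omega>. emeasure M C = 0} \<in> sets (measure_algebra borel)" if "C \<in> sets borel" for C
    using that unfolding \<Omega>_def by measurable
  then have \<F>_sub: "sets \<F> \<subseteq> sets (measure_algebra borel)"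
    unfolding se\<F> \<Omega>_def by (intro sets.sigma_sets_subset) (auto simp: G_def \<Omega>_def)
  have L1: "prob_space ?L1" and L2: "prob_space ?L2"
    using \<eta> by (auto intro: prob_space_distr)

  have restr_eq: "restr_to_subalg ?L1 \<F> = restr_to_subalg ?L2 \<F>"
  proof (rule measure_eqI_generator_eq[where E=G and \<Omega>=\<Omega> and A="\<lambda>_. \<Omega>"])
    have sub: "subalgebra ?L1 \<F>" "subalgebra ?L2 \<F>"
      using \<F>_sub by (auto simp: subalgebra_def sp\<F> \<Omega>_def)
    have val: "emeasure (restr_to_subalg ?L1 \<F>) X = emeasure ?L1 X"
      "emeasure (restr_to_subalg ?L2 \<F>) X = emeasure ?L2 X" if "X \<in> G" for X
      using that sub by (auto simp: emeasure_restr_to_subalg se\<F>)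
    show "Int_stable G"
    proof (rule Int_stableI)
      fix X Y assume "X \<in> G" "Y \<in> G"
      then obtain C D where CD: "C \<in> sets borel" "X = {M\<in>\<Omega>. emeasure M C = 0}"
        "D \<in> sets borel" "Y = {M\<in>\<Omega>. emeasure M D = 0}" by (auto simp: G_def)
      have "emeasure M (C \<union> D) = 0 \<longleftrightarrow> emeasure M C = 0 \<and> emeasure M D = 0" if "M \<in> \<Omega>" for M
      proof -
        have "sets M = sets borel" using that by (simp add: \<Omega>_def space_measure_algebra)
        then have "C \<in> sets M" "D \<in> sets M" using CD by auto
        then show ?thesis
          by (metis emeasure_Un_null_set emeasure_mono le_zero_eq null_setsI sets.Un sup_ge1 sup_ge2)
      qed
      then have "X \<inter> Y = {M\<in>\<Omega>. emeasure M (C \<union> D) = 0}" using CD by auto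
      then show "X \<inter> Y \<in> G" using CD by (auto simp: G_def intro!: exI[of _ "C \<union> D"])
    qed
    show "G \<subseteq> Pow \<Omega>" by fact
    show "emeasure (restr_to_subalg ?L1 \<F>) X = emeasure (restr_to_subalg ?L2 \<F>) X" if X: "X \<in> G" for X
    proof -
      obtain C where C: "C \<in> sets borel" "X = {M\<in>\<Omega>. emeasure M C = 0}" using X by (auto simp: G_def)
      have "\<eta>1 -` X \<inter> space P = {\<omega>\<in>space P. emeasure (\<eta>1 \<omega>) C = 0}"
        "\<eta>2 -` X \<inter> space P = {\<omega>\<in>space P. emeasure (\<eta>2 \<omega>) C = 0}"
        using C measurable_space[OF \<eta>(1)] measurable_space[OF \<eta>(2)] by (auto simp: \<Omega>_def)
      then show ?thesis
        unfolding val[OF X] using void[OF C(1)] \<eta> G_sets[OF C(1)] C(2)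
        by (simp add: emeasure_distr emeasure_eq_measure)
    qed
    show "sets (restr_to_subalg ?L1 \<F>) = sigma_sets \<Omega> G" "sets (restr_to_subalg ?L2 \<F>) = sigma_sets \<Omega> G"
      using sub by (simp_all add: sets_restr_to_subalg se\<F>)
    have "\<Omega> = {M\<in>\<Omega>. emeasure M {} = 0}" by simp
    then show *: "range (\<lambda>i::nat. \<Omega>) \<subseteq> G" unfolding G_def by blast
    show "(\<Union>i::nat. \<Omega>) = \<Omega>" by simp
    show "emeasure (restr_to_subalg ?L1 \<F>) \<Omega> \<noteq> \<infinity>"
    proof -
      have "emeasure ?L1 \<Omega> = 1" using prob_space.emeasure_space_1[OF L1] by (simp add: \<Omega>_def)
      then show ?thesis using val(1)[of \<Omega>] * by auto
    qed
  qed

  \<comment> \<open>The measurability of \<open>X0\<close> is unclear, so it is used only inside almost sure statements.\<close>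
  define X0 :: "'b measure set" where "X0 = {M\<in>\<Omega>. simple_counting M}"
  obtain U :: "nat \<Rightarrow> 'b set" where U: "\<And>n. open (U n)" "\<And>x y. x \<noteq> y \<Longrightarrow> \<exists>n. x \<in> U n \<and> y \<notin> U n"
    using ex_separating_sequence by blast
  have Ub: "U n \<in> sets borel" for n using U(1) by simp
  have approx: "\<exists>E'\<in>sets \<F>. E \<inter> X0 = E' \<inter> X0" if E: "E \<in> sets (measure_algebra borel)" for E
    using E unfolding sets_measure_algebra \<Omega>_def[symmetric]
  proof (induction rule: sigma_sets.induct)
    case (Basic E)
    then obtain B V where B: "B \<in> sets borel" and V: "V \<in> sets borel"
      and E: "E = (\<lambda>M. emeasure M B) -` V \<inter> \<Omega>" by blast
    define Z where "Z M = (SUP m. \<Sum>s\<in>Pow {..<m::nat}.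
       if emeasure M (B \<inter> {x. \<forall>n<m. x \<in> U n \<longleftrightarrow> n \<in> s}) = 0 then 0 else 1 :: ennreal)" for M :: "'b measure"
    have D: "B \<inter> {x. \<forall>n<m. x \<in> U n \<longleftrightarrow> n \<in> s} \<in> sets borel" for m s
      using B sets_borel_cell[OF Ub] by (rule sets.Int)
    have pred: "{M\<in>space \<F>. emeasure M C = 0} \<in> sets \<F>" if "C \<in> sets borel" for C
      unfolding sp\<F> se\<F> using that by (intro sigma_sets.Basic) (auto simp: G_def)
    have "Z \<in> borel_measurable \<F>"
      unfolding Z_def by (intro borel_measurable_SUP borel_measurable_sum measurable_If pred D) simp_all
    then have "Z -` V \<inter> \<Omega> \<in> sets \<F>" using V measurable_sets[of Z \<F> borel V] by (simp add: sp\<F>)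
    moreover have "Z M = emeasure M B" if "M \<in> X0" for M
      using that emeasure_simple_counting[OF U(2) Ub _ B, of M] by (simp add: X0_def Z_def)
    ultimately show ?case unfolding E by (intro bexI[of _ "Z -` V \<inter> \<Omega>"]) auto
  next
    case Empty
    then show ?case by (intro bexI[of _ "{}"]) auto
  next
    case (Compl E)
    then obtain E' where "E' \<in> sets \<F>" "E \<inter> X0 = E' \<inter> X0" by blast
    then show ?case
      using sets.compl_sets[of E' \<F>] by (intro bexI[of _ "\<Omega> - E'"]) (auto simp: sp\<F>)
  next
    case (Union E)
    then obtain E' where "\<And>i. E' i \<in> sets \<F>" "\<And>i. E i \<inter> X0 = E' i \<inter> X0" by metis
    then show ?case by (intro bexI[of _ "\<Union>i::nat. E' i"]) auto
  qed

  show ?thesis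
  proof (rule measure_eqI)
    fix E assume "E \<in> sets ?L1"
    then have E: "E \<in> sets (measure_algebra borel)" by simp
    obtain E' where E': "E' \<in> sets \<F>" "E \<inter> X0 = E' \<inter> X0" using approx[OF E] by blast
    have E'm: "E' \<in> sets (measure_algebra borel)" using E' \<F>_sub by auto
    have same: "emeasure (distr P (measure_algebra borel) \<eta>) E = emeasure (distr P (measure_algebra borel) \<eta>) E'"
      if \<eta>: "\<eta> \<in> P \<rightarrow>\<^sub>M measure_algebra borel" and "AE \<omega> in P. simple_counting (\<eta> \<omega>)" for \<eta>
    proof -
      have "AE \<omega> in P. \<omega> \<in> \<eta> -` E \<inter> space P \<longleftrightarrow> \<omega> \<in> \<eta> -` E' \<inter> space P"
        using that(2)
      proof eventually_elim
        case (elim \<omega>)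
        have "\<eta> \<omega> \<in> X0" if "\<omega> \<in> space P"
          using measurable_space[OF \<eta> that] elim by (simp add: X0_def \<Omega>_def)
        then show ?case using E'(2) by blast
      qed
      then show ?thesis
        using \<eta> E E'm by (subst (1 2) emeasure_distr) (auto intro!: emeasure_eq_AE)
    qed
    have sub: "subalgebra ?L1 \<F>" "subalgebra ?L2 \<F>"
      using \<F>_sub by (auto simp: subalgebra_def sp\<F> \<Omega>_def)
    have "emeasure ?L1 E' = emeasure ?L2 E'"
      using restr_eq emeasure_restr_to_subalg[OF sub(1) E'(1)] emeasure_restr_to_subalg[OF sub(2) E'(1)]
      by simp
    then show "emeasure ?L1 E = emeasure ?L2 E"
      using same[OF \<eta>(1) simple(1)] same[OF \<eta>(2) simple(2)] by simp
  qed simp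
qed

section \<open>Moments and void probabilities of a Poisson process\<close>

abbreviation borel_rectangles :: "('a::topological_space \<times> 'b::topological_space) set set" where
  "borel_rectangles \<equiv> {a \<times> b | a b. a \<in> sets borel \<and> b \<in> sets borel}"

lemma poisson_sums_mean: "(\<lambda>k. real k * (m ^ k / fact k * exp (- m))) sums (m::real)"
proof -
  have "(\<lambda>k. m ^ k / fact k * (m * exp (- m))) sums (exp m * (m * exp (- m)))"
    using exp_converges[of m] by (intro sums_mult2) (simp add: divide_inverse mult.commute)
  also have "exp m * (m * exp (- m)) = m" by (simp add: exp_minus field_simps)
  also have "(\<lambda>k. m ^ k / fact k * (m * exp (- m))) = (\<lambda>k. real (Suc k) * (m ^ Suc k / fact (Suc k) * exp (- m)))"
    by (rule ext) (simp add: field_simps del: of_nat_Suc)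
  finally show ?thesis by (subst (asm) sums_Suc_iff) simp
qed

lemma (in prob_space) poisson_mean:
  assumes X: "poisson_distributed M X m" and nat: "AE \<omega> in M. X \<omega> \<in> \<nat>" and m: "0 \<le> m"
  shows "(\<integral>\<^sup>+\<omega>. X \<omega> \<partial>M) = ennreal m"
proof -
  have [measurable]: "X \<in> borel_measurable M"
    and pk: "\<And>k::nat. prob {\<omega>\<in>space M. X \<omega> = of_nat k} = m ^ k / fact k * exp (- m)"
    using X by (auto simp: poisson_distributed_def)
  have "(\<integral>\<^sup>+\<omega>. X \<omega> \<partial>M) = (\<integral>\<^sup>+\<omega>. (\<Sum>k. of_nat k * indicator {\<omega>\<in>space M. X \<omega> = of_nat k} \<omega>) \<partial>M)"
  proof (rule nn_integral_cong_AE)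
    show "AE \<omega> in M. X \<omega> = (\<Sum>k. of_nat k * indicator {\<omega>\<in>space M. X \<omega> = of_nat k} \<omega>)"
      using nat AE_space
    proof eventually_elim
      case (elim \<omega>)
      then obtain n where n: "X \<omega> = of_nat n" by (auto simp: Nats_def)
      have "(\<Sum>k. of_nat k * indicator {\<omega>\<in>space M. X \<omega> = of_nat k} \<omega>) =
            (\<Sum>k\<in>{n}. of_nat k * indicator {\<omega>\<in>space M. X \<omega> = of_nat k} \<omega> :: ennreal)"
        by (rule suminf_finite) (auto simp: n)
      then show ?case using elim n by simp
    qed
  qed
  also have "\<dots> = (\<Sum>k. \<integral>\<^sup>+\<omega>. of_nat k * indicator {\<omega>\<in>space M. X \<omega> = of_nat k} \<omega> \<partial>M)"
    by (rule nn_integral_suminf) measurable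
  also have "\<dots> = (\<Sum>k. ennreal (real k * (m ^ k / fact k * exp (- m))))"
  proof (rule suminf_cong)
    fix k
    have "(\<integral>\<^sup>+\<omega>. of_nat k * indicator {\<omega>\<in>space M. X \<omega> = of_nat k} \<omega> \<partial>M) =
        of_nat k * emeasure M {\<omega>\<in>space M. X \<omega> = of_nat k}"
      by (rule nn_integral_cmult_indicator) measurable
    also have "\<dots> = of_nat k * ennreal (m ^ k / fact k * exp (- m))"
      by (simp only: emeasure_eq_measure pk)
    also have "\<dots> = ennreal (real k * (m ^ k / fact k * exp (- m)))"
      by (subst ennreal_of_nat_eq_real_of_nat, subst ennreal_mult') auto
    finally show "(\<integral>\<^sup>+\<omega>. of_nat k * indicator {\<omega>\<in>space M. X \<omega> = of_nat k} \<omega> \<partial>M) = \<dots>" .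
  qed
  also have "\<dots> = ennreal m"
    using m by (intro suminf_ennreal_eq poisson_sums_mean) auto
  finally show ?thesis .
qed

lemma borel_measurable_count_space_integral:
  assumes "\<And>i. f i \<in> borel_measurable M"
  shows "(\<lambda>\<omega>. \<integral>\<^sup>+i. f i \<omega> \<partial>count_space (UNIV :: 'i::countable set)) \<in> borel_measurable M"
proof -
  interpret sigma_finite_measure "count_space (UNIV :: 'i set)"
    by (rule sigma_finite_measure_count_space_countable) simp
  have "(\<lambda>(i, \<omega>). f i \<omega>) \<in> borel_measurable (count_space UNIV \<Otimes>\<^sub>M M)"
    by (intro measurable_pair_measure_countable1) (use assms in auto)
  then have "(\<lambda>(\<omega>, i). f i \<omega>) \<in> borel_measurable (M \<Otimes>\<^sub>M count_space UNIV)"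
    by (subst measurable_pair_swap_iff) (simp add: case_prod_beta')
  then show ?thesis by (rule borel_measurable_nn_integral)
qed

text \<open>The choice operator supplies a center, since the space has no distinguished point.\<close>

definition bounded_exhaustion :: "nat \<Rightarrow> 'a::metric_space set" where
  "bounded_exhaustion n = cball (SOME x. True) (real n)"

lemma bounded_exhaustion_sets [measurable, simp]: "bounded_exhaustion n \<in> sets borel"
  and bounded_exhaustion_bounded [simp]: "bounded (bounded_exhaustion n)"
  and bounded_exhaustion_incseq: "incseq bounded_exhaustion"
  and bounded_exhaustion_UN: "(\<Union>n. bounded_exhaustion n) = UNIV"
proof -
  show "bounded_exhaustion n \<in> sets borel" "bounded (bounded_exhaustion n)"
    by (simp_all add: bounded_exhaustion_def)
  show "incseq bounded_exhaustion"
    by (auto simp: incseq_def bounded_exhaustion_def)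
  show "(\<Union>n. bounded_exhaustion n) = UNIV"
    using real_arch_simple by (auto simp: bounded_exhaustion_def)
qed

lemma emeasure_exhaust:
  assumes M: "sets M = sets borel" and B: "B \<in> sets borel"
  shows "(SUP n. emeasure M (B \<inter> bounded_exhaustion n)) = emeasure M B"
    and "(\<lambda>n. emeasure M (B \<inter> bounded_exhaustion n)) \<longlonglongrightarrow> emeasure M B"
proof -
  have inc: "incseq (\<lambda>n. B \<inter> bounded_exhaustion n)"
    using bounded_exhaustion_incseq by (auto simp: incseq_def)
  have UN: "(\<Union>n. B \<inter> bounded_exhaustion n) = B"
  proof -
    have "(\<Union>n. B \<inter> bounded_exhaustion n) = B \<inter> (\<Union>n. bounded_exhaustion n)"
      by (rule Int_UN_distrib[symmetric])
    also have "\<dots> = B" unfolding bounded_exhaustion_UN by (rule Int_UNIV_right)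
    finally show ?thesis .
  qed
  have sub: "range (\<lambda>n. B \<inter> bounded_exhaustion n) \<subseteq> sets M"
    unfolding M using B by (intro image_subsetI sets.Int) simp_all
  show "(SUP n. emeasure M (B \<inter> bounded_exhaustion n)) = emeasure M B"
    using SUP_emeasure_incseq[OF sub inc] UN by simp
  show "(\<lambda>n. emeasure M (B \<inter> bounded_exhaustion n)) \<longlonglongrightarrow> emeasure M B"
    using Lim_emeasure_incseq[OF sub inc] UN by simp
qed

text \<open>The enumeration of the points is arbitrary and may depend on the whole configuration. Hence the
  Poisson property gives access only to the laws of quantities that are symmetric under renumbering.\<close>

locale poisson_points = prob_space P + \<mu>: sigma_finite_measure \<mu>
  for P :: "'w measure" and \<mu> :: "'a::polish_space measure" +
  fixes N :: "'w \<Rightarrow> enat" and S :: "nat \<Rightarrow> 'w \<Rightarrow> 'a"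
  assumes sets_\<mu>: "sets \<mu> = sets borel"
    and diffuse: "diffuse \<mu>"
    and locally_finite: "locally_finite \<mu>"
    and N [measurable]: "N \<in> P \<rightarrow>\<^sub>M count_space UNIV"
    and S [measurable]: "\<And>k. S k \<in> P \<rightarrow>\<^sub>M borel"
    and inj: "AE \<omega> in P. inj_on (\<lambda>i. S i \<omega>) {i. enat i < N \<omega>}"
    and poisson: "poisson_process P \<mu> (\<lambda>\<omega>. dirac_sum {i. enat i < N \<omega>} (\<lambda>i. S i \<omega>))"
begin

definition \<nu> :: "'w \<Rightarrow> 'a measure" where
  "\<nu> \<omega> = dirac_sum {i. enat i < N \<omega>} (\<lambda>i. S i \<omega>)"

lemma sets_\<mu>_pair: "sets (\<mu> \<Otimes>\<^sub>M \<mu>) = sets borel"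
  using sets_\<mu> by (metis borel_prod sets_pair_measure_cong)

lemma space_\<mu>: "space \<mu> = UNIV"
  using sets_eq_imp_space_eq[OF sets_\<mu>] by simp

lemma emeasure_\<nu>:
  assumes "B \<in> sets borel"
  shows "emeasure (\<nu> \<omega>) B = (\<integral>\<^sup>+i. indicator {i. enat i < N \<omega> \<and> S i \<omega> \<in> B} i \<partial>count_space UNIV)"
  unfolding \<nu>_def using assms by (subst emeasure_dirac_sum_card) simp_all

lemma \<nu>_measurable: "\<nu> \<in> P \<rightarrow>\<^sub>M measure_algebra borel"
  using poisson unfolding \<nu>_def by (simp add: poisson_process_def point_process_def random_measure_def)

lemma \<nu>_measurable_emeasure [measurable]:
  "B \<in> sets borel \<Longrightarrow> (\<lambda>\<omega>. emeasure (\<nu> \<omega>) B) \<in> borel_measurable P"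
  using measurable_emeasure_kernel[OF \<nu>_measurable] by simp

lemma \<mu>_bounded_finite: "B \<in> sets borel \<Longrightarrow> bounded B \<Longrightarrow> emeasure \<mu> B < \<infinity>"
  using locally_finite by (auto simp: locally_finite_def)

lemma \<nu>_counts:
  fixes B :: "nat \<Rightarrow> 'a set"
  assumes "\<And>i. i < n \<Longrightarrow> B i \<in> sets borel \<and> bounded (B i)" "disjoint_family_on B {..<n}"
  shows "indep_vars (\<lambda>_. borel) (\<lambda>i \<omega>. emeasure (\<nu> \<omega>) (B i)) {..<n}"
    and "\<And>i. i < n \<Longrightarrow> poisson_distributed P (\<lambda>\<omega>. emeasure (\<nu> \<omega>) (B i)) (measure \<mu> (B i))"
  using poisson[unfolded poisson_process_def, THEN conjunct2, THEN spec, of n, THEN spec, of B] assms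
  unfolding \<nu>_def by simp_all

lemma \<nu>_poisson:
  assumes "B \<in> sets borel" "bounded B"
  shows "poisson_distributed P (\<lambda>\<omega>. emeasure (\<nu> \<omega>) B) (measure \<mu> B)"
  using \<nu>_counts(2)[of "Suc 0" "\<lambda>_. B" 0] assms by (simp add: disjoint_family_on_def)

lemma \<nu>_indep:
  assumes A: "A \<in> sets borel" "bounded A" and B: "B \<in> sets borel" "bounded B" and "A \<inter> B = {}"
  shows "indep_vars (\<lambda>_. borel) (\<lambda>i \<omega>. emeasure (\<nu> \<omega>) (if i = 0 then A else B)) {..<2::nat}"
  using assms by (intro \<nu>_counts(1)) (auto simp: disjoint_family_on_def)

lemma mean_bounded:
  assumes B: "B \<in> sets borel" "bounded B"
  shows "(\<integral>\<^sup>+\<omega>. emeasure (\<nu> \<omega>) B \<partial>P) = emeasure \<mu> B"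
proof -
  have "AE \<omega> in P. \<forall>B\<in>sets borel. bounded B \<longrightarrow> emeasure (\<nu> \<omega>) B \<in> \<nat>"
    using poisson by (simp add: poisson_process_def point_process_def \<nu>_def)
  then have "AE \<omega> in P. emeasure (\<nu> \<omega>) B \<in> \<nat>" using B by (auto elim: eventually_mono)
  then have "(\<integral>\<^sup>+\<omega>. emeasure (\<nu> \<omega>) B \<partial>P) = ennreal (measure \<mu> B)"
    by (intro poisson_mean \<nu>_poisson B) auto
  then show ?thesis using \<mu>_bounded_finite[OF B] by (simp add: emeasure_eq_ennreal_measure less_top)
qed

lemma sets_\<nu> [simp]: "sets (\<nu> \<omega>) = sets borel"
  by (simp add: \<nu>_def)

lemma mean:
  assumes B: "B \<in> sets borel"
  shows "(\<integral>\<^sup>+\<omega>. emeasure (\<nu> \<omega>) B \<partial>P) = emeasure \<mu> B"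
proof -
  have "(\<integral>\<^sup>+\<omega>. emeasure (\<nu> \<omega>) B \<partial>P) = (\<integral>\<^sup>+\<omega>. (SUP n. emeasure (\<nu> \<omega>) (B \<inter> bounded_exhaustion n)) \<partial>P)"
    using emeasure_exhaust(1)[OF sets_\<nu> B] by simp
  also have "\<dots> = (SUP n. \<integral>\<^sup>+\<omega>. emeasure (\<nu> \<omega>) (B \<inter> bounded_exhaustion n) \<partial>P)"
    using B bounded_exhaustion_incseq
    by (intro nn_integral_monotone_convergence_SUP) (auto simp: incseq_def le_fun_def intro!: emeasure_mono)
  also have "\<dots> = (SUP n. emeasure \<mu> (B \<inter> bounded_exhaustion n))"
    using B by (simp add: mean_bounded bounded_Int)
  finally show ?thesis using emeasure_exhaust(1)[OF sets_\<mu> B] by simp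
qed

lemma void_probability_bounded:
  assumes B: "B \<in> sets borel" "bounded B"
  shows "prob {\<omega>\<in>space P. emeasure (\<nu> \<omega>) B = 0} = exp (- measure \<mu> B)"
  using \<nu>_poisson[OF B] by (auto simp: poisson_distributed_def dest!: spec[of _ 0])

text \<open>The set \<open>B\<close> may be unbounded and even of infinite mass, where the right-hand side is
  \<open>exp (-\<infinity>) = 0\<close>.\<close>

lemma void_probability:
  assumes B: "B \<in> sets borel"
  shows "prob {\<omega>\<in>space P. emeasure (\<nu> \<omega>) B = 0} = (if emeasure \<mu> B = \<infinity> then 0 else exp (- measure \<mu> B))"
proof (rule LIMSEQ_unique)
  let ?B = "\<lambda>n. B \<inter> bounded_exhaustion n"
  have Bn: "?B n \<in> sets borel" "bounded (?B n)" for n using B by (auto simp: bounded_Int)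
  have dec: "decseq (\<lambda>n. {\<omega>\<in>space P. emeasure (\<nu> \<omega>) (?B n) = 0})"
  proof (intro decseq_SucI subsetI, clarsimp)
    fix n \<omega> assume "emeasure (\<nu> \<omega>) (?B (Suc n)) = 0"
    moreover have "emeasure (\<nu> \<omega>) (?B n) \<le> emeasure (\<nu> \<omega>) (?B (Suc n))"
      using B bounded_exhaustion_incseq by (intro emeasure_mono) (auto simp: incseq_Suc_iff)
    ultimately show "emeasure (\<nu> \<omega>) (?B n) = 0" by simp
  qed
  have "(\<Inter>n. {\<omega>\<in>space P. emeasure (\<nu> \<omega>) (?B n) = 0}) = {\<omega>\<in>space P. emeasure (\<nu> \<omega>) B = 0}"
  proof -
    have "emeasure (\<nu> \<omega>) B = 0 \<longleftrightarrow> (\<forall>n. emeasure (\<nu> \<omega>) (?B n) = 0)" for \<omega>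
      unfolding emeasure_exhaust(1)[OF sets_\<nu> B, symmetric] by (simp flip: bot_ennreal)
    then show ?thesis by auto
  qed
  moreover have "range (\<lambda>n. {\<omega>\<in>space P. emeasure (\<nu> \<omega>) (?B n) = 0}) \<subseteq> sets P"
  proof (rule image_subsetI)
    fix n
    have [measurable]: "?B n \<in> sets borel" by (rule Bn)
    show "{\<omega>\<in>space P. emeasure (\<nu> \<omega>) (?B n) = 0} \<in> sets P" by measurable
  qed
  ultimately show "(\<lambda>n. prob {\<omega>\<in>space P. emeasure (\<nu> \<omega>) (?B n) = 0}) \<longlonglongrightarrow> prob {\<omega>\<in>space P. emeasure (\<nu> \<omega>) B = 0}"
    using finite_Lim_measure_decseq[OF _ dec] by simp
  have fin: "emeasure \<mu> (?B n) = ennreal (measure \<mu> (?B n))" for n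
    using \<mu>_bounded_finite[OF Bn] by (simp add: emeasure_eq_ennreal_measure less_top)
  have lim: "(\<lambda>n. ennreal (measure \<mu> (?B n))) \<longlonglongrightarrow> emeasure \<mu> B"
    using emeasure_exhaust(2)[OF sets_\<mu> B] by (simp only: fin)
  show "(\<lambda>n. prob {\<omega>\<in>space P. emeasure (\<nu> \<omega>) (?B n) = 0}) \<longlonglongrightarrow> (if emeasure \<mu> B = \<infinity> then 0 else exp (- measure \<mu> B))"
  proof (cases "emeasure \<mu> B = \<infinity>")
    case True
    have "filterlim (\<lambda>n. measure \<mu> (?B n)) at_top sequentially"
      using lim unfolding True by (simp add: ennreal_tendsto_top_eq_at_top)
    then have "(\<lambda>n. exp (- measure \<mu> (?B n))) \<longlonglongrightarrow> 0"
      by (intro filterlim_compose[OF exp_at_bot] filterlim_compose[OF filterlim_uminus_at_bot_at_top])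
    then show ?thesis using Bn True by (simp add: void_probability_bounded)
  next
    case False
    then have "emeasure \<mu> B = ennreal (measure \<mu> B)" by (simp add: emeasure_eq_ennreal_measure)
    then have "(\<lambda>n. measure \<mu> (?B n)) \<longlonglongrightarrow> measure \<mu> B" using lim by (simp add: tendsto_ennreal_iff)
    then have "(\<lambda>n. exp (- measure \<mu> (?B n))) \<longlonglongrightarrow> exp (- measure \<mu> B)" by (intro tendsto_intros)
    then show ?thesis using Bn False by (simp add: void_probability_bounded)
  qed
qed

lemma second_moment_rectangle:
  assumes A: "A \<in> sets borel" "bounded A" and B: "B \<in> sets borel" "bounded B" and "A \<inter> B = {}"
  shows "(\<integral>\<^sup>+\<omega>. emeasure (\<nu> \<omega>) A * emeasure (\<nu> \<omega>) B \<partial>P) = emeasure \<mu> A * emeasure \<mu> B"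
  using indep_vars_nn_integral[OF _ \<nu>_indep[OF assms]] mean_bounded[OF A] mean_bounded[OF B]
  by (simp add: lessThan_nat_numeral lessThan_Suc mult.commute numeral_2_eq_2)

abbreviation point_pair :: "nat \<times> nat \<Rightarrow> 'w \<Rightarrow> 'a \<times> 'a" where
  "point_pair ij \<omega> \<equiv> (S (fst ij) \<omega>, S (snd ij) \<omega>)"

definition pair_event :: "('a \<times> 'a) set \<Rightarrow> nat \<times> nat \<Rightarrow> 'w \<Rightarrow> bool" where
  "pair_event C ij \<omega> \<longleftrightarrow> enat (fst ij) < N \<omega> \<and> enat (snd ij) < N \<omega> \<and> (point_pair ij \<omega>) \<in> C"

lemma S_pair_measurable: "(\<lambda>\<omega>. (S i \<omega>, S j \<omega>)) \<in> P \<rightarrow>\<^sub>M borel"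
  by (simp add: borel_prod[symmetric])

lemma pair_event_measurable [measurable]:
  assumes "C \<in> sets borel"
  shows "Measurable.pred P (pair_event C ij)"
proof -
  note [measurable] = assms S_pair_measurable
  have "Measurable.pred borel (\<lambda>z. z \<in> C)" by measurable
  then have "Measurable.pred P (\<lambda>\<omega>. (point_pair ij \<omega>) \<in> C)"
    by (rule measurable_compose[OF S_pair_measurable])
  then show ?thesis unfolding pair_event_def by measurable
qed

abbreviation "pair_count X C \<omega> \<equiv> emeasure (count_space UNIV)
  {(i, j). i \<noteq> j \<and> enat i < N \<omega> \<and> enat j < N \<omega> \<and> (X i \<omega>, X j \<omega>) \<in> C}"

text \<open>On rectangles this is the independence of the counts in disjoint sets, and rectangles generate. The
  sum runs over ordered pairs of points with the first one in \<open>A\<close> and the second one in \<open>B\<close>.\<close>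

theorem second_moment:
  assumes A: "A \<in> sets borel" "bounded A" and B: "B \<in> sets borel" "bounded B" and disj: "A \<inter> B = {}"
    and f [measurable]: "f \<in> borel_measurable borel"
  shows "(\<integral>\<^sup>+\<omega>. (\<integral>\<^sup>+ij. of_bool (pair_event (A \<times> B) ij \<omega>) * f (point_pair ij \<omega>) \<partial>count_space UNIV) \<partial>P)
    = (\<integral>\<^sup>+z. f z * indicator (A \<times> B) z \<partial>(\<mu> \<Otimes>\<^sub>M \<mu>))"
proof -
  note [measurable] = A(1) B(1)
  have AB[measurable]: "A \<times> B \<in> sets borel" by (simp add: borel_prod[symmetric])
  define Q where "Q = count_space (UNIV :: (nat \<times> nat) set) \<Otimes>\<^sub>M P"
  define g where "g = (\<lambda>(ij, \<omega>). of_bool (pair_event (A \<times> B) ij \<omega>) :: ennreal)"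
  define \<phi> where "\<phi> = (\<lambda>(ij, \<omega>). (point_pair ij \<omega>))"
  define \<alpha> where "\<alpha> = distr (density Q g) borel \<phi>"
  have [measurable]: "g \<in> borel_measurable Q"
    unfolding Q_def g_def by (intro measurable_pair_measure_countable1) auto
  have [measurable]: "\<phi> \<in> Q \<rightarrow>\<^sub>M borel"
    unfolding Q_def \<phi>_def by (intro measurable_pair_measure_countable1) auto
  interpret CP: pair_sigma_finite "count_space (UNIV :: (nat \<times> nat) set)" P
    by (intro pair_sigma_finite.intro sigma_finite_measure_count_space_countable)
       (auto intro: prob_space_imp_sigma_finite prob_space_axioms)
  have \<alpha>_int: "(\<integral>\<^sup>+z. h z \<partial>\<alpha>) =
      (\<integral>\<^sup>+\<omega>. (\<integral>\<^sup>+ij. of_bool (pair_event (A \<times> B) ij \<omega>) * h (point_pair ij \<omega>) \<partial>count_space UNIV) \<partial>P)"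
    if [measurable]: "h \<in> borel_measurable borel" for h
  proof -
    have "(\<integral>\<^sup>+z. h z \<partial>\<alpha>) = (\<integral>\<^sup>+q. g q * h (\<phi> q) \<partial>Q)"
      unfolding \<alpha>_def by (simp add: nn_integral_distr nn_integral_density)
    also have "\<dots> = (\<integral>\<^sup>+\<omega>. (\<integral>\<^sup>+ij. g (ij, \<omega>) * h (\<phi> (ij, \<omega>)) \<partial>count_space UNIV) \<partial>P)"
      unfolding Q_def by (rule CP.nn_integral_snd[symmetric]) (auto simp: Q_def[symmetric] case_prod_beta)
    finally show ?thesis by (simp add: g_def \<phi>_def)
  qed
  interpret \<mu>\<mu>: pair_sigma_finite \<mu> \<mu> ..
  let ?\<beta> = "density (\<mu> \<Otimes>\<^sub>M \<mu>) (indicator (A \<times> B))"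
  have ABs: "A \<times> B \<in> sets (\<mu> \<Otimes>\<^sub>M \<mu>)" using AB sets_\<mu>_pair by simp
  have rect: "emeasure \<alpha> (a \<times> b) = emeasure \<mu> (a \<inter> A) * emeasure \<mu> (b \<inter> B)"
    if [measurable]: "a \<in> sets borel" "b \<in> sets borel" for a b
  proof -
    have ab[measurable]: "a \<times> b \<in> sets borel" by (simp add: borel_prod[symmetric])
    have "emeasure \<alpha> (a \<times> b) = (\<integral>\<^sup>+z. indicator (a \<times> b) z \<partial>\<alpha>)"
      using ab by (subst nn_integral_indicator) (auto simp: \<alpha>_def)
    also have "\<dots> = (\<integral>\<^sup>+\<omega>. (\<integral>\<^sup>+i. (\<integral>\<^sup>+j. indicator {i. enat i < N \<omega> \<and> S i \<omega> \<in> a \<inter> A} i *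
        indicator {j. enat j < N \<omega> \<and> S j \<omega> \<in> b \<inter> B} j \<partial>count_space UNIV) \<partial>count_space UNIV) \<partial>P)"
      unfolding \<alpha>_int[OF borel_measurable_indicator[OF ab]]
      by (subst nn_integral_fst_count_space[symmetric])
         (auto intro!: nn_integral_cong simp: pair_event_def indicator_def)
    also have "\<dots> = (\<integral>\<^sup>+\<omega>. emeasure (\<nu> \<omega>) (a \<inter> A) * emeasure (\<nu> \<omega>) (b \<inter> B) \<partial>P)"
      by (simp add: emeasure_\<nu> nn_integral_cmult nn_integral_multc del: nn_integral_indicator)
    also have "\<dots> = emeasure \<mu> (a \<inter> A) * emeasure \<mu> (b \<inter> B)"
      using A B disj by (intro second_moment_rectangle) (auto simp: bounded_Int)
    finally show ?thesis .
  qed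
  have "\<alpha> = ?\<beta>"
  proof (rule measure_eqI_generator_eq[where E="borel_rectangles"
        and \<Omega>=UNIV and A="\<lambda>_. UNIV"])
    show "Int_stable (borel_rectangles :: ('a \<times> 'a) set set)"
      by (rule Int_stable_pair_measure_generator)
    fix X assume "X \<in> (borel_rectangles :: ('a \<times> 'a) set set)"
    then obtain a b where [measurable]: "a \<in> sets borel" "b \<in> sets borel" and X: "X = a \<times> b" by auto
    have "emeasure ?\<beta> X = (\<integral>\<^sup>+z. indicator ((a \<inter> A) \<times> (b \<inter> B)) z \<partial>(\<mu> \<Otimes>\<^sub>M \<mu>))"
    proof -
      have "X \<in> sets (\<mu> \<Otimes>\<^sub>M \<mu>)" unfolding X sets_\<mu>_pair by (simp add: borel_prod[symmetric])
      then show ?thesis using ABs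
        by (subst emeasure_density) (auto intro!: nn_integral_cong simp: X indicator_def)
    qed
    also have "\<dots> = emeasure \<mu> (a \<inter> A) * emeasure \<mu> (b \<inter> B)"
      by (subst nn_integral_indicator) (auto simp: \<mu>.emeasure_pair_measure_Times sets_\<mu>)
    finally show "emeasure \<alpha> X = emeasure ?\<beta> X" using rect[of a b] X by simp
  next
    show "sets \<alpha> = sigma_sets UNIV borel_rectangles"
      "sets ?\<beta> = sigma_sets UNIV borel_rectangles"
      by (simp_all add: \<alpha>_def sets_\<mu>_pair, simp_all add: borel_prod[symmetric] sets_pair_measure)
    show "emeasure \<alpha> UNIV \<noteq> \<infinity>"
      using rect[of UNIV UNIV] \<mu>_bounded_finite[OF A] \<mu>_bounded_finite[OF B]
      by (simp add: ennreal_mult_eq_top_iff less_top)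
    show "range (\<lambda>_::nat. UNIV) \<subseteq> (borel_rectangles :: ('a \<times> 'a) set set)"
      by (auto intro!: exI[of _ UNIV])
  qed auto
  then have "(\<integral>\<^sup>+z. f z \<partial>\<alpha>) = (\<integral>\<^sup>+z. indicator (A \<times> B) z * f z \<partial>(\<mu> \<Otimes>\<^sub>M \<mu>))"
    using ABs by (simp add: nn_integral_density sets_\<mu>_pair cong: measurable_cong_sets)
  then show ?thesis unfolding \<alpha>_int[OF f] by (simp add: mult.commute)
qed

text \<open>Countably many products of disjoint bounded sets cover the complement of the diagonal, and in each
  of them the expected number of pairs that lie in \<open>R\<close> is \<open>0\<close> by \<open>second_moment\<close>.\<close>

theorem no_pairs_in_null_set:
  assumes R: "R \<in> sets borel" "emeasure (\<mu> \<Otimes>\<^sub>M \<mu>) R = 0"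
  shows "AE \<omega> in P. \<forall>i j. i \<noteq> j \<longrightarrow> enat i < N \<omega> \<longrightarrow> enat j < N \<omega> \<longrightarrow> (S i \<omega>, S j \<omega>) \<notin> R"
proof -
  have box: "AE \<omega> in P. \<forall>ij. pair_event (A \<times> B) ij \<omega> \<longrightarrow> (point_pair ij \<omega>) \<notin> R"
    if A: "A \<in> sets borel" "bounded A" and B: "B \<in> sets borel" "bounded B" and disj: "A \<inter> B = {}" for A B
  proof -
    note [measurable] = A(1) B(1) R(1)
    have AB[measurable]: "A \<times> B \<in> sets borel" by (simp add: borel_prod[symmetric])
    have "(\<integral>\<^sup>+\<omega>. (\<integral>\<^sup>+ij. of_bool (pair_event (A \<times> B) ij \<omega>) * indicator R (point_pair ij \<omega>) \<partial>count_space UNIV) \<partial>P) = 0"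
    proof (subst second_moment[OF A B disj])
      show "(\<integral>\<^sup>+z. indicator R z * indicator (A \<times> B) z \<partial>(\<mu> \<Otimes>\<^sub>M \<mu>)) = 0"
      proof (subst nn_integral_0_iff_AE)
        show "(\<lambda>z. indicator R z * indicator (A \<times> B) z :: ennreal) \<in> borel_measurable (\<mu> \<Otimes>\<^sub>M \<mu>)"
          by (subst measurable_cong_sets[OF sets_\<mu>_pair refl]) measurable
        show "AE z in \<mu> \<Otimes>\<^sub>M \<mu>. indicator R z * indicator (A \<times> B) z = (0 :: ennreal)"
          using R by (auto simp: sets_\<mu>_pair null_sets_def intro!: AE_I'[of R] split: split_indicator)
      qed
    qed measurable
    moreover have "(\<lambda>\<omega>. of_bool (pair_event (A \<times> B) ij \<omega>) * indicator R (point_pair ij \<omega>) :: ennreal)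
        \<in> borel_measurable P" for ij
    proof -
      have [measurable]: "(\<lambda>\<omega>. indicator R (point_pair ij \<omega>) :: ennreal) \<in> borel_measurable P"
        using measurable_compose[OF S_pair_measurable borel_measurable_indicator[OF R(1)]] .
      show ?thesis by measurable
    qed
    ultimately have "AE \<omega> in P. (\<integral>\<^sup>+ij. of_bool (pair_event (A \<times> B) ij \<omega>) *
        indicator R (point_pair ij \<omega>) \<partial>count_space UNIV) = (0 :: ennreal)"
      by (subst (asm) nn_integral_0_iff_AE) (auto intro: borel_measurable_count_space_integral)
    then show ?thesis
    proof eventually_elim
      case (elim \<omega>)
      then have *: "\<forall>ij. of_bool (pair_event (A \<times> B) ij \<omega>) *
          indicator R (point_pair ij \<omega>) = (0 :: ennreal)"
        by (subst (asm) nn_integral_0_iff_AE) (simp_all add: AE_count_space)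
      show ?case
      proof (intro allI impI notI)
        fix ij assume "pair_event (A \<times> B) ij \<omega>" "(point_pair ij \<omega>) \<in> R"
        then show False using *[THEN spec, of ij] by simp
      qed
    qed
  qed
  obtain U :: "'a set set" where U: "countable U" "topological_basis U"
    using ex_countable_basis by blast
  let ?J = "{(a, b). a \<in> U \<and> b \<in> U \<and> bounded a \<and> bounded b \<and> a \<inter> b = {}}"
  have "countable ?J" by (rule countable_subset[OF _ countable_SIGMA[OF U(1) U(1)]]) auto
  then have "AE \<omega> in P. \<forall>(A, B)\<in>?J. \<forall>ij. pair_event (A \<times> B) ij \<omega> \<longrightarrow> (point_pair ij \<omega>) \<notin> R"
    using box topological_basis_open[OF U(2)] by (subst AE_ball_countable) auto
  then show ?thesis using inj
  proof eventually_elim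
    case (elim \<omega>)
    show ?case
    proof (intro allI impI)
      fix i j assume ij: "i \<noteq> j" "enat i < N \<omega>" "enat j < N \<omega>"
      then have ne: "S i \<omega> \<noteq> S j \<omega>" using elim(2) by (auto simp: inj_on_def)
      have small: "\<exists>a\<in>U. z \<in> a \<and> a \<subseteq> ball z (dist (S i \<omega>) (S j \<omega>) / 2)" for z
      proof -
        have "z \<in> ball z (dist (S i \<omega>) (S j \<omega>) / 2)" using ne by simp
        then obtain a where "a \<in> U" "z \<in> a" "a \<subseteq> ball z (dist (S i \<omega>) (S j \<omega>) / 2)"
          by (rule topological_basisE[OF U(2) open_ball])
        then show ?thesis by (intro bexI[of _ a] conjI)
      qed
      obtain a where a: "a \<in> U" "S i \<omega> \<in> a" "a \<subseteq> ball (S i \<omega>) (dist (S i \<omega>) (S j \<omega>) / 2)"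
        using small[of "S i \<omega>"] by (elim bexE conjE)
      obtain b where b: "b \<in> U" "S j \<omega> \<in> b" "b \<subseteq> ball (S j \<omega>) (dist (S i \<omega>) (S j \<omega>) / 2)"
        using small[of "S j \<omega>"] by (elim bexE conjE)
      have "ball (S i \<omega>) (dist (S i \<omega>) (S j \<omega>) / 2) \<inter> ball (S j \<omega>) (dist (S i \<omega>) (S j \<omega>) / 2) = {}"
        by (rule disjoint_ballI) simp
      then have "a \<inter> b = {}" using a(3) b(3) by (meson disjoint_iff subsetD)
      then have "(a, b) \<in> ?J"
        using a b bounded_subset[OF bounded_ball a(3)] bounded_subset[OF bounded_ball b(3)] by simp
      then show "(S i \<omega>, S j \<omega>) \<notin> R"
        using elim(1)[THEN bspec, of "(a, b)"] a b ij by (auto simp: pair_event_def)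
    qed
  qed
qed

end

section \<open>Pairs of points and measure-preserving maps\<close>

text \<open>In order to transfer the law of a point process to the number of its pairs in \<open>C\<close>, this number must
  be a measurable functional of the measure. For finite measures \<open>M\<close> the mass \<open>(M \<otimes> M) C\<close> is measurable
  in \<open>M\<close> by a Dynkin argument; bounded windows reduce locally finite measures to finite ones. A window
  of infinite mass gets the value \<open>0\<close> only to make the functional total.\<close>

definition window_pair_mass :: "nat \<Rightarrow> ('a::polish_space \<times> 'a) set \<Rightarrow> 'a measure \<Rightarrow> ennreal" where
  "window_pair_mass n C M = (if emeasure M (bounded_exhaustion n) < \<infinity>
     then \<integral>\<^sup>+x. (\<integral>\<^sup>+y. indicator (C \<inter> bounded_exhaustion n \<times> bounded_exhaustion n) (x, y) \<partial>M) \<partial>M else 0)"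

definition pair_mass :: "('a::polish_space \<times> 'a) set \<Rightarrow> 'a measure \<Rightarrow> ennreal" where
  "pair_mass C M = (SUP n. window_pair_mass n C M)"

lemma sets_borel_pair_eq:
  "sets (borel :: ('a::second_countable_topology \<times> 'b::second_countable_topology) measure) =
     sigma_sets UNIV borel_rectangles"
  by (subst borel_prod[symmetric], subst sets_pair_measure) simp

lemma sets_borel_Times [simp, intro]:
  fixes a :: "'a::second_countable_topology set" and b :: "'b::second_countable_topology set"
  shows "a \<in> sets borel \<Longrightarrow> b \<in> sets borel \<Longrightarrow> a \<times> b \<in> sets borel"
  by (subst borel_prod[symmetric]) simp

lemma emeasure_density_indicator_Int:
  assumes "E \<in> sets M" "B \<in> sets M"
  shows "emeasure (density M (indicator E)) B = emeasure M (E \<inter> B)"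
proof -
  have "emeasure (density M (indicator E)) B = (\<integral>\<^sup>+x. indicator (E \<inter> B) x \<partial>M)"
    using assms by (subst emeasure_density) (auto intro!: nn_integral_cong simp del: nn_integral_indicator split: split_indicator)
  also have "\<dots> = emeasure M (E \<inter> B)" using assms by (intro nn_integral_indicator) auto
  finally show ?thesis .
qed

lemma window_pair_mass_measurable:
  fixes C :: "('a::polish_space \<times> 'a) set"
  assumes C: "C \<in> sets borel"
  shows "window_pair_mass n C \<in> borel_measurable (measure_algebra borel)"
proof -
  let ?K = "bounded_exhaustion n :: 'a set" and ?X = "measure_algebra borel :: 'a measure measure"
  define R where "R M = density M (indicator ?K)" for M :: "'a measure"
  define X where "X = {M\<in>space ?X. emeasure M ?K < \<infinity>}"
  have X_sets: "X \<in> sets ?X" unfolding X_def by measurable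
  have setsX: "sets M = sets borel" if "M \<in> X" for M
    using that by (simp add: X_def space_measure_algebra)
  have emR: "emeasure (R M) B = emeasure M (?K \<inter> B)" if "M \<in> X" "B \<in> sets borel" for M B
    unfolding R_def using setsX[OF that(1)] that(2) by (intro emeasure_density_indicator_Int) simp_all
  have fin: "finite_measure (R M)" if M: "M \<in> X" for M
  proof (rule finite_measureI)
    have "space (R M) = UNIV" using sets_eq_imp_space_eq[OF setsX[OF M]] by (simp add: R_def)
    then show "emeasure (R M) (space (R M)) \<noteq> \<infinity>" using emR[OF M, of UNIV] M by (simp add: X_def less_top)
  qed
  have setsRR: "sets (R M \<Otimes>\<^sub>M R M) = sets borel" if M: "M \<in> X" for M
  proof -
    have "sets (R M) = sets borel" using setsX[OF M] by (simp add: R_def)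
    then show ?thesis by (metis borel_prod sets_pair_measure_cong)
  qed
  have rect: "emeasure (R M \<Otimes>\<^sub>M R M) (a \<times> b) = emeasure M (?K \<inter> a) * emeasure M (?K \<inter> b)"
    if M: "M \<in> X" and ab: "a \<in> sets borel" "b \<in> sets borel" for M a b
  proof -
    interpret finite_measure "R M" by (rule fin[OF M])
    have "a \<in> sets (R M)" "b \<in> sets (R M)" using ab setsX[OF M] by (auto simp: R_def)
    then show ?thesis using emR[OF M] ab by (simp add: emeasure_pair_measure_Times)
  qed
  \<comment> \<open>Finiteness on the window is what makes the complement step of the Dynkin argument a subtraction.\<close>
  have meas: "(\<lambda>M. if M \<in> X then emeasure (R M \<Otimes>\<^sub>M R M) C else 0) \<in> borel_measurable ?X"
  proof (rule sigma_sets_induct_disjoint[where G="borel_rectangles" and \<Omega>=UNIV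
        and P="\<lambda>C. (\<lambda>M. if M \<in> X then emeasure (R M \<Otimes>\<^sub>M R M) C else 0) \<in> borel_measurable ?X"])
    show "Int_stable (borel_rectangles :: ('a \<times> 'a) set set)"
      by (rule Int_stable_pair_measure_generator)
    show "C \<in> sigma_sets UNIV borel_rectangles"
      using C by (simp only: sets_borel_pair_eq)
  next
    fix A assume "A \<in> (borel_rectangles :: ('a \<times> 'a) set set)"
    then obtain a b where [measurable]: "a \<in> sets (borel :: 'a measure)" "b \<in> sets (borel :: 'a measure)"
      and A: "A = a \<times> b" by blast
    have "(\<lambda>M. if M \<in> X then emeasure M (?K \<inter> a) * emeasure M (?K \<inter> b) else 0) \<in> borel_measurable ?X"
      using X_sets by measurable
    then show "(\<lambda>M. if M \<in> X then emeasure (R M \<Otimes>\<^sub>M R M) A else 0) \<in> borel_measurable ?X"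
      by (rule measurable_cong[THEN iffD1, rotated]) (simp add: A rect)
  next
    fix A :: "('a \<times> 'a) set" assume A: "A \<in> sigma_sets UNIV borel_rectangles"
      and IH: "(\<lambda>M. if M \<in> X then emeasure (R M \<Otimes>\<^sub>M R M) A else 0) \<in> borel_measurable ?X"
    have A': "A \<in> sets borel" using A by (simp only: sets_borel_pair_eq)
    have *: "(\<lambda>M. if M \<in> X then emeasure M ?K * emeasure M ?K else 0) \<in> borel_measurable ?X"
      using X_sets by measurable
    have "(\<lambda>M. (if M \<in> X then emeasure M ?K * emeasure M ?K else 0) -
             (if M \<in> X then emeasure (R M \<Otimes>\<^sub>M R M) A else 0)) \<in> borel_measurable ?X"
      using * IH by (rule borel_measurable_minus_ennreal)
    then show "(\<lambda>M. if M \<in> X then emeasure (R M \<Otimes>\<^sub>M R M) (UNIV - A) else 0) \<in> borel_measurable ?X"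
    proof (rule measurable_cong[THEN iffD1, rotated])
      fix M
      show "(if M \<in> X then emeasure M ?K * emeasure M ?K else 0) -
             (if M \<in> X then emeasure (R M \<Otimes>\<^sub>M R M) A else 0) =
            (if M \<in> X then emeasure (R M \<Otimes>\<^sub>M R M) (UNIV - A) else 0)"
      proof (cases "M \<in> X")
        case True
        interpret finite_measure "R M" by (rule fin[OF True])
        interpret RR: finite_measure "R M \<Otimes>\<^sub>M R M" by (rule finite_measure_pair_measure) (rule fin[OF True])+
        have "emeasure (R M \<Otimes>\<^sub>M R M) (UNIV - A) = emeasure (R M \<Otimes>\<^sub>M R M) UNIV - emeasure (R M \<Otimes>\<^sub>M R M) A"
          using A' setsRR[OF True] by (intro emeasure_Diff) auto
        also have "emeasure (R M \<Otimes>\<^sub>M R M) UNIV = emeasure M ?K * emeasure M ?K"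
          using rect[OF True, of UNIV UNIV] by simp
        finally show ?thesis using True by simp
      qed simp
    qed
  next
    fix A :: "nat \<Rightarrow> ('a \<times> 'a) set" assume A: "disjoint_family A"
      "range A \<subseteq> sigma_sets UNIV borel_rectangles"
      and IH: "\<And>i. (\<lambda>M. if M \<in> X then emeasure (R M \<Otimes>\<^sub>M R M) (A i) else 0) \<in> borel_measurable ?X"
    have A': "range A \<subseteq> sets borel" using A(2) by (simp only: sets_borel_pair_eq)
    have "(\<lambda>M. \<Sum>i. if M \<in> X then emeasure (R M \<Otimes>\<^sub>M R M) (A i) else 0) \<in> borel_measurable ?X"
      by (rule borel_measurable_suminf_order[OF IH])
    then show "(\<lambda>M. if M \<in> X then emeasure (R M \<Otimes>\<^sub>M R M) (\<Union>i. A i) else 0) \<in> borel_measurable ?X"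
      by (rule measurable_cong[THEN iffD1, rotated]) (use A(1) A' in \<open>simp add: suminf_emeasure setsRR\<close>)
  qed (simp_all cong: if_cong)
  show ?thesis
  proof (rule measurable_cong[THEN iffD1, OF _ meas])
    fix M assume M: "M \<in> space ?X"
    show "(if M \<in> X then emeasure (R M \<Otimes>\<^sub>M R M) C else 0) = window_pair_mass n C M"
    proof (cases "M \<in> X")
      case True
      interpret finite_measure "R M" by (rule fin[OF True])
      have sM: "sets M = sets borel" by (rule setsX[OF True])
      have C': "C \<in> sets (M \<Otimes>\<^sub>M M)" using C sM by (metis borel_prod sets_pair_measure_cong)
      have ind: "(indicator ?K :: _ \<Rightarrow> ennreal) \<in> borel_measurable M" using sM by simp
      have "emeasure (R M \<Otimes>\<^sub>M R M) C = (\<integral>\<^sup>+x. (\<integral>\<^sup>+y. indicator C (x, y) \<partial>R M) \<partial>R M)"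
        using C setsRR[OF True] by (intro emeasure_pair_measure) simp
      also have "\<dots> = (\<integral>\<^sup>+x. indicator ?K x * (\<integral>\<^sup>+y. indicator C (x, y) \<partial>R M) \<partial>M)"
      proof -
        have "(\<lambda>x. \<integral>\<^sup>+y. indicator C (x, y) \<partial>R M) \<in> borel_measurable M"
        proof -
          have "(\<lambda>z. indicator C z :: ennreal) \<in> borel_measurable (M \<Otimes>\<^sub>M R M)"
            using C' by (intro borel_measurable_indicator) (simp add: R_def sets_pair_measure_cong[OF refl, of "density M (indicator ?K)" M])
          then show ?thesis by (intro borel_measurable_nn_integral) (simp add: case_prod_beta')
        qed
        then show ?thesis unfolding R_def[of M] using ind by (intro nn_integral_density) (simp_all add: R_def)
      qed
      also have "\<dots> = (\<integral>\<^sup>+x. (\<integral>\<^sup>+y. indicator (C \<inter> ?K \<times> ?K) (x, y) \<partial>M) \<partial>M)"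
      proof (rule nn_integral_cong)
        fix x assume "x \<in> space M"
        have sec: "(\<lambda>y. indicator C (x, y) :: ennreal) \<in> borel_measurable M"
          using borel_measurable_indicator[OF sets_Pair1[OF C'], of x] unfolding indicator_vimage by (simp only: comp_def)
        have "indicator ?K x * (\<integral>\<^sup>+y. indicator C (x, y) \<partial>R M) = indicator ?K x * (\<integral>\<^sup>+y. indicator ?K y * indicator C (x, y) \<partial>M)"
          unfolding R_def using ind sec by (simp add: nn_integral_density)
        also have "\<dots> = (\<integral>\<^sup>+y. indicator ?K x * (indicator ?K y * indicator C (x, y)) \<partial>M)"
          using ind sec by (intro nn_integral_cmult[symmetric]) simp
        also have "\<dots> = (\<integral>\<^sup>+y. indicator (C \<inter> ?K \<times> ?K) (x, y) \<partial>M)"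
          by (intro nn_integral_cong) (auto split: split_indicator)
        finally show "indicator ?K x * (\<integral>\<^sup>+y. indicator C (x, y) \<partial>R M) = \<dots>" .
      qed
      finally show ?thesis using True by (simp add: window_pair_mass_def X_def)
    next
      case False
      then show ?thesis using M by (simp add: window_pair_mass_def X_def)
    qed
  qed
qed

lemma pair_mass_measurable:
  "C \<in> sets borel \<Longrightarrow> pair_mass C \<in> borel_measurable (measure_algebra borel)"
  unfolding pair_mass_def by (intro borel_measurable_SUP) (auto intro: window_pair_mass_measurable)

lemma nn_integral_dirac_sum:
  fixes I :: "'i set"
  assumes "f \<in> borel_measurable borel"
  shows "(\<integral>\<^sup>+z. f z \<partial>dirac_sum I x) = (\<integral>\<^sup>+i. f (x i) * indicator I i \<partial>count_space UNIV)"
proof -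
  have "(\<integral>\<^sup>+z. f z \<partial>dirac_sum I x) = (\<integral>\<^sup>+i. f (x i) \<partial>count_space I)"
    unfolding dirac_sum_def using assms by (intro nn_integral_distr) auto
  also have "\<dots> = (\<integral>\<^sup>+i. f (x i) * indicator I i \<partial>count_space UNIV)"
    by (simp add: nn_integral_count_space_indicator)
  finally show ?thesis .
qed

lemma pair_mass_dirac_sum:
  fixes x :: "nat \<Rightarrow> 'a::polish_space"
  assumes C: "C \<in> sets borel"
    and fin: "\<And>n. emeasure (dirac_sum I x) (bounded_exhaustion n) < \<infinity>"
  shows "pair_mass C (dirac_sum I x) = emeasure (count_space UNIV) {(i, j). i \<in> I \<and> j \<in> I \<and> (x i, x j) \<in> C}"
proof -
  let ?K = "bounded_exhaustion :: nat \<Rightarrow> 'a set" and ?M = "dirac_sum I x"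
  let ?D = "\<lambda>n. {(i, j). i \<in> I \<and> j \<in> I \<and> (x i, x j) \<in> C \<inter> ?K n \<times> ?K n}"
  have win: "window_pair_mass n C ?M = emeasure (count_space UNIV) (?D n)" for n
  proof -
    let ?C = "C \<inter> ?K n \<times> ?K n"
    have C': "?C \<in> sets borel" using C by auto
    then have Cp: "?C \<in> sets (borel \<Otimes>\<^sub>M borel)" by (simp only: borel_prod)
    have sec: "(\<lambda>v. indicator ?C (u, v) :: ennreal) \<in> borel_measurable borel" for u
      using borel_measurable_indicator[OF sets_Pair1[OF Cp], of u] unfolding indicator_vimage by (simp only: comp_def)
    interpret cs: sigma_finite_measure "count_space (UNIV :: nat set)"
      by (rule sigma_finite_measure_count_space_countable) simp
    have inner: "(\<integral>\<^sup>+v. indicator ?C (u, v) \<partial>?M) = (\<integral>\<^sup>+j. indicator ?C (u, x j) * indicator I j \<partial>count_space UNIV)" for u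
      by (rule nn_integral_dirac_sum[OF sec])
    have sec2: "(\<lambda>u. indicator ?C (u, v) :: ennreal) \<in> borel_measurable borel" for v
      using borel_measurable_indicator[OF sets_Pair2[OF Cp], of v] unfolding indicator_vimage by (simp only: comp_def)
    have "window_pair_mass n C ?M = (\<integral>\<^sup>+u. (\<integral>\<^sup>+j. indicator ?C (u, x j) * indicator I j \<partial>count_space UNIV) \<partial>?M)"
      using fin[of n] by (simp add: window_pair_mass_def inner)
    also have "\<dots> = (\<integral>\<^sup>+i. (\<integral>\<^sup>+j. indicator ?C (x i, x j) * indicator I j \<partial>count_space UNIV) * indicator I i \<partial>count_space UNIV)"
      using sec2 by (intro nn_integral_dirac_sum borel_measurable_count_space_integral borel_measurable_times_ennreal) auto
    also have "\<dots> = (\<integral>\<^sup>+i. (\<integral>\<^sup>+j. indicator (?D n) (i, j) \<partial>count_space UNIV) \<partial>count_space UNIV)"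
      by (subst nn_integral_multc[symmetric]) (auto intro!: nn_integral_cong split: split_indicator)
    also have "\<dots> = (\<integral>\<^sup>+ij. indicator (?D n) ij \<partial>count_space UNIV)"
      by (rule nn_integral_fst_count_space)
    also have "\<dots> = emeasure (count_space UNIV) (?D n)" by (rule nn_integral_indicator) simp
    finally show ?thesis .
  qed
  have "(SUP n. emeasure (count_space UNIV) (?D n)) = emeasure (count_space UNIV) (\<Union>n. ?D n)"
    using bounded_exhaustion_incseq by (intro SUP_emeasure_incseq) (auto simp: incseq_def)
  also have "(\<Union>n. ?D n) = {(i, j). i \<in> I \<and> j \<in> I \<and> (x i, x j) \<in> C}" (is "_ = ?R")
  proof
    show "?R \<subseteq> (\<Union>n. ?D n)"
    proof clarify
      fix i j assume ij: "i \<in> I" "j \<in> I" "(x i, x j) \<in> C"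
      obtain k l where "x i \<in> ?K k" "x j \<in> ?K l" using bounded_exhaustion_UN by blast
      then have "x i \<in> ?K (max k l)" "x j \<in> ?K (max k l)"
        using incseqD[OF bounded_exhaustion_incseq, of k "max k l"] incseqD[OF bounded_exhaustion_incseq, of l "max k l"] by auto
      then show "(i, j) \<in> (\<Union>n. ?D n)" using ij by blast
    qed
  qed blast
  finally show ?thesis by (simp add: pair_mass_def win)
qed

lemma distr_dirac_sum:
  assumes "T \<in> borel \<rightarrow>\<^sub>M borel"
  shows "distr (dirac_sum I x) borel T = dirac_sum I (T \<circ> x)"
  unfolding dirac_sum_def using assms by (subst distr_distr) auto

lemma measure_preservingD:
  assumes "measure_preserving \<mu> T"
  shows "T \<in> borel \<rightarrow>\<^sub>M borel" "B \<in> sets borel \<Longrightarrow> emeasure \<mu> (T -` B) = emeasure \<mu> B"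
    "B \<in> sets borel \<Longrightarrow> T -` B \<in> sets borel"
  using assms measurable_sets_borel[of T borel B] by (auto simp: measure_preserving_def)

lemma map_prod_borel_measurable:
  fixes T :: "'a::second_countable_topology \<Rightarrow> 'a"
  assumes "T \<in> borel \<rightarrow>\<^sub>M borel"
  shows "map_prod T T \<in> borel \<rightarrow>\<^sub>M borel"
proof -
  have "map_prod T T \<in> borel \<Otimes>\<^sub>M borel \<rightarrow>\<^sub>M borel \<Otimes>\<^sub>M borel"
    using assms by (simp add: map_prod_def case_prod_beta')
  then show ?thesis by (simp only: borel_prod)
qed

lemma diagonal_sets_borel:
  "{z. fst z = snd z} \<in> sets (borel :: ('a::{second_countable_topology, t2_space} \<times> 'a) measure)"
proof -
  have "{z :: 'a \<times> 'a. fst z = snd z} = {y. \<exists>x. y = (x, x)}" by (auto simp: prod_eq_iff)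
  moreover have "{y. \<exists>x :: 'a. y = (x, x)} \<in> sets borel" by (rule borel_closed[OF closed_diagonal])
  ultimately show ?thesis by (simp only:)
qed

context poisson_points
begin

text \<open>A measure-preserving map need not be injective, but \<open>\<mu> (T -` {T x}) = \<mu> {T x} = 0\<close>, so that
  it almost surely does not merge points.\<close>

lemma image_inj:
  assumes T: "measure_preserving \<mu> T"
  shows "AE \<omega> in P. inj_on (\<lambda>i. T (S i \<omega>)) {i. enat i < N \<omega>}"
proof -
  note T' = measure_preservingD[OF T]
  define R where "R = {z :: 'a \<times> 'a. T (fst z) = T (snd z)}"
  have R: "R \<in> sets borel"
  proof -
    from measurable_sets_borel[OF map_prod_borel_measurable[OF T'(1)] diagonal_sets_borel] show ?thesis
      by (simp add: R_def vimage_def)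
  qed
  have "emeasure (\<mu> \<Otimes>\<^sub>M \<mu>) R = (\<integral>\<^sup>+x. emeasure \<mu> (Pair x -` R) \<partial>\<mu>)"
    using R by (intro \<mu>.emeasure_pair_measure_alt) (simp add: sets_\<mu>_pair)
  also have "\<dots> = (\<integral>\<^sup>+x. 0 \<partial>\<mu>)"
  proof (rule nn_integral_cong)
    fix x
    have "Pair x -` R = T -` {T x}" by (auto simp: R_def)
    then show "emeasure \<mu> (Pair x -` R) = 0"
      using T'(2)[of "{T x}"] diffuse by (simp add: diffuse_def)
  qed
  finally have "emeasure (\<mu> \<Otimes>\<^sub>M \<mu>) R = 0" by simp
  from no_pairs_in_null_set[OF R this] show ?thesis
    by eventually_elim (auto simp: inj_on_def R_def)
qed

text \<open>The preimage of a bounded set under \<open>T\<close> may be unbounded, so the image is not a Poisson process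
  straight from the definition. But both \<open>\<nu>\<close> and its image are simple, and the void probabilities of
  \<open>\<nu>\<close> on arbitrary Borel sets depend on the mass of the set only.\<close>

theorem distr_image:
  assumes T: "measure_preserving \<mu> T"
  shows "distr P (measure_algebra borel) (\<lambda>\<omega>. distr (\<nu> \<omega>) borel T) = distr P (measure_algebra borel) \<nu>"
proof (rule distr_eq_if_void_probabilities_eq)
  note T' = measure_preservingD[OF T]
  show "prob_space P" by (rule prob_space_axioms)
  show "(\<lambda>\<omega>. distr (\<nu> \<omega>) borel T) \<in> P \<rightarrow>\<^sub>M measure_algebra borel"
    by (rule measurable_distr_kernel[OF \<nu>_measurable T'(1)])
  show "\<nu> \<in> P \<rightarrow>\<^sub>M measure_algebra borel" by (rule \<nu>_measurable)
  show "AE \<omega> in P. simple_counting (\<nu> \<omega>)"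
    using inj by eventually_elim (simp add: \<nu>_def simple_counting_dirac_sum)
  show "AE \<omega> in P. simple_counting (distr (\<nu> \<omega>) borel T)"
    using image_inj[OF T] by eventually_elim (simp add: \<nu>_def distr_dirac_sum T'(1) simple_counting_dirac_sum comp_def)
  fix B :: "'a set" assume B: "B \<in> sets borel"
  have "{\<omega>\<in>space P. emeasure (distr (\<nu> \<omega>) borel T) B = 0} = {\<omega>\<in>space P. emeasure (\<nu> \<omega>) (T -` B) = 0}"
    using emeasure_distr_kernel[OF \<nu>_measurable T'(1) B] by auto
  then show "prob {\<omega>\<in>space P. emeasure (distr (\<nu> \<omega>) borel T) B = 0} = prob {\<omega>\<in>space P. emeasure (\<nu> \<omega>) B = 0}"
    using void_probability[OF B] void_probability[OF T'(3)[OF B]] T'(2)[OF B] by (simp add: measure_def)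
qed

text \<open>The number of pairs of distinct points is the mass that the square of the point measure gives to
  \<open>C\<close> without the diagonal, provided that distinct indices carry distinct points, which holds before
  and after the application of \<open>T\<close>. So equality of the laws of the point processes suffices, although
  the counts are indexed by the enumeration.\<close>

theorem distr_pair_count_image:
  assumes T: "measure_preserving \<mu> T" and C: "C \<in> sets borel" and g: "g \<in> borel_measurable borel"
  shows "(\<integral>\<^sup>+\<omega>. g (pair_count (\<lambda>i \<omega>. T (S i \<omega>)) C \<omega>) \<partial>P) =
    (\<integral>\<^sup>+\<omega>. g (pair_count S C \<omega>) \<partial>P)"
proof -
  note T' = measure_preservingD[OF T]
  define D where "D = C - {z. fst z = snd z}"
  have D: "D \<in> sets borel" unfolding D_def using C diagonal_sets_borel by (rule sets.Diff)
  have h: "(\<lambda>M. g (pair_mass D M)) \<in> borel_measurable (measure_algebra borel)"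
    using measurable_compose[OF pair_mass_measurable[OF D] g] .
  have fin: "AE \<omega> in P. \<forall>n. emeasure (\<nu> \<omega>) (U -` bounded_exhaustion n) < \<infinity>"
    if "measure_preserving \<mu> U" for U
  proof -
    note U = measure_preservingD[OF that]
    have "AE \<omega> in P. emeasure (\<nu> \<omega>) (U -` bounded_exhaustion n) \<noteq> \<infinity>" for n
    proof (rule nn_integral_PInf_AE)
      show "(\<lambda>\<omega>. emeasure (\<nu> \<omega>) (U -` bounded_exhaustion n)) \<in> borel_measurable P"
        using U(3) by (intro \<nu>_measurable_emeasure) simp
      show "(\<integral>\<^sup>+\<omega>. emeasure (\<nu> \<omega>) (U -` bounded_exhaustion n) \<partial>P) \<noteq> \<infinity>"
        using U(2,3) \<mu>_bounded_finite[of "bounded_exhaustion n"] by (simp add: mean less_top)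
    qed
    then show ?thesis by (simp add: AE_all_countable less_top)
  qed
  have count: "pair_mass D (dirac_sum {i. enat i < N \<omega>} x) =
      pair_count (\<lambda>i _. x i) C \<omega>"
    if "inj_on x {i. enat i < N \<omega>}" "\<And>n. emeasure (dirac_sum {i. enat i < N \<omega>} x) (bounded_exhaustion n) < \<infinity>" for x \<omega>
    unfolding pair_mass_dirac_sum[OF D that(2)]
    by (rule arg_cong[where f="emeasure (count_space UNIV)"]) (use that(1) in \<open>auto simp: D_def inj_on_def\<close>)
  have "(\<integral>\<^sup>+\<omega>. g (pair_count (\<lambda>i \<omega>. T (S i \<omega>)) C \<omega>) \<partial>P) =
      (\<integral>\<^sup>+\<omega>. g (pair_mass D (distr (\<nu> \<omega>) borel T)) \<partial>P)"
  proof (rule nn_integral_cong_AE)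
    show "AE \<omega> in P. g (pair_count (\<lambda>i \<omega>. T (S i \<omega>)) C \<omega>) = g (pair_mass D (distr (\<nu> \<omega>) borel T))"
      using image_inj[OF T] fin[OF T] AE_space
    proof eventually_elim
      case (elim \<omega>)
      have eq: "distr (\<nu> \<omega>) borel T = dirac_sum {i. enat i < N \<omega>} (\<lambda>i. T (S i \<omega>))"
        unfolding \<nu>_def by (subst distr_dirac_sum[OF T'(1)]) (simp add: comp_def)
      have "emeasure (distr (\<nu> \<omega>) borel T) (bounded_exhaustion n) < \<infinity>" for n
        using elim by (subst emeasure_distr_kernel[OF \<nu>_measurable T'(1)]) simp_all
      then show ?case using count[OF elim(1)] by (simp only: eq)
    qed
  qed
  also have "\<dots> = (\<integral>\<^sup>+M. g (pair_mass D M) \<partial>distr P (measure_algebra borel) (\<lambda>\<omega>. distr (\<nu> \<omega>) borel T))"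
    by (subst nn_integral_distr[OF measurable_distr_kernel[OF \<nu>_measurable T'(1)]]) (use h in simp_all)
  also have "\<dots> = (\<integral>\<^sup>+\<omega>. g (pair_mass D (\<nu> \<omega>)) \<partial>P)"
    unfolding distr_image[OF T] by (subst nn_integral_distr[OF \<nu>_measurable]) (use h in simp_all)
  also have "\<dots> = (\<integral>\<^sup>+\<omega>. g (pair_count S C \<omega>) \<partial>P)"
  proof (rule nn_integral_cong_AE)
    have "measure_preserving \<mu> (\<lambda>x. x)" by (simp add: measure_preserving_def)
    from inj fin[OF this] show "AE \<omega> in P. g (pair_mass D (\<nu> \<omega>)) = g (pair_count S C \<omega>)"
    proof eventually_elim
      case (elim \<omega>)
      then show ?case using count[OF elim(1)] by (simp add: \<nu>_def)
    qed
  qed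
  finally show ?thesis .
qed

end

section \<open>Edges given the vertices\<close>

lemma nn_integral_count_space_swap:
  fixes f :: "'i::countable \<Rightarrow> 'w \<Rightarrow> ennreal"
  assumes "sigma_finite_measure M" and f: "\<And>i. f i \<in> borel_measurable M"
  shows "(\<integral>\<^sup>+\<omega>. (\<integral>\<^sup>+i. f i \<omega> \<partial>count_space UNIV) \<partial>M) = (\<integral>\<^sup>+i. (\<integral>\<^sup>+\<omega>. f i \<omega> \<partial>M) \<partial>count_space UNIV)"
proof -
  interpret pair_sigma_finite "count_space (UNIV :: 'i set)" M
    by (intro pair_sigma_finite.intro sigma_finite_measure_count_space_countable assms(1)) simp
  have "(\<lambda>(i, \<omega>). f i \<omega>) \<in> borel_measurable (count_space UNIV \<Otimes>\<^sub>M M)"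
    by (intro measurable_pair_measure_countable1) (use f in auto)
  from Fubini'[OF this] show ?thesis by simp
qed

locale poisson_graph = poisson_points P \<mu> N S
  for P :: "'w measure" and \<mu> :: "'a::polish_space measure" and N S +
  fixes W :: "'a \<times> 'a \<Rightarrow> real" and A :: "nat \<Rightarrow> nat \<Rightarrow> 'w \<Rightarrow> bool"
  assumes kernel: "connection_kernel W"
    and graph: "poisson_graph_process P \<mu> W N S A"
begin

lemma W_measurable [measurable]: "W \<in> borel_measurable borel"
  and W_nonneg: "0 \<le> W z" and W_le_1: "W z \<le> 1" and W_sym: "W (x, y) = W (y, x)"
  using kernel unfolding connection_kernel_def by (cases z; simp)+

lemma A_measurable [measurable]: "A i j \<in> P \<rightarrow>\<^sub>M count_space UNIV"
  and A_symmetric: "AE \<omega> in P. \<forall>i j. enat i < N \<omega> \<longrightarrow> enat j < N \<omega> \<longrightarrow> \<not> A i i \<omega> \<and> (A j i \<omega> \<longleftrightarrow> A i j \<omega>)"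
  and A_cond: "i < j \<Longrightarrow> AE \<omega> in P. enat j < N \<omega> \<longrightarrow>
      cond_prob P (vertex_algebra P N S) (\<lambda>\<omega>. A i j \<omega>) \<omega> = W (S i \<omega>, S j \<omega>)"
  and A_indep: "finite I \<Longrightarrow> I \<subseteq> {(i, j). i < j} \<Longrightarrow> AE \<omega> in P. (\<forall>(i, j)\<in>I. enat j < N \<omega>) \<longrightarrow>
      cond_prob P (vertex_algebra P N S) (\<lambda>\<omega>. \<forall>(i, j)\<in>I. A i j \<omega> \<in> E i j) \<omega> =
      (\<Prod>(i, j)\<in>I. cond_prob P (vertex_algebra P N S) (\<lambda>\<omega>. A i j \<omega> \<in> E i j) \<omega>)"
  using graph by (simp_all add: poisson_graph_process_def)

abbreviation "\<V> \<equiv> vertex_algebra P N S"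

lemma subalgebra_\<V>: "subalgebra P \<V>"
  by (rule subalgebra_vertex_algebra) measurable

lemma finite_measure_subalgebra_\<V>: "finite_measure_subalgebra P \<V>"
  by (intro finite_measure_subalgebra.intro finite_measure_subalgebra_axioms.intro finite_measure_axioms subalgebra_\<V>)

lemma space_\<V>: "space \<V> = space P"
  using subalgebra_\<V> by (simp add: subalgebra_def)

lemma sets_\<V>_sub: "H \<in> sets \<V> \<Longrightarrow> H \<in> sets P"
  using subalgebra_\<V> by (auto simp: subalgebra_def)

lemma N_\<V>: "N \<in> \<V> \<rightarrow>\<^sub>M count_space UNIV"
  and vertex_event_\<V>: "B \<in> sets borel \<Longrightarrow> {\<omega>\<in>space P. enat k < N \<omega> \<and> S k \<omega> \<in> B} \<in> sets \<V>"
proof -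
  let ?G = "{{\<omega> \<in> space P. N \<omega> = n} | n. True} \<union>
      {{\<omega> \<in> space P. enat k < N \<omega> \<and> S k \<omega> \<in> B} | k B. B \<in> sets borel}"
  have "?G \<subseteq> Pow (space P)" by blast
  then have eq: "sets \<V> = sigma_sets (space P) ?G"
    by (simp only: vertex_algebra_def sets_measure_of)
  show "{\<omega>\<in>space P. enat k < N \<omega> \<and> S k \<omega> \<in> B} \<in> sets \<V>" if "B \<in> sets borel"
    unfolding eq using that by (intro sigma_sets.Basic) blast
  have "N -` {n} \<inter> space P \<in> sets \<V>" for n
    unfolding eq by (intro sigma_sets.Basic) (auto simp: vimage_def)
  then show "N \<in> \<V> \<rightarrow>\<^sub>M count_space UNIV"
    by (subst measurable_count_space_eq2_countable) (auto simp: space_\<V>)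
qed

lemma pair_event_\<V>:
  assumes C: "C \<in> sets borel"
  shows "Measurable.pred \<V> (pair_event C ij)"
proof -
  note [measurable] = N_\<V>
  define x0 :: 'a where "x0 = undefined"
  define S' where "S' k \<omega> = (if enat k < N \<omega> then S k \<omega> else x0)" for k \<omega>
  have S': "S' k \<in> \<V> \<rightarrow>\<^sub>M borel" for k
  proof (rule measurableI)
    fix B :: "'a set" assume B: "B \<in> sets borel"
    have "S' k -` B \<inter> space \<V> = {\<omega>\<in>space P. enat k < N \<omega> \<and> S k \<omega> \<in> B} \<union> {\<omega>\<in>space \<V>. \<not> enat k < N \<omega> \<and> x0 \<in> B}"
      by (auto simp: S'_def space_\<V> split: if_splits)
    also have "\<dots> \<in> sets \<V>" by (intro sets.Un vertex_event_\<V> B) measurable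
    finally show "S' k -` B \<inter> space \<V> \<in> sets \<V>" .
  qed simp
  have "(\<lambda>\<omega>. (S' (fst ij) \<omega>, S' (snd ij) \<omega>)) \<in> \<V> \<rightarrow>\<^sub>M borel"
    using S' by (simp add: borel_prod[symmetric])
  moreover have "Measurable.pred borel (\<lambda>z. z \<in> C)"
    using C by (simp add: pred_def)
  ultimately have [measurable]: "Measurable.pred \<V> (\<lambda>\<omega>. (S' (fst ij) \<omega>, S' (snd ij) \<omega>) \<in> C)"
    by (rule measurable_compose)
  have "pair_event C ij = (\<lambda>\<omega>. enat (fst ij) < N \<omega> \<and> enat (snd ij) < N \<omega> \<and> (S' (fst ij) \<omega>, S' (snd ij) \<omega>) \<in> C)"
    by (auto simp: pair_event_def S'_def fun_eq_iff)
  then show ?thesis by simp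
qed

text \<open>The conditions on a graph process determine conditional probabilities only where the indices
  involved occur. So they are applied on events \<open>H\<close> of the vertex algebra on which this is the case.\<close>

lemma prob_via_cond_prob:
  assumes H: "H \<in> sets \<V>" and Q: "{\<omega>\<in>space P. Q \<omega>} \<in> sets P" and h: "h \<in> borel_measurable P"
    and AE: "AE \<omega> in P. \<omega> \<in> H \<longrightarrow> cond_prob P \<V> Q \<omega> = h \<omega>"
  shows "prob (H \<inter> {\<omega>\<in>space P. Q \<omega>}) = (\<integral>\<omega>. indicator H \<omega> * h \<omega> \<partial>P)"
proof -
  interpret vertices: finite_measure_subalgebra P \<V> by (rule finite_measure_subalgebra_\<V>)
  let ?Q = "{\<omega>\<in>space P. Q \<omega>}"
  have HP: "H \<in> sets P" using H by (rule sets_\<V>_sub)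
  have int: "integrable P (\<lambda>\<omega>. indicator H \<omega> * indicator ?Q \<omega> :: real)"
    using HP Q by (intro integrable_const_bound[where B=1]) (auto split: split_indicator)
  have "(\<integral>\<omega>. indicator H \<omega> * cond_prob P \<V> Q \<omega> \<partial>P) = (\<integral>\<omega>. indicator H \<omega> * indicator ?Q \<omega> \<partial>P)"
    unfolding cond_prob_def using H Q by (intro vertices.real_cond_exp_intg(2) int) auto
  also have "\<dots> = (\<integral>\<omega>. indicator (H \<inter> ?Q) \<omega> \<partial>P)"
    by (simp add: indicator_inter_arith)
  also have "\<dots> = prob (H \<inter> ?Q)"
    using HP Q by simp
  finally have "prob (H \<inter> ?Q) = (\<integral>\<omega>. indicator H \<omega> * cond_prob P \<V> Q \<omega> \<partial>P)" ..
  also have "\<dots> = (\<integral>\<omega>. indicator H \<omega> * h \<omega> \<partial>P)"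
  proof (rule integral_cong_AE)
    show "(\<lambda>\<omega>. indicator H \<omega> * cond_prob P \<V> Q \<omega>) \<in> borel_measurable P"
      unfolding cond_prob_def using HP by simp
    show "(\<lambda>\<omega>. indicator H \<omega> * h \<omega>) \<in> borel_measurable P"
      using HP h by simp
    show "AE \<omega> in P. indicator H \<omega> * cond_prob P \<V> Q \<omega> = indicator H \<omega> * h \<omega>"
      using AE by eventually_elim (auto split: split_indicator)
  qed
  finally show ?thesis .
qed

lemma W_S_measurable: "(\<lambda>\<omega>. W (S i \<omega>, S j \<omega>)) \<in> borel_measurable P"
  using measurable_compose[OF S_pair_measurable W_measurable] .

lemma prob_edge:
  assumes "i < j" and H: "H \<in> sets \<V>" "\<And>\<omega>. \<omega> \<in> H \<Longrightarrow> enat j < N \<omega>"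
  shows "prob (H \<inter> {\<omega>\<in>space P. A i j \<omega>}) = (\<integral>\<omega>. indicator H \<omega> * W (S i \<omega>, S j \<omega>) \<partial>P)"
proof (rule prob_via_cond_prob[OF H(1) _ W_S_measurable])
  show "{\<omega>\<in>space P. A i j \<omega>} \<in> sets P" by measurable
  show "AE \<omega> in P. \<omega> \<in> H \<longrightarrow> cond_prob P \<V> (A i j) \<omega> = W (S i \<omega>, S j \<omega>)"
    using A_cond[OF assms(1)] by eventually_elim (use H(2) in auto)
qed

lemma cond_prob_no_edge:
  assumes "i < j"
  shows "AE \<omega> in P. enat j < N \<omega> \<longrightarrow> cond_prob P \<V> (\<lambda>\<omega>. A i j \<omega> \<in> {False}) \<omega> = 1 - W (S i \<omega>, S j \<omega>)"
proof -
  interpret vertices: finite_measure_subalgebra P \<V> by (rule finite_measure_subalgebra_\<V>)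
  let ?a = "indicator {\<omega>\<in>space P. A i j \<omega>} :: 'w \<Rightarrow> real" and ?n = "indicator {\<omega>\<in>space P. A i j \<omega> \<in> {False}} :: 'w \<Rightarrow> real"
  have [measurable]: "{\<omega>\<in>space P. A i j \<omega>} \<in> sets P" "{\<omega>\<in>space P. A i j \<omega> \<in> {False}} \<in> sets P"
    by (simp_all, measurable)
  have "AE \<omega> in P. real_cond_exp P \<V> ?n \<omega> = real_cond_exp P \<V> (\<lambda>\<omega>. 1 - ?a \<omega>) \<omega>"
    by (intro vertices.real_cond_exp_cong) (auto split: split_indicator intro!: AE_I2)
  moreover have "integrable P ?a" by (intro integrable_const_bound[where B=1]) auto
  then have "AE \<omega> in P. real_cond_exp P \<V> (\<lambda>\<omega>. 1 - ?a \<omega>) \<omega> = real_cond_exp P \<V> (\<lambda>\<omega>. 1) \<omega> - real_cond_exp P \<V> ?a \<omega>"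
    by (intro vertices.real_cond_exp_diff) auto
  moreover have "AE \<omega> in P. real_cond_exp P \<V> (\<lambda>\<omega>. 1) \<omega> = (1::real)"
    by (intro vertices.real_cond_exp_F_meas) auto
  ultimately show ?thesis using A_cond[OF assms]
    unfolding cond_prob_def by eventually_elim auto
qed

lemma prob_no_edges:
  assumes I: "finite I" "I \<subseteq> {(i, j). i < j}"
    and H: "H \<in> sets \<V>" "\<And>\<omega> i j. \<omega> \<in> H \<Longrightarrow> (i, j) \<in> I \<Longrightarrow> enat j < N \<omega>"
  shows "prob (H \<inter> {\<omega>\<in>space P. \<forall>(i, j)\<in>I. \<not> A i j \<omega>}) =
    (\<integral>\<omega>. indicator H \<omega> * (\<Prod>(i, j)\<in>I. 1 - W (S i \<omega>, S j \<omega>)) \<partial>P)"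
proof -
  have eq: "(\<forall>(i, j)\<in>I. \<not> A i j \<omega>) \<longleftrightarrow> (\<forall>(i, j)\<in>I. A i j \<omega> \<in> {False})" for \<omega> by auto
  show ?thesis unfolding eq
  proof (rule prob_via_cond_prob[OF H(1)])
    have "{\<omega>\<in>space P. \<forall>ij\<in>I. \<not> A (fst ij) (snd ij) \<omega>} \<in> sets P"
      using I(1) by measurable
    then show "{\<omega>\<in>space P. \<forall>(i, j)\<in>I. A i j \<omega> \<in> {False}} \<in> sets P"
      by (simp add: case_prod_beta')
    show "(\<lambda>\<omega>. \<Prod>(i, j)\<in>I. 1 - W (S i \<omega>, S j \<omega>)) \<in> borel_measurable P"
      unfolding case_prod_beta by (intro borel_measurable_prod borel_measurable_diff W_S_measurable) simp
    have "AE \<omega> in P. \<forall>ij\<in>I. enat (snd ij) < N \<omega> \<longrightarrow>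
        cond_prob P \<V> (\<lambda>\<omega>. A (fst ij) (snd ij) \<omega> \<in> {False}) \<omega> = 1 - W (point_pair ij \<omega>)"
      using I cond_prob_no_edge by (intro AE_finite_allI) auto
    with A_indep[OF I, of "\<lambda>_ _. {False}"]
    show "AE \<omega> in P. \<omega> \<in> H \<longrightarrow> cond_prob P \<V> (\<lambda>\<omega>. \<forall>(i, j)\<in>I. A i j \<omega> \<in> {False}) \<omega> =
        (\<Prod>(i, j)\<in>I. 1 - W (S i \<omega>, S j \<omega>))"
    proof eventually_elim
      case (elim \<omega>)
      show ?case
      proof
        assume "\<omega> \<in> H"
        then have N: "\<forall>(i, j)\<in>I. enat j < N \<omega>" using H(2) by auto
        with elim(1) have "cond_prob P \<V> (\<lambda>\<omega>. \<forall>(i, j)\<in>I. A i j \<omega> \<in> {False}) \<omega> =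
            (\<Prod>(i, j)\<in>I. cond_prob P \<V> (\<lambda>\<omega>. A i j \<omega> \<in> {False}) \<omega>)" by simp
        also have "\<dots> = (\<Prod>(i, j)\<in>I. 1 - W (S i \<omega>, S j \<omega>))"
        proof (rule prod.cong[OF refl], clarsimp simp only: prod.case)
          fix i j assume "(i, j) \<in> I"
          then show "cond_prob P \<V> (\<lambda>\<omega>. A i j \<omega> \<in> {False}) \<omega> = 1 - W (S i \<omega>, S j \<omega>)"
            using elim(2)[THEN bspec, of "(i, j)"] N[THEN bspec, of "(i, j)"] by simp
        qed
        finally show "cond_prob P \<V> (\<lambda>\<omega>. \<forall>(i, j)\<in>I. A i j \<omega> \<in> {False}) \<omega> = \<dots>" .
      qed
    qed
  qed
qed


section \<open>The first moment of the edge measure\<close>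

lemma emeasure_edge_measure:
  assumes "C \<in> sets borel"
  shows "emeasure (edge_measure N S A \<omega>) C =
    (\<integral>\<^sup>+ij. of_bool (pair_event C ij \<omega> \<and> A (fst ij) (snd ij) \<omega>) \<partial>count_space UNIV)"
proof -
  have "emeasure (edge_measure N S A \<omega>) C = emeasure (count_space UNIV)
      {ij. pair_event C ij \<omega> \<and> A (fst ij) (snd ij) \<omega>}"
    unfolding edge_measure_def emeasure_dirac_sum_card[OF assms]
    by (rule arg_cong[where f="emeasure (count_space UNIV)"]) (auto simp: pair_event_def)
  also have "\<dots> = (\<integral>\<^sup>+ij. indicator {ij. pair_event C ij \<omega> \<and> A (fst ij) (snd ij) \<omega>} ij \<partial>count_space UNIV)"
    by (rule nn_integral_indicator[symmetric]) simp
  finally show ?thesis by (simp add: indicator_def of_bool_def)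
qed

lemma edge_mean_less:
  assumes "i < j" and C: "C \<in> sets borel"
  shows "(\<integral>\<^sup>+\<omega>. of_bool (pair_event C (i, j) \<omega> \<and> A i j \<omega>) \<partial>P) =
    (\<integral>\<^sup>+\<omega>. of_bool (pair_event C (i, j) \<omega>) * ennreal (W (S i \<omega>, S j \<omega>)) \<partial>P)"
proof -
  define H where "H = {\<omega>\<in>space P. pair_event C (i, j) \<omega>}"
  have H: "H \<in> sets \<V>" using pair_event_\<V>[OF C, of "(i, j)"] by (simp add: H_def pred_def space_\<V>)
  then have HP: "H \<in> sets P" by (rule sets_\<V>_sub)
  have [measurable]: "{\<omega>\<in>space P. A i j \<omega>} \<in> sets P" by measurable
  have "(\<integral>\<^sup>+\<omega>. of_bool (pair_event C (i, j) \<omega> \<and> A i j \<omega>) \<partial>P) = (\<integral>\<^sup>+\<omega>. indicator (H \<inter> {\<omega>\<in>space P. A i j \<omega>}) \<omega> \<partial>P)"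
    by (intro nn_integral_cong) (auto simp: H_def)
  also have "\<dots> = emeasure P (H \<inter> {\<omega>\<in>space P. A i j \<omega>})"
    using HP by (intro nn_integral_indicator) auto
  also have "\<dots> = ennreal (\<integral>\<omega>. indicator H \<omega> * W (S i \<omega>, S j \<omega>) \<partial>P)"
    unfolding emeasure_eq_measure by (subst prob_edge[OF assms(1) H]) (auto simp: H_def pair_event_def)
  also have "\<dots> = (\<integral>\<^sup>+\<omega>. ennreal (indicator H \<omega> * W (S i \<omega>, S j \<omega>)) \<partial>P)"
    using HP W_S_measurable W_nonneg W_le_1
    by (intro nn_integral_eq_integral[symmetric] integrable_const_bound[where B=1])
       (auto split: split_indicator)
  also have "\<dots> = (\<integral>\<^sup>+\<omega>. of_bool (pair_event C (i, j) \<omega>) * ennreal (W (S i \<omega>, S j \<omega>)) \<partial>P)"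
    by (intro nn_integral_cong) (auto simp: H_def)
  finally show ?thesis .
qed

lemma swap_sets_borel:
  fixes C :: "('a \<times> 'a) set"
  assumes "C \<in> sets borel"
  shows "prod.swap -` C \<in> sets borel"
proof -
  have swap: "prod.swap = (\<lambda>(x, y). (y, x :: 'a) :: 'a \<times> 'a)" by auto
  have "prod.swap \<in> borel \<Otimes>\<^sub>M borel \<rightarrow>\<^sub>M (borel \<Otimes>\<^sub>M borel :: ('a \<times> 'a) measure)"
    unfolding swap by (rule measurable_pair_swap')
  then have "prod.swap \<in> borel \<rightarrow>\<^sub>M (borel :: ('a \<times> 'a) measure)" by (simp only: borel_prod)
  from measurable_sets_borel[OF this assms] show ?thesis .
qed

text \<open>The kernel prescribes \<open>A i j\<close> for \<open>i < j\<close> only; the other order follows by the symmetry of \<open>A\<close> and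
  of \<open>W\<close>.\<close>

lemma edge_mean:
  assumes "i \<noteq> j" and C: "C \<in> sets borel"
  shows "(\<integral>\<^sup>+\<omega>. of_bool (pair_event C (i, j) \<omega> \<and> A i j \<omega>) \<partial>P) =
    (\<integral>\<^sup>+\<omega>. of_bool (pair_event C (i, j) \<omega>) * ennreal (W (S i \<omega>, S j \<omega>)) \<partial>P)"
proof (cases "i < j")
  case True
  then show ?thesis using C by (rule edge_mean_less)
next
  case False
  then have ji: "j < i" using assms by simp
  let ?C = "prod.swap -` C"
  have sw: "pair_event C (i, j) \<omega> \<longleftrightarrow> pair_event ?C (j, i) \<omega>" for \<omega> by (auto simp: pair_event_def)
  have "(\<integral>\<^sup>+\<omega>. of_bool (pair_event C (i, j) \<omega> \<and> A i j \<omega>) \<partial>P) = (\<integral>\<^sup>+\<omega>. of_bool (pair_event ?C (j, i) \<omega> \<and> A j i \<omega>) \<partial>P)"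
  proof (rule nn_integral_cong_AE)
    show "AE \<omega> in P. (of_bool (pair_event C (i, j) \<omega> \<and> A i j \<omega>) :: ennreal) = of_bool (pair_event ?C (j, i) \<omega> \<and> A j i \<omega>)"
      using A_symmetric
    proof eventually_elim
      case (elim \<omega>)
      have "pair_event C (i, j) \<omega> \<and> A i j \<omega> \<longleftrightarrow> pair_event ?C (j, i) \<omega> \<and> A j i \<omega>"
        using elim[THEN spec, of i, THEN spec, of j] sw[of \<omega>] by (auto simp: pair_event_def)
      then show ?case by simp
    qed
  qed
  also have "\<dots> = (\<integral>\<^sup>+\<omega>. of_bool (pair_event ?C (j, i) \<omega>) * ennreal (W (S j \<omega>, S i \<omega>)) \<partial>P)"
    by (rule edge_mean_less[OF ji swap_sets_borel[OF C]])
  finally show ?thesis by (simp add: sw W_sym[of "S j _"])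
qed

theorem edge_measure_mean:
  assumes D: "D \<in> sets borel" "bounded D" and B: "B \<in> sets borel" "bounded B" and disj: "D \<inter> B = {}"
  shows "(\<integral>\<^sup>+\<omega>. emeasure (edge_measure N S A \<omega>) (D \<times> B) \<partial>P) =
    (\<integral>\<^sup>+z. ennreal (W z) * indicator (D \<times> B) z \<partial>(\<mu> \<Otimes>\<^sub>M \<mu>))"
proof -
  have DB: "D \<times> B \<in> sets borel" using D B by simp
  have sf: "sigma_finite_measure P" ..
  have m1: "(\<lambda>\<omega>. of_bool (pair_event (D \<times> B) ij \<omega> \<and> A (fst ij) (snd ij) \<omega>) :: ennreal) \<in> borel_measurable P" for ij
    using pair_event_measurable[OF DB] by measurable
  have m2: "(\<lambda>\<omega>. of_bool (pair_event (D \<times> B) ij \<omega>) * ennreal (W (point_pair ij \<omega>))) \<in> borel_measurable P" for ij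
  proof -
    note [measurable] = pair_event_measurable[OF DB] W_S_measurable
    show ?thesis by measurable
  qed
  have "(\<integral>\<^sup>+\<omega>. emeasure (edge_measure N S A \<omega>) (D \<times> B) \<partial>P) =
      (\<integral>\<^sup>+ij. (\<integral>\<^sup>+\<omega>. of_bool (pair_event (D \<times> B) ij \<omega> \<and> A (fst ij) (snd ij) \<omega>) \<partial>P) \<partial>count_space UNIV)"
    unfolding emeasure_edge_measure[OF DB] by (rule nn_integral_count_space_swap[OF sf m1])
  also have "\<dots> = (\<integral>\<^sup>+ij. (\<integral>\<^sup>+\<omega>. of_bool (pair_event (D \<times> B) ij \<omega>) * ennreal (W (point_pair ij \<omega>)) \<partial>P) \<partial>count_space UNIV)"
  proof (rule nn_integral_cong)
    fix ij :: "nat \<times> nat"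
    obtain i j where ij: "ij = (i, j)" by fastforce
    show "(\<integral>\<^sup>+\<omega>. of_bool (pair_event (D \<times> B) ij \<omega> \<and> A (fst ij) (snd ij) \<omega>) \<partial>P) =
      (\<integral>\<^sup>+\<omega>. of_bool (pair_event (D \<times> B) ij \<omega>) * ennreal (W (point_pair ij \<omega>)) \<partial>P)"
    proof (cases "i = j")
      case True
      have "\<not> pair_event (D \<times> B) ij \<omega>" for \<omega>
        using disj by (auto simp: pair_event_def ij True)
      then show ?thesis by simp
    next
      case False
      from edge_mean[OF this DB] show ?thesis by (simp add: ij)
    qed
  qed
  also have "\<dots> = (\<integral>\<^sup>+\<omega>. (\<integral>\<^sup>+ij. of_bool (pair_event (D \<times> B) ij \<omega>) * ennreal (W (point_pair ij \<omega>)) \<partial>count_space UNIV) \<partial>P)"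
    by (rule nn_integral_count_space_swap[OF sf m2, symmetric])
  also have "\<dots> = (\<integral>\<^sup>+z. ennreal (W z) * indicator (D \<times> B) z \<partial>(\<mu> \<Otimes>\<^sub>M \<mu>))"
    by (rule second_moment[OF D B disj]) measurable
  finally show ?thesis .
qed

end

section \<open>A constant kernel gives an exchangeable edge measure\<close>

text \<open>The power \<open>(1 - c) ^ (l / 2)\<close> extended to \<open>l = \<infinity>\<close> by its limit. Here \<open>l\<close> will count each
  unordered pair of vertices twice, which is the reason for the square root.\<close>

definition no_edge_weight :: "real \<Rightarrow> ennreal \<Rightarrow> real" where
  "no_edge_weight c l = (if l = \<infinity> then of_bool (c = 0) else sqrt (1 - c) ^ nat \<lfloor>enn2real l\<rfloor>)"

lemma no_edge_weight_measurable [measurable]: "no_edge_weight c \<in> borel_measurable borel"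
proof -
  have "(\<lambda>l. nat \<lfloor>enn2real l\<rfloor>) \<in> borel \<rightarrow>\<^sub>M count_space UNIV" by measurable
  then have "(\<lambda>l. sqrt (1 - c) ^ nat \<lfloor>enn2real l\<rfloor>) \<in> borel_measurable borel"
    by (rule measurable_compose) simp
  then show ?thesis unfolding no_edge_weight_def by measurable
qed

lemma no_edge_weight_of_nat: "no_edge_weight c (of_nat m) = sqrt (1 - c) ^ m"
  by (simp add: no_edge_weight_def ennreal_of_nat_eq_real_of_nat)

lemma no_edge_weight_bounds:
  assumes "0 \<le> c" "c \<le> 1"
  shows "0 \<le> no_edge_weight c l" "no_edge_weight c l \<le> 1"
  using assms by (auto simp: no_edge_weight_def intro!: power_le_one)

lemma filterlim_card_at_top:
  fixes K :: "nat \<Rightarrow> 'i set"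
  assumes inf: "infinite (\<Union>n. K n)" and inc: "incseq K" and fin: "\<And>n. finite (K n)"
  shows "filterlim (\<lambda>n. card (K n)) at_top sequentially"
  unfolding filterlim_at_top
proof
  fix Z :: nat
  obtain F where F: "F \<subseteq> (\<Union>n. K n)" "finite F" "card F = Z"
    using infinite_arbitrarily_large[OF inf] by blast
  have "\<forall>x\<in>F. \<exists>n. x \<in> K n" using F(1) by auto
  from bchoice[OF this] obtain m where m: "\<forall>x\<in>F. x \<in> K (m x)" ..
  have n: "F \<subseteq> K (Max (m ` F))" (is "_ \<subseteq> K ?n")
  proof
    fix x assume x: "x \<in> F"
    then have "m x \<le> ?n" using F(2) by (intro Max_ge) simp_all
    then show "x \<in> K ?n" using m x incseqD[OF inc] by blast
  qed
  show "\<forall>\<^sub>F n in sequentially. Z \<le> card (K n)"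
  proof (rule eventually_sequentiallyI)
    fix m assume "?n \<le> m"
    then have "F \<subseteq> K m" using n incseqD[OF inc] by blast
    then show "Z \<le> card (K m)" using F(3) card_mono[OF fin] by metis
  qed
qed

context poisson_graph
begin

text \<open>Each unordered pair of vertices is represented once, by its increasing enumeration, because the
  edge variables of a pair are independent only across different unordered pairs.\<close>

definition linked_pairs :: "('a \<times> 'a) set \<Rightarrow> 'w \<Rightarrow> (nat \<times> nat) set" where
  "linked_pairs C \<omega> = {(i, j). i < j \<and> pair_event C (i, j) \<omega>}"

abbreviation "linked_below C n \<omega> \<equiv> {(i, j)\<in>linked_pairs C \<omega>. j < n}"

lemma tendsto_no_edge_weight:
  assumes c: "0 \<le> c" "c \<le> 1" and sym: "prod.swap -` C = C"
  shows "(\<lambda>n. (1 - c) ^ card (linked_below C n \<omega>)) \<longlonglongrightarrow>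
    no_edge_weight c (pair_count S C \<omega>)"
    (is "_ \<longlonglongrightarrow> no_edge_weight c (emeasure _ ?L)")
proof -
  let ?K = "linked_pairs C \<omega>" and ?Kn = "\<lambda>n. linked_below C n \<omega>"
  have fin: "finite (?Kn n)" for n
    by (rule finite_subset[of _ "{..<n} \<times> {..<n}"]) (auto simp: linked_pairs_def)
  have inc: "incseq ?Kn" by (auto simp: incseq_def)
  have UN: "(\<Union>n. ?Kn n) = ?K" by auto
  have C_iff: "(x, y) \<in> C \<longleftrightarrow> (y, x) \<in> C" for x y using sym by auto
  have L: "?L = ?K \<union> prod.swap ` ?K"
    using C_iff by (auto simp: linked_pairs_def pair_event_def image_iff not_less_iff_gr_or_eq)
  have disj: "?K \<inter> prod.swap ` ?K = {}" by (auto simp: linked_pairs_def)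
  show ?thesis
  proof (cases "finite ?K")
    case True
    have "card ?L = 2 * card ?K"
      unfolding L using True disj by (simp add: card_Un_disjoint card_image)
    moreover have "finite ?L" unfolding L using True by simp
    ultimately have "no_edge_weight c (emeasure (count_space UNIV) ?L) = (1 - c) ^ card ?K"
      using c by (simp add: no_edge_weight_of_nat power_mult del: of_nat_mult)
    moreover have "\<forall>\<^sub>F n in sequentially. (1 - c) ^ card (?Kn n) = (1 - c) ^ card ?K"
    proof (rule eventually_sequentiallyI)
      fix n assume n: "Suc (Max (snd ` ?K)) \<le> n"
      have "j < n" if "(i, j) \<in> ?K" for i j
      proof -
        have "j \<le> Max (snd ` ?K)" using True that by (intro Max_ge) force+
        then show ?thesis using n by simp
      qed
      then have "?Kn n = ?K" by auto
      then show "(1 - c) ^ card (?Kn n) = (1 - c) ^ card ?K" by simp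
    qed
    ultimately show ?thesis by (simp add: tendsto_eventually)
  next
    case False
    have "filterlim (\<lambda>n. card (?Kn n)) at_top sequentially"
      by (rule filterlim_card_at_top) (simp_all only: UN False inc fin not_False_eq_True)
    moreover have "infinite ?L" unfolding L using False by simp
    then have "no_edge_weight c (emeasure (count_space UNIV) ?L) = of_bool (c = 0)"
      by (simp add: no_edge_weight_def)
    moreover have "(\<lambda>m. (1 - c) ^ m) \<longlonglongrightarrow> of_bool (c = 0)"
      using c by (cases "c = 0") (auto intro!: LIMSEQ_power_zero)
    ultimately show ?thesis
      using filterlim_compose[of "\<lambda>m. (1 - c) ^ m" "nhds (of_bool (c = 0))" sequentially "\<lambda>n. card (?Kn n)" sequentially]
      by (simp only:)
  qed
qed

text \<open>The set \<open>J\<close> of the pairs with indices below \<open>n\<close> that hit \<open>C\<close> is determined by the vertices and takes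
  finitely many values; on each event on which it is fixed, the conditional independence of the edges
  applies to exactly these pairs.\<close>

lemma prob_no_linked_edges:
  assumes C: "C \<in> sets borel" and c: "AE z in \<mu> \<Otimes>\<^sub>M \<mu>. W z = c"
  shows "prob {\<omega>\<in>space P. \<forall>(i, j)\<in>linked_pairs C \<omega>. j < n \<longrightarrow> \<not> A i j \<omega>} =
    (\<integral>\<omega>. (1 - c) ^ card (linked_below C n \<omega>) \<partial>P)"
    and "{\<omega>\<in>space P. \<forall>(i, j)\<in>linked_pairs C \<omega>. j < n \<longrightarrow> \<not> A i j \<omega>} \<in> sets P"
    and "(\<lambda>\<omega>. (1 - c) ^ card (linked_below C n \<omega>)) \<in> borel_measurable P"
proof -
  define I where "I = {(i, j). i < j \<and> j < n}"
  have finI: "finite I"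
    by (rule finite_subset[of _ "{..<n} \<times> {..<n}"]) (auto simp: I_def)
  have I_sub: "J \<subseteq> {(i, j). i < j}" if "J \<subseteq> I" for J using that by (auto simp: I_def)
  define H where "H J = {\<omega>\<in>space P. linked_below C n \<omega> = J}" for J
  have H_eq: "H J = {\<omega>\<in>space \<V>. \<forall>ij\<in>I. pair_event C ij \<omega> \<longleftrightarrow> ij \<in> J}" if "J \<subseteq> I" for J
    using that by (auto simp: H_def I_def linked_pairs_def space_\<V> set_eq_iff)
  have H: "H J \<in> sets \<V>" if "J \<subseteq> I" for J
  proof -
    note [measurable] = pair_event_\<V>[OF C]
    show ?thesis unfolding H_eq[OF that] using finI by measurable
  qed
  have HP: "H J \<in> sets P" if "J \<subseteq> I" for J using H[OF that] by (rule sets_\<V>_sub)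
  have E_sets: "{\<omega>\<in>space P. \<forall>(i, j)\<in>J. \<not> A i j \<omega>} \<in> sets P" if "J \<subseteq> I" for J
  proof -
    have "{\<omega>\<in>space P. \<forall>ij\<in>J. \<not> A (fst ij) (snd ij) \<omega>} \<in> sets P"
      using finite_subset[OF that finI] by measurable
    then show ?thesis by (simp add: case_prod_beta')
  qed
  have in_H: "\<omega> \<in> H J \<longleftrightarrow> J = linked_below C n \<omega>" if "\<omega> \<in> space P" for \<omega> J
    using that by (auto simp: H_def)
  have cover: "linked_below C n \<omega> \<subseteq> I" for \<omega> by (auto simp: I_def linked_pairs_def)
  have split: "{\<omega>\<in>space P. \<forall>(i, j)\<in>linked_pairs C \<omega>. j < n \<longrightarrow> \<not> A i j \<omega>} =
      (\<Union>J\<in>Pow I. H J \<inter> {\<omega>\<in>space P. \<forall>(i, j)\<in>J. \<not> A i j \<omega>})" (is "?E = _")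
  proof (intro set_eqI)
    fix \<omega>
    have "\<omega> \<in> (\<Union>J\<in>Pow I. H J \<inter> {\<omega>\<in>space P. \<forall>(i, j)\<in>J. \<not> A i j \<omega>}) \<longleftrightarrow>
        \<omega> \<in> space P \<and> (\<forall>(i, j)\<in>linked_below C n \<omega>. \<not> A i j \<omega>)"
      using in_H[of \<omega>] cover[of \<omega>] by auto
    then show "\<omega> \<in> ?E \<longleftrightarrow> \<omega> \<in> (\<Union>J\<in>Pow I. H J \<inter> {\<omega>\<in>space P. \<forall>(i, j)\<in>J. \<not> A i j \<omega>})"
      by auto
  qed
  show "?E \<in> sets P"
    unfolding split using finI HP E_sets by (intro sets.finite_UN) auto
  have sum: "(1 - c) ^ card (linked_below C n \<omega>) = (\<Sum>J\<in>Pow I. indicator (H J) \<omega> * (1 - c) ^ card J)"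
    if "\<omega> \<in> space P" for \<omega>
  proof -
    have "(\<Sum>J\<in>Pow I. indicator (H J) \<omega> * (1 - c) ^ card J) =
        (\<Sum>J\<in>Pow I. if linked_below C n \<omega> = J then (1 - c) ^ card J else 0)"
      using in_H[OF that] by (intro sum.cong) (auto simp: indicator_def)
    also have "\<dots> = (1 - c) ^ card (linked_below C n \<omega>)"
      using finI cover[of \<omega>] by (subst sum.delta') auto
    finally show ?thesis ..
  qed
  show "(\<lambda>\<omega>. (1 - c) ^ card (linked_below C n \<omega>)) \<in> borel_measurable P"
    using HP by (subst measurable_cong[OF sum]) (auto intro!: borel_measurable_sum borel_measurable_times)
  have "{z. W z \<noteq> c} \<in> sets borel" by measurable
  moreover have "emeasure (\<mu> \<Otimes>\<^sub>M \<mu>) {z. W z \<noteq> c} = 0"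
  proof -
    have "{z. W z \<noteq> c} = {z\<in>space (\<mu> \<Otimes>\<^sub>M \<mu>). \<not> W z = c}" by (auto simp: space_pair_measure space_\<mu>)
    moreover have "{z\<in>space (\<mu> \<Otimes>\<^sub>M \<mu>). \<not> W z = c} \<in> sets (\<mu> \<Otimes>\<^sub>M \<mu>)"
      using \<open>{z. W z \<noteq> c} \<in> sets borel\<close> by (simp only: calculation[symmetric] sets_\<mu>_pair)
    ultimately have "(AE z in \<mu> \<Otimes>\<^sub>M \<mu>. W z = c) = (emeasure (\<mu> \<Otimes>\<^sub>M \<mu>) {z. W z \<noteq> c} = 0)"
      by (intro AE_iff_measurable) simp_all
    then show ?thesis using c by blast
  qed
  ultimately have Wc: "AE \<omega> in P. \<forall>i j. i \<noteq> j \<longrightarrow> enat i < N \<omega> \<longrightarrow> enat j < N \<omega> \<longrightarrow> (S i \<omega>, S j \<omega>) \<notin> {z. W z \<noteq> c}"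
    by (rule no_pairs_in_null_set)
  have part: "prob (H J \<inter> {\<omega>\<in>space P. \<forall>(i, j)\<in>J. \<not> A i j \<omega>}) = (\<integral>\<omega>. indicator (H J) \<omega> * (1 - c) ^ card J \<partial>P)"
    if J: "J \<subseteq> I" for J
  proof -
    have act: "pair_event C (i, j) \<omega>" if "\<omega> \<in> H J" "(i, j) \<in> J" for \<omega> i j
      using that by (auto simp: H_def linked_pairs_def)
    have "prob (H J \<inter> {\<omega>\<in>space P. \<forall>(i, j)\<in>J. \<not> A i j \<omega>}) =
        (\<integral>\<omega>. indicator (H J) \<omega> * (\<Prod>(i, j)\<in>J. 1 - W (S i \<omega>, S j \<omega>)) \<partial>P)"
      by (rule prob_no_edges[OF finite_subset[OF J finI] I_sub[OF J] H[OF J]])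
         (use act in \<open>auto simp: pair_event_def\<close>)
    also have "\<dots> = (\<integral>\<omega>. indicator (H J) \<omega> * (1 - c) ^ card J \<partial>P)"
    proof (rule integral_cong_AE)
      show "(\<lambda>\<omega>. indicator (H J) \<omega> * (\<Prod>(i, j)\<in>J. 1 - W (S i \<omega>, S j \<omega>))) \<in> borel_measurable P"
        unfolding case_prod_beta using HP[OF J]
        by (intro borel_measurable_times borel_measurable_prod borel_measurable_diff W_S_measurable) auto
      show "(\<lambda>\<omega>. indicator (H J) \<omega> * (1 - c) ^ card J) \<in> borel_measurable P"
        using HP[OF J] by simp
      show "AE \<omega> in P. indicator (H J) \<omega> * (\<Prod>(i, j)\<in>J. 1 - W (S i \<omega>, S j \<omega>)) = indicator (H J) \<omega> * (1 - c) ^ card J"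
        using Wc
      proof eventually_elim
        case (elim \<omega>)
        have "(\<Prod>(i, j)\<in>J. 1 - W (S i \<omega>, S j \<omega>)) = (\<Prod>(i, j)\<in>J. 1 - c)" if "\<omega> \<in> H J"
        proof (rule prod.cong[OF refl], clarsimp simp only: prod.case)
          fix i j assume ij: "(i, j) \<in> J"
          then have "i \<noteq> j" using I_sub[OF J] by auto
          then show "1 - W (S i \<omega>, S j \<omega>) = 1 - c"
            using elim act[OF that ij] by (auto simp: pair_event_def)
        qed
        then show ?case by (auto simp: indicator_def)
      qed
    qed
    finally show ?thesis .
  qed
  have "prob ?E = (\<Sum>J\<in>Pow I. prob (H J \<inter> {\<omega>\<in>space P. \<forall>(i, j)\<in>J. \<not> A i j \<omega>}))"
    unfolding split using finI HP E_sets
    by (intro finite_measure_finite_Union) (auto simp: disjoint_family_on_def H_def)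
  also have "\<dots> = (\<Sum>J\<in>Pow I. (\<integral>\<omega>. indicator (H J) \<omega> * (1 - c) ^ card J \<partial>P))"
    using part by (intro sum.cong) auto
  also have "\<dots> = (\<integral>\<omega>. (\<Sum>J\<in>Pow I. indicator (H J) \<omega> * (1 - c) ^ card J) \<partial>P)"
  proof (rule Bochner_Integration.integral_sum[symmetric])
    fix J assume "J \<in> Pow I"
    then have "integrable P (indicator (H J) :: _ \<Rightarrow> real)"
      using HP by (intro integrable_const_bound[where B=1]) auto
    then show "integrable P (\<lambda>\<omega>. indicator (H J) \<omega> * (1 - c) ^ card J)" by simp
  qed
  also have "\<dots> = (\<integral>\<omega>. (1 - c) ^ card (linked_below C n \<omega>) \<partial>P)"
    using sum by (intro Bochner_Integration.integral_cong) auto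
  finally show "prob ?E = \<dots>" .
qed

abbreviation no_edge_event :: "('a \<times> 'a) set \<Rightarrow> 'w set" where
  "no_edge_event C \<equiv> {\<omega>\<in>space P. emeasure (edge_measure N S A \<omega>) C = 0}"

lemma edge_measure_event [measurable]:
  assumes "C \<in> sets borel"
  shows "(no_edge_event C) \<in> sets P"
proof -
  have "(\<lambda>\<omega>. emeasure (edge_measure N S A \<omega>) C) \<in> borel_measurable P"
    unfolding emeasure_edge_measure[OF assms]
  proof (rule borel_measurable_count_space_integral)
    fix ij
    note [measurable] = pair_event_measurable[OF assms, of ij] A_measurable[of "fst ij" "snd ij"]
    show "(\<lambda>\<omega>. of_bool (pair_event C ij \<omega> \<and> A (fst ij) (snd ij) \<omega>) :: ennreal) \<in> borel_measurable P"
      by measurable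
  qed
  then show ?thesis by measurable
qed

text \<open>Given the vertices, each of the unordered pairs that hit \<open>C\<close> stays unlinked with probability
  \<open>1 - c\<close>. Hence the void probabilities of the edge measure depend on the vertices only through the
  number of such pairs.\<close>

theorem edge_measure_void_probability:
  assumes C: "C \<in> sets borel" and c: "AE z in \<mu> \<Otimes>\<^sub>M \<mu>. W z = c" "0 \<le> c" "c \<le> 1"
  shows "emeasure P (no_edge_event C) =
    (\<integral>\<^sup>+\<omega>. ennreal (no_edge_weight c (pair_count S (C \<union> prod.swap -` C) \<omega>)) \<partial>P)"
proof -
  \<comment> \<open>An edge contributes both ordered pairs, so \<open>C\<close> is missed iff its symmetrization is.\<close>
  define D where "D = C \<union> prod.swap -` C"
  have D: "D \<in> sets borel" unfolding D_def using C swap_sets_borel[OF C] by (rule sets.Un)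
  have sym: "prod.swap -` D = D" by (auto simp: D_def)
  define L where "L \<omega> = pair_count S D \<omega>" for \<omega>
  define q where "q n \<omega> = (1 - c) ^ card (linked_below D n \<omega>)" for n \<omega>
  define E where "E n = {\<omega>\<in>space P. \<forall>(i, j)\<in>linked_pairs D \<omega>. j < n \<longrightarrow> \<not> A i j \<omega>}" for n
  note fin = prob_no_linked_edges[OF D c(1), folded q_def E_def]
  have lim: "(\<lambda>n. q n \<omega>) \<longlonglongrightarrow> no_edge_weight c (L \<omega>)" for \<omega>
    unfolding q_def L_def by (rule tendsto_no_edge_weight[OF c(2,3) sym])
  have q01: "0 \<le> q n \<omega>" "q n \<omega> \<le> 1" for n \<omega>
    using c by (auto simp: q_def intro!: power_le_one)
  have w: "(\<lambda>\<omega>. no_edge_weight c (L \<omega>)) \<in> borel_measurable P"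
    by (rule borel_measurable_LIMSEQ_real[OF lim fin(3)])
  have "(\<lambda>n. prob (E n)) \<longlonglongrightarrow> (\<integral>\<omega>. no_edge_weight c (L \<omega>) \<partial>P)"
    unfolding fin(1)
  proof (rule integral_dominated_convergence[where w="\<lambda>_. 1"])
    show "AE \<omega> in P. (\<lambda>n. q n \<omega>) \<longlonglongrightarrow> no_edge_weight c (L \<omega>)" using lim by simp
    show "AE \<omega> in P. norm (q n \<omega>) \<le> 1" for n using q01 by simp
  qed (use w fin(3) in simp_all)
  moreover have "(\<lambda>n. prob (E n)) \<longlonglongrightarrow> prob (\<Inter>n. E n)"
    using fin(2) by (intro finite_Lim_measure_decseq) (auto simp: decseq_def E_def)
  moreover have "prob (\<Inter>n. E n) = prob (no_edge_event C)"
  proof (rule measure_eq_AE)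
    show "AE \<omega> in P. \<omega> \<in> (\<Inter>n. E n) \<longleftrightarrow> \<omega> \<in> no_edge_event C"
      using A_symmetric AE_space
    proof eventually_elim
      case (elim \<omega>)
      have "emeasure (edge_measure N S A \<omega>) C = 0 \<longleftrightarrow> (\<forall>i j. pair_event C (i, j) \<omega> \<longrightarrow> \<not> A i j \<omega>)"
        unfolding emeasure_edge_measure[OF C]
        by (subst nn_integral_0_iff_AE) (auto simp: AE_count_space)
      also have "\<dots> \<longleftrightarrow> (\<forall>(i, j)\<in>linked_pairs D \<omega>. \<not> A i j \<omega>)"
      proof
        assume *: "\<forall>i j. pair_event C (i, j) \<omega> \<longrightarrow> \<not> A i j \<omega>"
        show "\<forall>(i, j)\<in>linked_pairs D \<omega>. \<not> A i j \<omega>"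
        proof clarify
          fix i j assume ij: "(i, j) \<in> linked_pairs D \<omega>" "A i j \<omega>"
          then have "pair_event C (i, j) \<omega> \<or> pair_event C (j, i) \<omega>" and "enat i < N \<omega>" "enat j < N \<omega>"
            by (auto simp: linked_pairs_def D_def pair_event_def)
          moreover have "A j i \<omega>" using elim(1) calculation ij(2) by blast
          ultimately show False using * ij(2) by blast
        qed
      next
        assume *: "\<forall>(i, j)\<in>linked_pairs D \<omega>. \<not> A i j \<omega>"
        show "\<forall>i j. pair_event C (i, j) \<omega> \<longrightarrow> \<not> A i j \<omega>"
        proof (intro allI impI notI)
          fix i j assume ij: "pair_event C (i, j) \<omega>" "A i j \<omega>"
          then have N: "enat i < N \<omega>" "enat j < N \<omega>" by (auto simp: pair_event_def)
          then have "A j i \<omega>" "i \<noteq> j" using elim(1) ij(2) by blast+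
          moreover have "(i, j) \<in> linked_pairs D \<omega> \<or> (j, i) \<in> linked_pairs D \<omega>"
            using ij(1) \<open>i \<noteq> j\<close> by (auto simp: linked_pairs_def D_def pair_event_def)
          ultimately show False using * ij(2) by blast
        qed
      qed
      also have "\<dots> \<longleftrightarrow> (\<forall>n. \<forall>(i, j)\<in>linked_pairs D \<omega>. j < n \<longrightarrow> \<not> A i j \<omega>)" by blast
      finally show ?case using elim(2) by (auto simp: E_def)
    qed
    show "(\<Inter>n. E n) \<in> sets P" using fin(2) by (intro sets.countable_INT) auto
    show "(no_edge_event C) \<in> sets P" by (rule edge_measure_event[OF C])
  qed
  ultimately have "prob (no_edge_event C) = (\<integral>\<omega>. no_edge_weight c (L \<omega>) \<partial>P)"
    using LIMSEQ_unique by metis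
  also have "ennreal \<dots> = (\<integral>\<^sup>+\<omega>. ennreal (no_edge_weight c (L \<omega>)) \<partial>P)"
    using w no_edge_weight_bounds[OF c(2,3)]
    by (intro nn_integral_eq_integral[symmetric] integrable_const_bound[where B=1]) auto
  finally show ?thesis by (simp add: emeasure_eq_measure L_def D_def)
qed

lemma edge_measure_image:
  fixes T :: "'a \<Rightarrow> 'a"
  assumes "T \<in> borel \<rightarrow>\<^sub>M borel"
  shows "distr (edge_measure N S A \<omega>) borel (map_prod T T) = edge_measure N (\<lambda>i \<omega>. T (S i \<omega>)) A \<omega>"
  unfolding edge_measure_def using map_prod_borel_measurable[OF assms]
  by (subst distr_dirac_sum) (auto simp: comp_def case_prod_beta')

lemma simple_counting_edge_measure:
  assumes "inj_on (\<lambda>i. X i \<omega>) {i. enat i < N \<omega>}"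
  shows "simple_counting (edge_measure N X A \<omega>)"
  unfolding edge_measure_def
  by (rule simple_counting_dirac_sum) (use assms in \<open>auto simp: inj_on_def\<close>)

text \<open>With \<open>edge_measure_void_probability\<close> the void probabilities of \<open>\<xi>\<close> and of its image are the same
  functional of the pair counts of the points and of their images.\<close>

theorem exchangeable_if_constant:
  assumes \<xi>: "random_measure P \<xi>" "AE \<omega> in P. \<xi> \<omega> = edge_measure N S A \<omega>"
    and c: "AE z in \<mu> \<Otimes>\<^sub>M \<mu>. W z = c" "0 \<le> c" "c \<le> 1"
  shows "jointly_exchangeable P \<mu> \<xi>"
  unfolding jointly_exchangeable_def
proof (intro conjI allI impI \<xi>(1) distr_eq_if_void_probabilities_eq)
  fix T assume T: "measure_preserving \<mu> T"
  note T' = measure_preservingD[OF T]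
  have TT: "map_prod T T \<in> borel \<rightarrow>\<^sub>M borel" by (rule map_prod_borel_measurable[OF T'(1)])
  show "prob_space P" by (rule prob_space_axioms)
  show m: "\<xi> \<in> P \<rightarrow>\<^sub>M measure_algebra borel" using \<xi>(1) by (simp add: random_measure_def)
  show "(\<lambda>\<omega>. distr (\<xi> \<omega>) borel (map_prod T T)) \<in> P \<rightarrow>\<^sub>M measure_algebra borel"
    by (rule measurable_distr_kernel[OF m TT])
  show "AE \<omega> in P. simple_counting (\<xi> \<omega>)"
    using \<xi>(2) inj by eventually_elim (simp add: simple_counting_edge_measure)
  show "AE \<omega> in P. simple_counting (distr (\<xi> \<omega>) borel (map_prod T T))"
    using \<xi>(2) image_inj[OF T] by eventually_elim (simp add: edge_measure_image[OF T'(1)] simple_counting_edge_measure)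
  fix C :: "('a \<times> 'a) set" assume C: "C \<in> sets borel"
  let ?TC = "map_prod T T -` C"
  have TC: "?TC \<in> sets borel" using measurable_sets_borel[OF TT C] .
  have to_edge: "emeasure P {\<omega>\<in>space P. emeasure (\<xi> \<omega>) D = 0} = emeasure P (no_edge_event D)"
    if D: "D \<in> sets borel" for D
  proof (rule emeasure_eq_AE)
    show "AE \<omega> in P. \<omega> \<in> {\<omega>\<in>space P. emeasure (\<xi> \<omega>) D = 0} \<longleftrightarrow> \<omega> \<in> no_edge_event D"
      using \<xi>(2) by eventually_elim simp
    have "(\<lambda>\<omega>. emeasure (\<xi> \<omega>) D) \<in> borel_measurable P" by (rule measurable_emeasure_kernel[OF m D])
    then show "{\<omega>\<in>space P. emeasure (\<xi> \<omega>) D = 0} \<in> sets P" by measurable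
    show "(no_edge_event D) \<in> sets P" by (rule edge_measure_event[OF D])
  qed
  have "emeasure P {\<omega>\<in>space P. emeasure (distr (\<xi> \<omega>) borel (map_prod T T)) C = 0} =
      emeasure P {\<omega>\<in>space P. emeasure (\<xi> \<omega>) ?TC = 0}"
    using emeasure_distr_kernel[OF m TT C] by (intro arg_cong[where f="emeasure P"]) auto
  also have "\<dots> = (\<integral>\<^sup>+\<omega>. ennreal (no_edge_weight c (pair_count S (?TC \<union> prod.swap -` ?TC) \<omega>)) \<partial>P)"
    unfolding to_edge[OF TC] by (rule edge_measure_void_probability[OF TC c])
  also have "\<dots> = (\<integral>\<^sup>+\<omega>. ennreal (no_edge_weight c (pair_count (\<lambda>i \<omega>. T (S i \<omega>)) (C \<union> prod.swap -` C) \<omega>)) \<partial>P)"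
    by simp
  also have "\<dots> = (\<integral>\<^sup>+\<omega>. ennreal (no_edge_weight c (pair_count S (C \<union> prod.swap -` C) \<omega>)) \<partial>P)"
    by (rule distr_pair_count_image[OF T, where g="\<lambda>l. ennreal (no_edge_weight c l)"])
       (use C swap_sets_borel[OF C] in \<open>auto intro!: sets.Un\<close>)
  also have "\<dots> = emeasure P {\<omega>\<in>space P. emeasure (\<xi> \<omega>) C = 0}"
    unfolding to_edge[OF C] by (rule edge_measure_void_probability[OF C c, symmetric])
  finally show "measure P {\<omega>\<in>space P. emeasure (distr (\<xi> \<omega>) borel (map_prod T T)) C = 0} =
      measure P {\<omega>\<in>space P. emeasure (\<xi> \<omega>) C = 0}"
    by (simp add: measure_def)
qed

end

section \<open>Transport of diffuse measures\<close>

text \<open>Digits \<open>0\<close> and \<open>1\<close> in base \<open>4\<close> can be read off by a floor, since the tail after any digit is at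
  most \<open>1/3 < 1\<close>; base \<open>2\<close> would be ambiguous.\<close>

lemma base4_digit:
  fixes b :: "nat \<Rightarrow> bool"
  shows "\<lfloor>4 ^ Suc n * (\<Sum>k. of_bool (b k) * (1/4 :: real) ^ Suc k)\<rfloor> mod 4 = (1::int) \<longleftrightarrow> b n"
proof -
  define d where "d k = (of_bool (b k) * (1/4) ^ Suc k :: real)" for k
  have geo: "(\<lambda>k. (1/4) ^ Suc k) sums (1/3 :: real)"
    using sums_mult[OF geometric_sums[of "1/4::real"], of "1/4"] by simp
  have d_le: "d k \<le> (1/4) ^ Suc k" "0 \<le> d k" for k by (auto simp: d_def)
  have summable: "summable d"
    by (rule summable_comparison_test_ev[OF _ sums_summable[OF geo]]) (use d_le in auto)
  define r where "r = 4 ^ Suc n * (\<Sum>k. d (k + Suc n))"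
  have tail: "(\<Sum>k. d (k + Suc n)) \<le> (\<Sum>k. (1/4) ^ Suc n * (1/4) ^ Suc k)"
  proof (rule suminf_le)
    show "d (k + Suc n) \<le> (1/4) ^ Suc n * (1/4) ^ Suc k" for k
      using d_le(1)[of "k + Suc n"] by (simp add: power_add mult.commute)
    show "summable (\<lambda>k. d (k + Suc n))" using summable summable_iff_shift[of d "Suc n"] by simp
    show "summable (\<lambda>k. (1/4) ^ Suc n * (1/4) ^ Suc k :: real)"
      by (rule summable_mult[OF sums_summable[OF geo]])
  qed
  also have "\<dots> = (1/4) ^ Suc n * (1/3)"
    using sums_unique[OF sums_mult[OF geo, of "(1/4) ^ Suc n"]] by simp
  finally have "r \<le> 4 ^ Suc n * ((1/4) ^ Suc n * (1/3))"
    unfolding r_def by (intro mult_left_mono) auto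
  also have "\<dots> = 1/3" by (simp add: power_divide)
  finally have r: "r < 1" by simp
  have r0: "0 \<le> r"
    unfolding r_def using d_le summable_iff_shift[of d "Suc n"] summable by (intro mult_nonneg_nonneg suminf_nonneg) auto
  define z :: int where "z = (\<Sum>k<n. of_bool (b k) * 4 ^ (n - Suc k))"
  have head: "4 ^ Suc n * d k = of_int (4 * (of_bool (b k) * 4 ^ (n - Suc k)))" if "k < n" for k
  proof -
    have "(4::real) ^ Suc n = 4 * 4 ^ (n - Suc k) * 4 ^ Suc k"
      using that by (simp flip: power_add power_Suc)
    then show ?thesis by (simp add: d_def power_divide)
  qed
  have "4 ^ Suc n * (\<Sum>k. d k) = 4 ^ Suc n * ((\<Sum>k. d (k + Suc n)) + (\<Sum>k<Suc n. d k))"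
    by (subst suminf_split_initial_segment[OF summable, of "Suc n"]) simp
  also have "\<dots> = r + (\<Sum>k<n. 4 ^ Suc n * d k) + 4 ^ Suc n * d n"
    by (simp only: r_def distrib_left sum.lessThan_Suc sum_distrib_left add.assoc)
  also have "(\<Sum>k<n. 4 ^ Suc n * d k) = of_int (4 * z)"
  proof -
    have "(\<Sum>k<n. 4 ^ Suc n * d k) = (\<Sum>k<n. of_int (4 * (of_bool (b k) * 4 ^ (n - Suc k))))"
      by (intro sum.cong refl head) simp
    also have "\<dots> = of_int (4 * z)" by (simp only: z_def sum_distrib_left of_int_sum)
    finally show ?thesis .
  qed
  also have "4 ^ Suc n * d n = of_int (of_bool (b n))"
    by (simp add: d_def power_divide)
  finally have "4 ^ Suc n * (\<Sum>k. d k) = r + of_int (4 * z + of_bool (b n))" by simp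
  then have "\<lfloor>4 ^ Suc n * (\<Sum>k. d k)\<rfloor> = 4 * z + of_bool (b n)"
    using r r0 by (intro floor_unique) auto
  moreover have "(4 * z + of_bool (b n)) mod 4 = 1 \<longleftrightarrow> b n" by simp
  ultimately show ?thesis unfolding d_def by (simp only:)
qed

text \<open>Code \<open>x\<close> by the digits that record its membership in the balls around the points of a countable
  dense set, and decode by taking the limit of centers of balls with radius tending to \<open>0\<close>.\<close>

lemma ex_real_coding:
  obtains f :: "'a::polish_space \<Rightarrow> real" and h :: "real \<Rightarrow> 'a"
  where "f \<in> borel_measurable borel" "h \<in> borel \<rightarrow>\<^sub>M borel" "\<And>x. h (f x) = x"
proof -
  obtain D :: "'a set" where D: "countable D" "\<And>X. open X \<Longrightarrow> X \<noteq> {} \<Longrightarrow> \<exists>d\<in>D. d \<in> X"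
    by (rule countable_dense_setE) blast
  define e where "e = from_nat_into D"
  have e: "\<exists>k. dist (e k) x < 1 / Suc m" for x m
  proof -
    obtain d where "d \<in> D" "d \<in> ball x (1 / Suc m)" using D(2)[of "ball x (1 / Suc m)"] by auto
    moreover from this obtain k where "d = e k"
      unfolding e_def using from_nat_into_surj[OF D(1)] by metis
    ultimately show ?thesis by (auto simp: dist_commute)
  qed
  \<comment> \<open>The digit with number \<open>(m, k)\<close> tells whether the \<open>k\<close>-th dense point is closer than \<open>1 / Suc m\<close>.\<close>
  define b where "b x n = (case prod_decode n of (m, k) \<Rightarrow> dist (e k) x < 1 / Suc m)" for x n
  define f where "f x = (\<Sum>n. of_bool (b x n) * (1/4) ^ Suc n :: real)" for x
  define h0 where "h0 m t = e (LEAST k. \<lfloor>4 ^ Suc (prod_encode (m, k)) * t\<rfloor> mod 4 = (1::int))" for m and t :: real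
  \<comment> \<open>Reals that code no point need a default, so that the limit exists everywhere.\<close>
  define h1 where "h1 m t = (if Cauchy (\<lambda>m. h0 m t) then h0 m t else e 0)" for m t
  define h where "h t = lim (\<lambda>m. h1 m t)" for t
  have f: "f \<in> borel_measurable borel"
    unfolding f_def
  proof (intro borel_measurable_suminf borel_measurable_times borel_measurable_const)
    fix n
    have "Measurable.pred borel (\<lambda>x. b x n)"
      unfolding b_def by (cases "prod_decode n") (simp, measurable)
    then show "(\<lambda>x. of_bool (b x n) :: real) \<in> borel_measurable borel" by measurable
  qed
  have h0_m: "h0 m \<in> borel \<rightarrow>\<^sub>M borel" for m
  proof -
    have "(\<lambda>t::real. LEAST k. \<lfloor>4 ^ Suc (prod_encode (m, k)) * t\<rfloor> mod 4 = (1::int)) \<in> borel \<rightarrow>\<^sub>M count_space UNIV"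
      by measurable
    then show ?thesis unfolding h0_def by (rule measurable_compose) simp
  qed
  have h1_m: "h1 m \<in> borel \<rightarrow>\<^sub>M borel" for m
  proof -
    note [measurable] = h0_m
    have "{t\<in>space borel. Cauchy (\<lambda>m. h0 m t)} \<in> sets borel" by (rule sets_Collect_Cauchy[OF h0_m])
    then show ?thesis unfolding h1_def using h0_m by (intro measurable_If) auto
  qed
  have "(\<lambda>m. h1 m t) \<longlonglongrightarrow> h t" for t
  proof -
    have "Cauchy (\<lambda>m. h1 m t)"
    proof (cases "Cauchy (\<lambda>m. h0 m t)")
      case True
      then show ?thesis by (simp only: h1_def if_True)
    next
      case False
      then have "h1 m t = e 0" for m by (simp only: h1_def if_False)
      then show ?thesis by (simp add: convergent_Cauchy convergent_const)
    qed
    then show ?thesis unfolding h_def by (simp only: Cauchy_convergent_iff convergent_LIMSEQ_iff)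
  qed
  then have h: "h \<in> borel \<rightarrow>\<^sub>M borel"
    by (intro borel_measurable_LIMSEQ_metric[OF h1_m]) simp
  have "h (f x) = x" for x
  proof -
    have digit: "\<lfloor>4 ^ Suc n * f x\<rfloor> mod 4 = (1::int) \<longleftrightarrow> b x n" for n
      unfolding f_def by (rule base4_digit)
    have close: "dist (h0 m (f x)) x < 1 / Suc m" for m
    proof -
      have "h0 m (f x) = e (LEAST k. dist (e k) x < 1 / Suc m)"
        unfolding h0_def digit by (simp add: b_def)
      moreover have "dist (e (LEAST k. dist (e k) x < 1 / Suc m)) x < 1 / Suc m"
        by (rule LeastI_ex) (rule e)
      ultimately show ?thesis by simp
    qed
    have lim: "(\<lambda>m. h0 m (f x)) \<longlonglongrightarrow> x"
    proof (rule tendsto_dist_iff[THEN iffD2], rule tendsto_sandwich[OF _ _ tendsto_const])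
      show "\<forall>\<^sub>F m in sequentially. dist (h0 m (f x)) x \<le> 1 / Suc m"
        using close by (intro always_eventually) (auto intro: less_imp_le)
      show "(\<lambda>m. 1 / real (Suc m)) \<longlonglongrightarrow> 0"
        using LIMSEQ_inverse_real_of_nat by (simp add: inverse_eq_divide)
    qed simp
    then have "Cauchy (\<lambda>m. h0 m (f x))" by (rule LIMSEQ_imp_Cauchy)
    then have "h1 m (f x) = h0 m (f x)" for m by (simp add: h1_def)
    then show ?thesis unfolding h_def using lim by (simp add: limI)
  qed
  then show ?thesis using that f h by blast
qed

lemma (in finite_borel_measure) continuous_cdf:
  assumes "\<And>x. measure M {x} = 0"
  shows "continuous_on UNIV (cdf M)"
  using assms isCont_cdf by (simp add: continuous_on_eq_continuous_at)

lemma (in finite_borel_measure) cdf_attains: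
  assumes cont: "\<And>x. measure M {x} = 0" and u: "0 < u" "u < measure M (space M)"
  shows "\<exists>s. cdf M s = u"
proof -
  have "\<forall>\<^sub>F x in at_bot. cdf M x < u" using order_tendstoD(2)[OF cdf_lim_at_bot u(1)] .
  moreover have "\<forall>\<^sub>F x in at_top. u < cdf M x" using order_tendstoD(1)[OF cdf_lim_at_top u(2)] .
  ultimately obtain p q where pq: "cdf M p < u" "u < cdf M q"
    by (metis eventually_at_bot_linorder eventually_at_top_linorder order_refl)
  then have "p \<le> q" using cdf_nondecreasing[of q p] by linarith
  then show ?thesis
    using IVT'[of "cdf M" p u q] continuous_on_subset[OF continuous_cdf[OF cont]] pq by (metis less_imp_le top_greatest)
qed

text \<open>A distribution function without jumps attains each value in \<open>(0, m)\<close>, and the mass to the left of a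
  point where it takes the value \<open>u\<close> is \<open>u\<close>. This is the uniformity of \<open>cdf M\<close> under \<open>M\<close>; the boundary
  values follow by approximation.\<close>

lemma (in finite_borel_measure) cdf_uniform:
  assumes cont: "\<And>x. measure M {x} = 0" and v: "0 \<le> v" "v \<le> measure M (space M)"
  shows "measure M {x. cdf M x \<le> v} = v"
proof -
  let ?m = "measure M (space M)"
  note isCont = continuous_cdf[OF cont]
  have sp: "space M = UNIV" using sets_eq_imp_space_eq[OF M_is_borel] by simp
  have cdf_meas: "{x. cdf M x \<le> u} \<in> sets M" for u
  proof -
    have "closed {x. cdf M x \<le> u}" using isCont by (intro closed_Collect_le) auto
    then show ?thesis by (auto simp: M_is_borel)
  qed
  have upper: "measure M {x. cdf M x \<le> w} \<le> u" if wu: "w < u" "0 < u" "u < ?m" for u w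
  proof -
    obtain s where s: "cdf M s = u" using cdf_attains[OF cont wu(2,3)] ..
    have "{x. cdf M x \<le> w} \<subseteq> {..s}"
      using s that cdf_nondecreasing[of s] by (auto simp: not_less[symmetric]) (meson less_imp_le not_le order_trans)
    then have "measure M {x. cdf M x \<le> w} \<le> measure M {..s}"
      by (intro finite_measure_mono) (auto simp: M_is_borel)
    then show ?thesis using s by (simp add: cdf_def)
  qed
  have lower: "u \<le> measure M {x. cdf M x \<le> u}" if u: "0 < u" "u < ?m" for u
  proof -
    obtain s where s: "cdf M s = u" using cdf_attains[OF cont u] ..
    have "{..s} \<subseteq> {x. cdf M x \<le> u}" using s cdf_nondecreasing by auto
    then have "measure M {..s} \<le> measure M {x. cdf M x \<le> u}"
      using cdf_meas by (intro finite_measure_mono) auto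
    then show ?thesis using s by (simp add: cdf_def)
  qed
  consider "v = ?m" | "v = 0" "v < ?m" | "0 < v" "v < ?m" using v by linarith
  then show ?thesis
  proof cases
    case 1
    then have "{x. cdf M x \<le> v} = space M" using cdf_bounded sp by auto
    then show ?thesis using 1 by simp
  next
    case 2
    have "measure M {x. cdf M x \<le> v} \<le> 0"
    proof (rule dense_ge_bounded[of 0 ?m])
      show "measure M {x. cdf M x \<le> v} \<le> u" if "0 < u" "u < ?m" for u
        using upper[of v u] 2 that by simp
    qed (use 2 in simp)
    then show ?thesis using 2 by (simp add: measure_le_0_iff)
  next
    case 3
    have "measure M {x. cdf M x \<le> v} \<le> v"
    proof (rule dense_ge_bounded[of v ?m])
      show "measure M {x. cdf M x \<le> v} \<le> u" if "v < u" "u < ?m" for u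
        using upper[of v u] 3 that by simp
    qed (use 3 in simp)
    then show ?thesis using lower[of v] 3 by simp
  qed
qed

text \<open>The transport is the quantile function of \<open>M2\<close> after the distribution function of \<open>M1\<close>: the latter is
  uniform, and the former maps the uniform law to \<open>M2\<close>.\<close>

lemma ex_real_transport:
  assumes M1: "finite_borel_measure M1" and M2: "finite_borel_measure M2"
    and cont: "\<And>x. measure M1 {x} = 0" and mass: "measure M1 UNIV = measure M2 UNIV"
  shows "\<exists>q\<in>borel_measurable borel. distr M1 borel q = M2"
proof -
  interpret M1: finite_borel_measure M1 by fact
  interpret M2: finite_borel_measure M2 by fact
  have sp: "space M1 = UNIV" "space M2 = UNIV"
    using sets_eq_imp_space_eq[OF M1.M_is_borel] sets_eq_imp_space_eq[OF M2.M_is_borel] by simp_all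
  define m where "m = measure M2 UNIV"
  interpret Q: right_continuous_mono "cdf M2" 0 m
    by standard (use M2.cdf_lim_at_top in \<open>auto intro: M2.cdf_nondecreasing M2.cdf_is_right_cont M2.cdf_lim_at_bot monoI simp: m_def sp\<close>)
  define q where "q x = (if 0 < cdf M1 x \<and> cdf M1 x < m then Q.I (cdf M1 x) else 0)" for x
  have F1[measurable]: "cdf M1 \<in> borel_measurable borel"
    by (intro borel_measurable_mono monoI M1.cdf_nondecreasing)
  have q[measurable]: "q \<in> borel_measurable borel"
  proof -
    have "Q.I \<in> borel_measurable (restrict_space borel {0<..<m})"
      by (intro borel_measurable_mono_on_fnc Q.mono_I)
    then have "(\<lambda>u. if 0 < u \<and> u < m then Q.I u else 0) \<in> borel_measurable borel"
      by (subst measurable_If_restrict_space_iff) (auto simp: greaterThanLessThan_def Int_def greaterThan_def lessThan_def)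
    from measurable_compose[OF F1 this] show ?thesis unfolding q_def .
  qed
  have q1: "q \<in> borel_measurable M1" using q by (simp add: M1.M_is_borel cong: measurable_cong_sets)
  have meas: "{x. cdf M1 x \<le> v} \<in> sets M1" for v
  proof -
    have "{x\<in>space borel. cdf M1 x \<le> v} \<in> sets borel" by measurable
    then show ?thesis by (simp add: M1.M_is_borel)
  qed
  have uni: "measure M1 {x. cdf M1 x \<le> v} = v" if "0 \<le> v" "v \<le> m" for v
    using M1.cdf_uniform[OF cont that(1)] that(2) mass by (simp add: m_def sp)
  have "AE x in M1. 0 < cdf M1 x \<and> cdf M1 x < m"
  proof -
    have "m \<ge> 0" by (simp add: m_def)
    have "AE x in M1. x \<notin> {x. cdf M1 x \<le> 0}"
      using uni[of 0] \<open>m \<ge> 0\<close> meas M1.emeasure_eq_measure by (intro AE_not_in null_setsI) auto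
    moreover have "AE x in M1. x \<notin> {x. m \<le> cdf M1 x}"
    proof (intro AE_not_in null_setsI)
      have "{x\<in>space borel. m \<le> cdf M1 x} \<in> sets borel" by measurable
      then show s: "{x. m \<le> cdf M1 x} \<in> sets M1" by (simp add: M1.M_is_borel)
      have "measure M1 {x. m \<le> cdf M1 x} \<le> 0"
      proof (rule field_le_epsilon)
        fix \<epsilon> :: real assume "0 < \<epsilon>"
        define v where "v = max 0 (m - \<epsilon>)"
        have v: "0 \<le> v" "v \<le> m" "m - v \<le> \<epsilon>" using \<open>m \<ge> 0\<close> \<open>0 < \<epsilon>\<close> by (auto simp: v_def)
        show "measure M1 {x. m \<le> cdf M1 x} \<le> 0 + \<epsilon>"
        proof (cases "m = 0")
          case True
          then have "measure M1 UNIV = 0" using mass by (simp add: m_def)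
          then show ?thesis using M1.bounded_measure[of "{x. m \<le> cdf M1 x}"] sp \<open>0 < \<epsilon>\<close> by simp
        next
          case False
          then have "v < m" using \<open>m \<ge> 0\<close> \<open>0 < \<epsilon>\<close> by (auto simp: v_def)
          then have "measure M1 {x. m \<le> cdf M1 x} + measure M1 {x. cdf M1 x \<le> v} = measure M1 ({x. m \<le> cdf M1 x} \<union> {x. cdf M1 x \<le> v})"
            using s meas by (intro M1.finite_measure_Union[symmetric]) auto
          also have "\<dots> \<le> m" using M1.bounded_measure sp mass by (simp add: m_def)
          finally show ?thesis using uni[OF v(1,2)] v(3) by simp
        qed
      qed
      then show "emeasure M1 {x. m \<le> cdf M1 x} = 0"
        by (simp add: M1.emeasure_eq_measure measure_le_0_iff)
    qed
    ultimately show ?thesis by eventually_elim auto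
  qed
  note inside = this
  have "distr M1 borel q = M2"
  proof (rule cdf_unique'[OF _ M2 ext])
    show "finite_borel_measure (distr M1 borel q)"
      using q1 by (intro finite_borel_measure.intro M1.finite_measure_distr finite_borel_measure_axioms.intro) auto
    fix y
    have v: "0 \<le> cdf M2 y" "cdf M2 y \<le> m"
      using M2.cdf_nonneg M2.cdf_bounded[of y] by (auto simp: m_def sp)
    have "cdf (distr M1 borel q) y = measure M1 {x. q x \<le> y}"
    proof -
      have eq: "q -` {..y} \<inter> space M1 = {x. q x \<le> y}" unfolding sp by blast
      have "{..y} \<in> sets borel" by simp
      then show ?thesis unfolding cdf_def by (simp only: measure_distr[OF q1] eq)
    qed
    also have "\<dots> = measure M1 {x. cdf M1 x \<le> cdf M2 y}"
    proof (rule measure_eq_AE)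
      show "AE x in M1. x \<in> {x. q x \<le> y} \<longleftrightarrow> x \<in> {x. cdf M1 x \<le> cdf M2 y}"
        using inside
      proof eventually_elim
        case (elim x)
        then have "q x \<le> y \<longleftrightarrow> cdf M1 x \<le> cdf M2 y"
          unfolding q_def using Q.pseudoinverse[of "cdf M1 x" y] by simp
        then show ?case by simp
      qed
      have "{x\<in>space borel. q x \<le> y} \<in> sets borel" by measurable
      then show "{x. q x \<le> y} \<in> sets M1" by (simp add: M1.M_is_borel)
    qed (rule meas)
    also have "\<dots> = cdf M2 y" by (rule uni[OF v])
    finally show "cdf (distr M1 borel q) y = cdf M2 y" .
  qed
  then show ?thesis using q by blast
qed

lemma finite_borel_measure_distr:
  fixes f :: "'a::topological_space \<Rightarrow> real"
  assumes "finite_measure M" "sets M = sets borel" "f \<in> borel_measurable borel"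
  shows "finite_borel_measure (distr M borel f)"
  using assms by (intro finite_borel_measure.intro finite_measure.finite_measure_distr finite_borel_measure_axioms.intro)
    (auto cong: measurable_cong_sets)

lemma measure_distr_inj_singleton:
  fixes f :: "'a::t1_space \<Rightarrow> real"
  assumes M: "sets M = sets borel" "\<And>x. emeasure M {x} = 0" and f: "f \<in> borel_measurable borel" "inj f"
  shows "measure (distr M borel f) {t} = 0"
proof -
  have fM: "f \<in> borel_measurable M" using f M(1) by (simp cong: measurable_cong_sets)
  have sp: "space M = UNIV" using sets_eq_imp_space_eq[OF M(1)] by simp
  have "f -` {t} = {} \<or> (\<exists>x. f -` {t} = {x})"
    using f(2) by (metis inj_vimage_singleton subset_singletonD)
  then have "emeasure M (f -` {t}) = 0" using M(2) by auto
  then show ?thesis using fM by (simp add: measure_def emeasure_distr sp)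
qed

text \<open>The coding moves the problem to the real line, and its left inverse brings the
  solution back; it is a Borel map on all of the real line, also off the image of the coding.\<close>

theorem ex_transport:
  fixes M1 M2 :: "'a::polish_space measure"
  assumes fin: "finite_measure M1" "finite_measure M2" and s: "sets M1 = sets borel" "sets M2 = sets borel"
    and diff: "\<And>x. emeasure M1 {x} = 0" and mass: "emeasure M1 UNIV = emeasure M2 UNIV"
  shows "\<exists>g\<in>borel \<rightarrow>\<^sub>M borel. distr M1 borel g = M2"
proof -
  obtain f :: "'a \<Rightarrow> real" and h where f: "f \<in> borel_measurable borel" and h: "h \<in> borel \<rightarrow>\<^sub>M borel"
    and hf: "\<And>x. h (f x) = x" using ex_real_coding by blast
  have fM: "f \<in> borel_measurable M1" "f \<in> borel_measurable M2" using f s by (simp_all cong: measurable_cong_sets)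
  have sp: "space M1 = UNIV" "space M2 = UNIV" using s[THEN sets_eq_imp_space_eq] by simp_all
  have "inj f" using hf by (metis injI)
  have "\<exists>q\<in>borel_measurable borel. distr (distr M1 borel f) borel q = distr M2 borel f"
  proof (rule ex_real_transport)
    show "finite_borel_measure (distr M1 borel f)" "finite_borel_measure (distr M2 borel f)"
      using fin s f by (auto intro: finite_borel_measure_distr)
    show "measure (distr M1 borel f) {x} = 0" for x
      by (rule measure_distr_inj_singleton[OF s(1) diff f \<open>inj f\<close>])
    show "measure (distr M1 borel f) UNIV = measure (distr M2 borel f) UNIV"
      using fM mass by (simp add: measure_def emeasure_distr sp)
  qed
  then obtain q where q: "q \<in> borel_measurable borel" "distr (distr M1 borel f) borel q = distr M2 borel f" ..
  have qf: "q \<circ> f \<in> borel_measurable M1" using q(1) fM(1) by (rule measurable_comp[rotated])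
  have "distr M1 borel (h \<circ> (q \<circ> f)) = distr (distr M1 borel (q \<circ> f)) borel h"
    using h qf by (rule distr_distr[symmetric])
  also have "distr M1 borel (q \<circ> f) = distr M2 borel f"
    using distr_distr[OF q(1) fM(1)] q(2) by simp
  also have "distr (distr M2 borel f) borel h = distr M2 borel (h \<circ> f)"
    using h fM(2) by (rule distr_distr)
  also have "\<dots> = distr M2 M2 (\<lambda>x. x)" using hf s by (intro distr_cong) (auto simp: comp_def)
  also have "\<dots> = M2" by (rule distr_id)
  finally show ?thesis
    using measurable_comp[OF measurable_comp[OF f q(1)] h] by blast
qed

text \<open>Along the coding the mass of \<open>E \<inter> f -` {..t}\<close> grows continuously from \<open>0\<close> to the mass of \<open>E\<close>, so the
  intermediate value theorem applies.\<close>

lemma ex_subset_of_mass: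
  fixes M :: "'a::polish_space measure"
  assumes s: "sets M = sets borel" and diff: "\<And>x. emeasure M {x} = 0"
    and E: "E \<in> sets borel" "emeasure M E < \<infinity>" and a: "a \<le> emeasure M E"
  shows "\<exists>D\<in>sets borel. D \<subseteq> E \<and> emeasure M D = a"
proof (cases "a = 0 \<or> a = emeasure M E")
  case True
  then show ?thesis using E by (auto intro: bexI[of _ "{}"])
next
  case False
  define R where "R = density M (indicator E)"
  have EM: "E \<in> sets M" using E s by simp
  have emR: "emeasure R B = emeasure M (E \<inter> B)" if "B \<in> sets borel" for B
    unfolding R_def using EM that s by (intro emeasure_density_indicator_Int) simp_all
  have sR: "sets R = sets borel" using s by (simp add: R_def)
  have spR: "space R = UNIV" using sets_eq_imp_space_eq[OF sR] by simp
  have finR: "finite_measure R"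
    by (rule finite_measureI) (use emR[of UNIV] E spR in auto)
  obtain f :: "'a \<Rightarrow> real" and h where f: "f \<in> borel_measurable borel" and hf: "\<And>x. h (f x) = x"
    using ex_real_coding by metis
  have "inj f" using hf by (metis injI)
  have fR: "f \<in> borel_measurable R" using f sR by (simp cong: measurable_cong_sets)
  let ?L = "distr R borel f"
  interpret L: finite_borel_measure ?L by (rule finite_borel_measure_distr[OF finR sR f])
  have diffR: "emeasure R {x} = 0" for x
    using emR[of "{x}"] emeasure_mono[of "E \<inter> {x}" "{x}" M] diff s by simp
  have top: "a < \<infinity>" using a E(2) by (rule le_less_trans)
  define u where "u = enn2real a"
  have au: "a = ennreal u" using top by (simp add: u_def less_top)
  have mE: "measure ?L (space ?L) = enn2real (emeasure M E)"
    using fR emR[of UNIV] by (simp add: measure_def emeasure_distr spR)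
  have u: "0 < u" "u < measure ?L (space ?L)"
  proof -
    show "0 < u" using False au by (cases "u > 0") (auto simp: ennreal_eq_0_iff not_less)
    have "a < emeasure M E" using False a by (simp add: less_le)
    then show "u < measure ?L (space ?L)" unfolding mE u_def using E
      by (simp add: enn2real_less_iff less_top au)
  qed
  obtain t where t: "cdf ?L t = u"
    using L.cdf_attains[OF measure_distr_inj_singleton[OF sR diffR f \<open>inj f\<close>] u] ..
  have pre: "f -` {..t} \<in> sets borel" using measurable_sets_borel[OF f] by simp
  have "emeasure M (E \<inter> f -` {..t}) = emeasure ?L {..t}"
    using fR emR[OF pre] by (simp add: emeasure_distr spR)
  also have "\<dots> = a" using t by (simp add: L.emeasure_eq_measure cdf_def au)
  finally show ?thesis using E pre by (intro bexI[of _ "E \<inter> f -` {..t}"]) auto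
qed

text \<open>Transporting \<open>\<mu>\<close> restricted to \<open>D\<close> to \<open>\<mu>\<close> restricted to \<open>D'\<close> and vice versa exchanges two disjoint sets
  of the same mass, up to null sets.\<close>

theorem ex_measure_preserving_swap:
  fixes \<mu> :: "'a::polish_space measure"
  assumes s: "sets \<mu> = sets borel" and diff: "diffuse \<mu>"
    and D: "D \<in> sets borel" "D' \<in> sets borel" "D \<inter> D' = {}"
    and mass: "emeasure \<mu> D = emeasure \<mu> D'" "emeasure \<mu> D < \<infinity>"
  obtains T where "measure_preserving \<mu> T" "\<And>x. x \<notin> D \<union> D' \<Longrightarrow> T x = x"
    "emeasure \<mu> (D - T -` D') = 0" "emeasure \<mu> (D' - T -` D) = 0"
proof -
  have D\<mu>: "D \<in> sets \<mu>" "D' \<in> sets \<mu>" using D s by simp_all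
  have sp: "space \<mu> = UNIV" using sets_eq_imp_space_eq[OF s] by simp
  let ?R = "\<lambda>E. density \<mu> (indicator E)"
  have em: "emeasure (?R E) B = emeasure \<mu> (E \<inter> B)" if "E \<in> sets borel" "B \<in> sets borel" for E B
    using that s by (intro emeasure_density_indicator_Int) simp_all
  have ex: "\<exists>g\<in>borel \<rightarrow>\<^sub>M borel. distr (?R E) borel g = ?R E'"
    if E: "E \<in> sets borel" "E' \<in> sets borel" "emeasure \<mu> E = emeasure \<mu> E'" "emeasure \<mu> E < \<infinity>" for E E'
  proof (rule ex_transport)
    show "finite_measure (?R E)" "finite_measure (?R E')"
      using em[of E UNIV] em[of E' UNIV] E by (auto intro!: finite_measureI simp: sp)
    show "emeasure (?R E) {x} = 0" for x
      using em[OF E(1), of "{x}"] emeasure_mono[of "E \<inter> {x}" "{x}" \<mu>] diff s by (simp add: diffuse_def)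
    show "emeasure (?R E) UNIV = emeasure (?R E') UNIV" using em[of E UNIV] em[of E' UNIV] E by simp
  qed (simp_all add: s)
  obtain g where g: "g \<in> borel \<rightarrow>\<^sub>M borel" "distr (?R D) borel g = ?R D'"
    using ex[OF D(1,2) mass] ..
  obtain g' where g': "g' \<in> borel \<rightarrow>\<^sub>M borel" "distr (?R D') borel g' = ?R D"
    using ex[OF D(2,1) mass(1)[symmetric]] mass by auto
  have push: "emeasure \<mu> (E \<inter> k -` B) = emeasure \<mu> (E' \<inter> B)"
    if "k \<in> borel \<rightarrow>\<^sub>M borel" "distr (?R E) borel k = ?R E'" "E \<in> sets borel" "E' \<in> sets borel" "B \<in> sets borel" for k E E' B
  proof -
    have k: "k \<in> ?R E \<rightarrow>\<^sub>M borel" using that(1) s by (simp cong: measurable_cong_sets)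
    have "emeasure \<mu> (E \<inter> k -` B) = emeasure (?R E) (k -` B)"
      using em[OF that(3) measurable_sets_borel[OF that(1,5)]] by simp
    also have "\<dots> = emeasure (distr (?R E) borel k) B" using k that(5) by (simp add: emeasure_distr sp)
    also have "\<dots> = emeasure \<mu> (E' \<inter> B)" using em[OF that(4,5)] that(2) by simp
    finally show ?thesis .
  qed
  define T where "T x = (if x \<in> D then g x else if x \<in> D' then g' x else x)" for x
  have T: "T \<in> borel \<rightarrow>\<^sub>M borel"
    unfolding T_def using D g(1) g'(1) by (intro measurable_If) auto
  have pre: "T -` B \<in> sets borel" if "B \<in> sets borel" for B by (rule measurable_sets_borel[OF T that])
  have "emeasure \<mu> (T -` B) = emeasure \<mu> B" if B: "B \<in> sets borel" for B
  proof -
    have split: "emeasure \<mu> X = emeasure \<mu> (D \<inter> X) + emeasure \<mu> (D' \<inter> X) + emeasure \<mu> (X - (D \<union> D'))"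
      if X: "X \<in> sets borel" for X
    proof -
      have "emeasure \<mu> (D \<inter> X) + emeasure \<mu> (D' \<inter> X) = emeasure \<mu> (D \<inter> X \<union> D' \<inter> X)"
        using D X s by (intro plus_emeasure) auto
      moreover have "emeasure \<mu> (D \<inter> X \<union> D' \<inter> X) + emeasure \<mu> (X - (D \<union> D')) =
          emeasure \<mu> ((D \<inter> X \<union> D' \<inter> X) \<union> (X - (D \<union> D')))"
        using D X s by (intro plus_emeasure) auto
      moreover have "(D \<inter> X \<union> D' \<inter> X) \<union> (X - (D \<union> D')) = X" by auto
      ultimately show ?thesis by simp
    qed
    have "D \<inter> T -` B = D \<inter> g -` B" "D' \<inter> T -` B = D' \<inter> g' -` B" "T -` B - (D \<union> D') = B - (D \<union> D')"
      using D(3) by (auto simp: T_def split: if_splits)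
    then show ?thesis
      using split[OF pre[OF B]] split[OF B] push[OF g D(1,2) B] push[OF g' D(2,1) B] by (simp add: ac_simps)
  qed
  then have "measure_preserving \<mu> T" using T by (simp add: measure_preserving_def)
  moreover have "T x = x" if "x \<notin> D \<union> D'" for x using that by (simp add: T_def)
  moreover have "emeasure \<mu> (D - T -` D') = 0"
  proof -
    have "D - T -` D' = D \<inter> g -` (- D')" using D(3) by (auto simp: T_def)
    then show ?thesis using push[OF g D(1,2), of "- D'"] D(2) by simp
  qed
  moreover have "emeasure \<mu> (D' - T -` D) = 0"
  proof -
    have "D' - T -` D = D' \<inter> g' -` (- D)"
      using D(3) by (auto simp: T_def split: if_splits)
    then show ?thesis using push[OF g' D(2,1), of "- D"] D(1) by simp
  qed
  ultimately show ?thesis by (rule that)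
qed

section \<open>An exchangeable edge measure has a constant kernel\<close>

lemma AE_obtain:
  assumes "AE x in M. Q x" "emeasure M (space M) > 0"
  obtains x where "Q x"
proof -
  have "ae_filter M \<noteq> bot" using assms(2) by (simp add: trivial_limit_def[symmetric] ae_filter_eq_bot_iff)
  with assms(1) show ?thesis using eventually_happens' that by blast
qed

lemma ex_Int_stable_bounded_basis:
  "\<exists>\<B> :: 'a::{metric_space, second_countable_topology} set set. countable \<B> \<and> Int_stable \<B> \<and>
     (\<forall>B\<in>\<B>. open B \<and> bounded B) \<and> (\<forall>V z. open V \<longrightarrow> z \<in> V \<longrightarrow> (\<exists>B\<in>\<B>. z \<in> B \<and> B \<subseteq> V))"
proof -
  obtain U :: "'a set set" where U: "countable U" "topological_basis U"
    using ex_countable_basis by blast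
  let ?F = "{F. F \<subseteq> U \<and> finite F}"
  define \<B> where "\<B> = {B \<in> Inter ` ?F. bounded B}"
  have "countable (Inter ` ?F)"
    using countable_Collect_finite_subset[OF U(1)] by (intro countable_image) (simp add: conj_commute)
  then have "countable \<B>" unfolding \<B>_def by (rule countable_subset[rotated]) auto
  moreover have "Int_stable \<B>"
  proof (rule Int_stableI)
    fix a b assume "a \<in> \<B>" "b \<in> \<B>"
    then obtain F G where F: "F \<in> ?F" "a = \<Inter>F" "bounded a" and G: "G \<in> ?F" "b = \<Inter>G"
      by (auto simp: \<B>_def)
    have "a \<inter> b = \<Inter>(F \<union> G)" "F \<union> G \<in> ?F" using F G by auto
    then have "a \<inter> b \<in> Inter ` ?F" by (simp only: image_eqI)
    then show "a \<inter> b \<in> \<B>" using F(3) by (simp add: \<B>_def bounded_Int)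
  qed
  moreover have "open B \<and> bounded B" if "B \<in> \<B>" for B
    using that topological_basis_open[OF U(2)] by (auto simp: \<B>_def intro!: open_Inter)
  moreover have "\<exists>B\<in>\<B>. z \<in> B \<and> B \<subseteq> V" if V: "open V" "z \<in> V" for V z
  proof -
    have "open (V \<inter> ball z 1)" "z \<in> V \<inter> ball z 1" using V by auto
    then obtain b where b: "b \<in> U" "z \<in> b" "b \<subseteq> V \<inter> ball z 1" by (rule topological_basisE[OF U(2)])
    have "bounded b" using b(3) bounded_subset[OF bounded_ball, of b z 1] by auto
    moreover have "b \<in> Inter ` ?F" using b(1) by (intro image_eqI[of _ _ "{b}"]) auto
    ultimately show ?thesis using b by (intro bexI[of _ b]) (auto simp: \<B>_def)
  qed
  ultimately show ?thesis by blast
qed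

context poisson_graph
begin

text \<open>The expected number of edges from a vertex at \<open>x\<close> to vertices in \<open>B\<close>.\<close>

definition degree_into :: "'a set \<Rightarrow> 'a \<Rightarrow> ennreal" where
  "degree_into B x = (\<integral>\<^sup>+y. ennreal (W (x, y)) * indicator B y \<partial>\<mu>)"

lemma W_ennreal_measurable: "(\<lambda>z. ennreal (W z)) \<in> borel_measurable (\<mu> \<Otimes>\<^sub>M \<mu>)"
  by (subst measurable_cong_sets[OF sets_\<mu>_pair refl]) measurable

lemma W_section_measurable: "(\<lambda>y. W (x, y)) \<in> borel_measurable \<mu>"
proof -
  have "W \<in> borel_measurable (\<mu> \<Otimes>\<^sub>M \<mu>)"
    by (subst measurable_cong_sets[OF sets_\<mu>_pair refl]) measurable
  then show ?thesis by (rule measurable_Pair2) (simp add: space_\<mu>)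
qed

lemma degree_into_measurable:
  assumes "B \<in> sets borel"
  shows "degree_into B \<in> borel_measurable \<mu>"
  unfolding degree_into_def
proof (rule \<mu>.borel_measurable_nn_integral)
  have "snd -` B \<inter> space (\<mu> \<Otimes>\<^sub>M \<mu>) \<in> sets (\<mu> \<Otimes>\<^sub>M \<mu>)"
    using assms by (intro measurable_sets[OF measurable_snd]) (simp add: sets_\<mu>)
  then have "(\<lambda>z. indicator B (snd z) :: ennreal) \<in> borel_measurable (\<mu> \<Otimes>\<^sub>M \<mu>)"
    by (subst measurable_cong[of _ _ "indicator (snd -` B \<inter> space (\<mu> \<Otimes>\<^sub>M \<mu>))"]) (auto simp: indicator_def)
  then have "(\<lambda>z. ennreal (W z) * indicator B (snd z)) \<in> borel_measurable (\<mu> \<Otimes>\<^sub>M \<mu>)"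
    using W_ennreal_measurable by (rule borel_measurable_times_ennreal[rotated])
  then show "(\<lambda>(x, y). ennreal (W (x, y)) * indicator B y) \<in> borel_measurable (\<mu> \<Otimes>\<^sub>M \<mu>)"
    by (simp add: case_prod_beta')
qed

lemma degree_level_sets_borel:
  fixes q :: real
  assumes [measurable]: "B \<in> sets borel"
  shows "{x. x \<notin> B \<and> degree_into B x < ennreal q} \<in> sets borel"
    and "{x. x \<notin> B \<and> ennreal q \<le> degree_into B x} \<in> sets borel"
proof -
  have [measurable]: "degree_into B \<in> borel_measurable borel"
    using degree_into_measurable[OF assms] measurable_cong_sets[OF sets_\<mu> refl] by blast
  have "{x\<in>space borel. x \<notin> B \<and> degree_into B x < ennreal q} \<in> sets borel" by measurable
  moreover have "{x\<in>space borel. x \<notin> B \<and> ennreal q \<le> degree_into B x} \<in> sets borel" by measurable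
  ultimately show "{x. x \<notin> B \<and> degree_into B x < ennreal q} \<in> sets borel"
    "{x. x \<notin> B \<and> ennreal q \<le> degree_into B x} \<in> sets borel" by simp_all
qed

lemma degree_into_le: "B \<in> sets borel \<Longrightarrow> degree_into B x \<le> emeasure \<mu> B"
proof -
  assume B: "B \<in> sets borel"
  have "degree_into B x \<le> (\<integral>\<^sup>+y. indicator B y \<partial>\<mu>)"
    unfolding degree_into_def using W_le_1 W_nonneg
    by (intro nn_integral_mono) (auto split: split_indicator simp: ennreal_le_1)
  also have "\<dots> = emeasure \<mu> B" using B by (simp add: sets_\<mu>)
  finally show ?thesis .
qed

lemma nn_integral_W_Times:
  assumes D: "D \<in> sets borel" and B: "B \<in> sets borel"
  shows "(\<integral>\<^sup>+z. ennreal (W z) * indicator (D \<times> B) z \<partial>(\<mu> \<Otimes>\<^sub>M \<mu>)) = (\<integral>\<^sup>+x. indicator D x * degree_into B x \<partial>\<mu>)"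
proof -
  have "D \<times> B \<in> sets (\<mu> \<Otimes>\<^sub>M \<mu>)" using D B by (simp add: sets_\<mu>)
  then have m: "(\<lambda>z. ennreal (W z) * indicator (D \<times> B) z) \<in> borel_measurable (\<mu> \<Otimes>\<^sub>M \<mu>)"
    using W_ennreal_measurable by (intro borel_measurable_times_ennreal) auto
  have "(\<integral>\<^sup>+z. ennreal (W z) * indicator (D \<times> B) z \<partial>(\<mu> \<Otimes>\<^sub>M \<mu>)) =
      (\<integral>\<^sup>+x. (\<integral>\<^sup>+y. ennreal (W (x, y)) * indicator (D \<times> B) (x, y) \<partial>\<mu>) \<partial>\<mu>)"
    using \<mu>.nn_integral_fst[OF m] by simp
  also have "\<dots> = (\<integral>\<^sup>+x. indicator D x * degree_into B x \<partial>\<mu>)"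
    by (intro nn_integral_cong) (simp add: degree_into_def indicator_times split: split_indicator)
  finally show ?thesis .
qed

context
  fixes \<xi>
  assumes \<xi>_edge: "AE \<omega> in P. \<xi> \<omega> = edge_measure N S A \<omega>"
    and exch: "jointly_exchangeable P \<mu> \<xi>"
begin

text \<open>Both sides are means of \<open>\<xi>\<close>, on \<open>D \<times> B\<close> and, up to null sets, on the preimage of \<open>D \<times> B\<close> under the
  map that exchanges \<open>D\<close> and \<open>D'\<close>. This map fixes all other points, which keeps the preimages bounded.\<close>

lemma degree_mass_eq:
  assumes D: "D \<in> sets borel" "bounded D" and D': "D' \<in> sets borel" "bounded D'" and B: "B \<in> sets borel" "bounded B"
    and disj: "D \<inter> D' = {}" "D \<inter> B = {}" "D' \<inter> B = {}" and mass: "emeasure \<mu> D = emeasure \<mu> D'"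
  shows "(\<integral>\<^sup>+x. indicator D x * degree_into B x \<partial>\<mu>) = (\<integral>\<^sup>+x. indicator D' x * degree_into B x \<partial>\<mu>)"
proof -
  obtain T where T: "measure_preserving \<mu> T" and T_id: "\<And>x. x \<notin> D \<union> D' \<Longrightarrow> T x = x"
    and null: "emeasure \<mu> (D - T -` D') = 0" "emeasure \<mu> (D' - T -` D) = 0"
    using ex_measure_preserving_swap[OF sets_\<mu> diffuse D(1) D'(1) disj(1) mass \<mu>_bounded_finite[OF D]] by blast
  note T' = measure_preservingD[OF T]
  have TT: "map_prod T T \<in> borel \<rightarrow>\<^sub>M borel" by (rule map_prod_borel_measurable[OF T'(1)])
  have m: "\<xi> \<in> P \<rightarrow>\<^sub>M measure_algebra borel" using exch by (simp add: jointly_exchangeable_def random_measure_def)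
  have mT: "(\<lambda>\<omega>. distr (\<xi> \<omega>) borel (map_prod T T)) \<in> P \<rightarrow>\<^sub>M measure_algebra borel"
    by (rule measurable_distr_kernel[OF m TT])
  have law: "distr P (measure_algebra borel) (\<lambda>\<omega>. distr (\<xi> \<omega>) borel (map_prod T T)) = distr P (measure_algebra borel) \<xi>"
    using exch T by (simp add: jointly_exchangeable_def)
  let ?TD = "T -` D" and ?TB = "T -` B"
  have pre: "?TD \<in> sets borel" "?TB \<in> sets borel" using T'(3) D B by auto
  have TD_sub: "?TD \<subseteq> D \<union> D'" and TB_sub: "?TB \<subseteq> D \<union> D' \<union> B" using T_id by force+
  have bdd: "bounded ?TD" "bounded ?TB"
    using bounded_subset[OF _ TD_sub] bounded_subset[OF _ TB_sub] D D' B by auto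
  have DB: "D \<times> B \<in> sets borel" using D B by simp
  have ev: "(\<lambda>M. emeasure M (D \<times> B)) \<in> borel_measurable (measure_algebra borel)"
    using DB by measurable
  have edge_mean: "(\<integral>\<^sup>+\<omega>. emeasure (\<xi> \<omega>) (E \<times> F) \<partial>P) = (\<integral>\<^sup>+x. indicator E x * degree_into F x \<partial>\<mu>)"
    if "E \<in> sets borel" "bounded E" "F \<in> sets borel" "bounded F" "E \<inter> F = {}" for E F
  proof -
    have "(\<integral>\<^sup>+\<omega>. emeasure (\<xi> \<omega>) (E \<times> F) \<partial>P) = (\<integral>\<^sup>+\<omega>. emeasure (edge_measure N S A \<omega>) (E \<times> F) \<partial>P)"
      by (rule nn_integral_cong_AE) (use \<xi>_edge in \<open>auto elim: eventually_mono\<close>)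
    then show ?thesis using edge_measure_mean[OF that] nn_integral_W_Times[OF that(1,3)] by simp
  qed
  have null_AE: "AE x in \<mu>. x \<notin> D - T -` D'" "AE x in \<mu>. x \<notin> D' - T -` D"
  proof -
    have "D - T -` D' \<in> sets \<mu>" "D' - T -` D \<in> sets \<mu>"
      unfolding sets_\<mu> using T'(3)[OF D(1)] T'(3)[OF D'(1)] D(1) D'(1) by (simp_all add: sets.Diff)
    then show "AE x in \<mu>. x \<notin> D - T -` D'" "AE x in \<mu>. x \<notin> D' - T -` D"
      using null by (simp_all only: AE_not_in null_setsI)
  qed
  have "(\<integral>\<^sup>+x. indicator D x * degree_into B x \<partial>\<mu>) = (\<integral>\<^sup>+\<omega>. emeasure (\<xi> \<omega>) (D \<times> B) \<partial>P)"
    using edge_mean[OF D B disj(2)] by simp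
  also have "\<dots> = (\<integral>\<^sup>+M. emeasure M (D \<times> B) \<partial>distr P (measure_algebra borel) \<xi>)"
    by (subst nn_integral_distr[OF m]) (use ev in simp_all)
  also have "\<dots> = (\<integral>\<^sup>+\<omega>. emeasure (distr (\<xi> \<omega>) borel (map_prod T T)) (D \<times> B) \<partial>P)"
    unfolding law[symmetric] by (subst nn_integral_distr[OF mT]) (use ev in simp_all)
  also have "\<dots> = (\<integral>\<^sup>+\<omega>. emeasure (\<xi> \<omega>) (?TD \<times> ?TB) \<partial>P)"
  proof (rule nn_integral_cong)
    fix \<omega> assume \<omega>: "\<omega> \<in> space P"
    have "map_prod T T -` (D \<times> B) = ?TD \<times> ?TB" by auto
    then show "emeasure (distr (\<xi> \<omega>) borel (map_prod T T)) (D \<times> B) = emeasure (\<xi> \<omega>) (?TD \<times> ?TB)"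
      using emeasure_distr_kernel[OF m TT DB \<omega>] by simp
  qed
  also have "\<dots> = (\<integral>\<^sup>+x. indicator ?TD x * degree_into ?TB x \<partial>\<mu>)"
    using pre bdd disj(2) by (intro edge_mean) auto
  also have "\<dots> = (\<integral>\<^sup>+x. indicator D' x * degree_into B x \<partial>\<mu>)"
  proof -
    have deg: "degree_into ?TB x = degree_into B x" for x
      unfolding degree_into_def
    proof (rule nn_integral_cong_AE)
      show "AE y in \<mu>. ennreal (W (x, y)) * indicator ?TB y = ennreal (W (x, y)) * indicator B y"
        using null_AE
      proof eventually_elim
        case (elim y)
        have "y \<in> ?TB \<longleftrightarrow> y \<in> B"
        proof (cases "y \<in> D \<union> D'")
          case True
          then have "T y \<in> D' \<or> T y \<in> D" "y \<notin> B" using elim disj by auto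
          then show ?thesis using disj by auto
        next
          case False
          then show ?thesis using T_id by simp
        qed
        then show ?case by (simp split: split_indicator)
      qed
    qed
    show ?thesis unfolding deg
    proof (rule nn_integral_cong_AE)
      show "AE x in \<mu>. indicator ?TD x * degree_into B x = indicator D' x * degree_into B x"
        using null_AE
      proof eventually_elim
        case (elim x)
        have "x \<in> ?TD \<longleftrightarrow> x \<in> D'"
        proof (cases "x \<in> D \<union> D'")
          case True
          then show ?thesis using elim disj by auto
        next
          case False
          then show ?thesis using T_id by auto
        qed
        then show ?case by (simp split: split_indicator)
      qed
    qed
  qed
  finally show ?thesis .
qed

text \<open>If the degree into \<open>B\<close> took values below and above \<open>q\<close> on two sets of positive mass, then these
  contain bounded subsets of equal positive mass that contradict \<open>degree_mass_eq\<close>.\<close>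

lemma degree_level_sets:
  fixes q :: real
  assumes B: "B \<in> sets borel" "bounded B"
  shows "emeasure \<mu> {x. x \<notin> B \<and> degree_into B x < ennreal q} = 0 \<or>
    emeasure \<mu> {x. x \<notin> B \<and> ennreal q \<le> degree_into B x} = 0"
proof (rule ccontr)
  let ?E = "{x. x \<notin> B \<and> degree_into B x < ennreal q}" and ?E' = "{x. x \<notin> B \<and> ennreal q \<le> degree_into B x}"
  assume "\<not> (emeasure \<mu> ?E = 0 \<or> emeasure \<mu> ?E' = 0)"
  then have pos: "emeasure \<mu> ?E \<noteq> 0" "emeasure \<mu> ?E' \<noteq> 0" by auto
  note E = degree_level_sets_borel[OF B(1), of q]
  have window: "\<exists>n. emeasure \<mu> (X \<inter> bounded_exhaustion n) \<noteq> 0"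
    if "X \<in> sets borel" "emeasure \<mu> X \<noteq> 0" for X
  proof (rule ccontr)
    assume "\<nexists>n. emeasure \<mu> (X \<inter> bounded_exhaustion n) \<noteq> 0"
    then show False using emeasure_exhaust(1)[OF sets_\<mu> that(1)] that(2) by simp
  qed
  obtain n where n: "emeasure \<mu> (?E \<inter> bounded_exhaustion n) \<noteq> 0" using window[OF E(1) pos(1)] ..
  obtain n' where n': "emeasure \<mu> (?E' \<inter> bounded_exhaustion n') \<noteq> 0" using window[OF E(2) pos(2)] ..
  let ?X = "?E \<inter> bounded_exhaustion n" and ?X' = "?E' \<inter> bounded_exhaustion n'"
  have X: "?X \<in> sets borel" "bounded ?X" and X': "?X' \<in> sets borel" "bounded ?X'"
    using E by (auto simp: bounded_Int)
  define a where "a = min (emeasure \<mu> ?X) (emeasure \<mu> ?X')"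
  have a: "a \<noteq> 0" "a \<noteq> \<infinity>" using n n' \<mu>_bounded_finite[OF X] by (auto simp: a_def min_def)
  have atom: "emeasure \<mu> {x} = 0" for x using diffuse by (simp add: diffuse_def)
  obtain D where D: "D \<in> sets borel" "D \<subseteq> ?X" "emeasure \<mu> D = a"
    using ex_subset_of_mass[OF sets_\<mu> atom X(1) \<mu>_bounded_finite[OF X], of a] by (auto simp: a_def)
  obtain D' where D': "D' \<in> sets borel" "D' \<subseteq> ?X'" "emeasure \<mu> D' = a"
    using ex_subset_of_mass[OF sets_\<mu> atom X'(1) \<mu>_bounded_finite[OF X'], of a] by (auto simp: a_def)
  have D\<mu>: "D \<in> sets \<mu>" "D' \<in> sets \<mu>" using D D' by (simp_all add: sets_\<mu>)
  have "(\<integral>\<^sup>+x. indicator D x * degree_into B x \<partial>\<mu>) < (\<integral>\<^sup>+x. indicator D x * ennreal q \<partial>\<mu>)"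
  proof (rule nn_integral_less)
    show "(\<lambda>x. indicator D x * degree_into B x) \<in> borel_measurable \<mu>"
      using D\<mu> degree_into_measurable[OF B(1)] by (intro borel_measurable_times_ennreal) auto
    show "(\<lambda>x. indicator D x * ennreal q) \<in> borel_measurable \<mu>" using D\<mu> by simp
    have "(\<integral>\<^sup>+x. indicator D x * degree_into B x \<partial>\<mu>) \<le> (\<integral>\<^sup>+x. ennreal q * indicator D x \<partial>\<mu>)"
      using D(2) by (intro nn_integral_mono) (auto split: split_indicator intro: less_imp_le)
    also have "\<dots> = ennreal q * a" using D\<mu> D(3) by (simp add: nn_integral_cmult_indicator)
    also have "\<dots> < \<infinity>" using a by (simp add: ennreal_mult_less_top less_top)
    finally show "(\<integral>\<^sup>+x. indicator D x * degree_into B x \<partial>\<mu>) \<noteq> \<infinity>" by simp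
    show "AE x in \<mu>. indicator D x * degree_into B x \<le> indicator D x * ennreal q"
      using D(2) by (intro AE_I2) (auto split: split_indicator intro: less_imp_le)
    show "\<not> (AE x in \<mu>. indicator D x * ennreal q \<le> indicator D x * degree_into B x)"
    proof
      assume "AE x in \<mu>. indicator D x * ennreal q \<le> indicator D x * degree_into B x"
      then have "AE x in \<mu>. x \<notin> D"
      proof eventually_elim
        case (elim x)
        show ?case
        proof
          assume "x \<in> D"
          then show False using elim D(2) by (auto simp: not_le[symmetric])
        qed
      qed
      then have "emeasure \<mu> D = 0"
        using D\<mu>(1) AE_iff_measurable[of D \<mu> "\<lambda>x. x \<notin> D"] by (auto simp: space_\<mu>)
      then show False using D(3) a(1) by simp
    qed
  qed
  also have "\<dots> = (\<integral>\<^sup>+x. indicator D' x * ennreal q \<partial>\<mu>)"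
    using D\<mu> D(3) D'(3) by (simp add: nn_integral_multc)
  also have "\<dots> \<le> (\<integral>\<^sup>+x. indicator D' x * degree_into B x \<partial>\<mu>)"
    using D'(2) by (intro nn_integral_mono) (auto split: split_indicator)
  also have "\<dots> = (\<integral>\<^sup>+x. indicator D x * degree_into B x \<partial>\<mu>)"
  proof (rule degree_mass_eq[symmetric])
    show "bounded D" "bounded D'" by (rule bounded_subset[OF X(2) D(2)], rule bounded_subset[OF X'(2) D'(2)])
    show "D \<inter> D' = {}" using D(2) D'(2) by (auto simp: not_le[symmetric])
    show "D \<inter> B = {}" "D' \<inter> B = {}" using D(2) D'(2) by auto
  qed (use D D' B in simp_all)
  finally show False by simp
qed

text \<open>Two different degrees are separated by a rational \<open>q\<close>, and for each \<open>q\<close> one of the two level sets is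
  null.\<close>

lemma degree_constant:
  assumes B: "B \<in> sets borel" "bounded B"
  shows "AE x in \<mu>. AE y in \<mu>. x \<notin> B \<longrightarrow> y \<notin> B \<longrightarrow> degree_into B x = degree_into B y"
proof -
  let ?E = "\<lambda>q::rat. {x. x \<notin> B \<and> degree_into B x < ennreal (of_rat q)}"
  let ?E' = "\<lambda>q::rat. {x. x \<notin> B \<and> ennreal (of_rat q) \<le> degree_into B x}"
  have E: "?E q \<in> sets \<mu>" "?E' q \<in> sets \<mu>" for q
    using degree_level_sets_borel[OF B(1)] by (simp_all add: sets_\<mu>)
  have "AE x in \<mu>. AE y in \<mu>. \<not> (x \<in> ?E q \<and> y \<in> ?E' q) \<and> \<not> (y \<in> ?E q \<and> x \<in> ?E' q)" for q
    using degree_level_sets[OF B, of "of_rat q"]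
  proof
    assume "emeasure \<mu> (?E q) = 0"
    then have "AE x in \<mu>. x \<notin> ?E q" using E by (intro AE_not_in null_setsI)
    then show ?thesis by eventually_elim (use \<open>AE x in \<mu>. x \<notin> ?E q\<close> in \<open>auto elim: eventually_mono\<close>)
  next
    assume "emeasure \<mu> (?E' q) = 0"
    then have "AE x in \<mu>. x \<notin> ?E' q" using E by (intro AE_not_in null_setsI)
    then show ?thesis by eventually_elim (use \<open>AE x in \<mu>. x \<notin> ?E' q\<close> in \<open>auto elim: eventually_mono\<close>)
  qed
  then have "AE x in \<mu>. \<forall>q. AE y in \<mu>. \<not> (x \<in> ?E q \<and> y \<in> ?E' q) \<and> \<not> (y \<in> ?E q \<and> x \<in> ?E' q)"
    by (subst AE_all_countable) blast
  then show ?thesis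
  proof eventually_elim
    case (elim x)
    then have "AE y in \<mu>. \<forall>q. \<not> (x \<in> ?E q \<and> y \<in> ?E' q) \<and> \<not> (y \<in> ?E q \<and> x \<in> ?E' q)"
      by (subst AE_all_countable) blast
    then show ?case
    proof eventually_elim
      case (elim y)
      show ?case
      proof (intro impI, rule ccontr)
        assume xy: "x \<notin> B" "y \<notin> B" "degree_into B x \<noteq> degree_into B y"
        have between: "\<exists>q::rat. s < ennreal (of_rat q) \<and> ennreal (of_rat q) \<le> t" if st: "s < t" for s t :: ennreal
        proof -
          obtain r where r: "s < ennreal r" "ennreal r < t" "0 \<le> r"
            using st by (metis dense ennreal_cases less_top_ennreal order_less_imp_not_less top.not_eq_extremum)
          obtain s' where s': "s = ennreal s'" "0 \<le> s'" "s' < r"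
            using r by (cases s) (auto simp: ennreal_less_iff top_unique)
          obtain q where q: "s' < of_rat q" "of_rat q < r" using of_rat_dense[OF s'(3)] by blast
          have "s < ennreal (of_rat q)" using q s' by (simp add: ennreal_less_iff)
          moreover have "ennreal (of_rat q) \<le> t"
            using q r(2) by (meson ennreal_leI less_imp_le order_trans)
          ultimately show ?thesis by blast
        qed
        from xy(3) consider "degree_into B x < degree_into B y" | "degree_into B y < degree_into B x" by force
        then show False
        proof cases
          case 1
          obtain q where "degree_into B x < ennreal (of_rat q)" "ennreal (of_rat q) \<le> degree_into B y"
            using between[OF 1] by blast
          then show False using elim[THEN spec, of q] xy by simp
        next
          case 2
          obtain q where "degree_into B y < ennreal (of_rat q)" "ennreal (of_rat q) \<le> degree_into B x"
            using between[OF 2] by blast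
          then show False using elim[THEN spec, of q] xy by simp
        qed
      qed
    qed
  qed
qed

text \<open>Sections of the kernel are determined by the degrees into the members of a countable
  \<open>\<inter>\<close>-stable base of the complement of \<open>{x, y}\<close>.\<close>

lemma sections_eq: "AE x in \<mu>. AE y in \<mu>. AE z in \<mu>. W (x, z) = W (y, z)"
proof -
  obtain \<B> :: "'a set set" where \<B>: "countable \<B>" "Int_stable \<B>" "\<And>B. B \<in> \<B> \<Longrightarrow> open B \<and> bounded B"
    "\<And>V z. open V \<Longrightarrow> z \<in> V \<Longrightarrow> \<exists>B\<in>\<B>. z \<in> B \<and> B \<subseteq> V"
    using ex_Int_stable_bounded_basis by blast
  have \<B>_sets: "B \<in> sets borel" if "B \<in> \<B>" for B using \<B>(3)[OF that] by simp
  have "AE x in \<mu>. \<forall>B\<in>\<B>. AE y in \<mu>. x \<notin> B \<longrightarrow> y \<notin> B \<longrightarrow> degree_into B x = degree_into B y"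
    using \<B>(1) degree_constant \<B>(3) \<B>_sets by (subst AE_ball_countable) auto
  then show ?thesis
  proof eventually_elim
    case (elim x)
    then have "AE y in \<mu>. \<forall>B\<in>\<B>. x \<notin> B \<longrightarrow> y \<notin> B \<longrightarrow> degree_into B x = degree_into B y"
      using \<B>(1) by (subst AE_ball_countable) auto
    then show ?case
    proof eventually_elim
      case (elim y)
      let ?\<rho> = "\<lambda>u. density \<mu> (\<lambda>z. ennreal (W (u, z)))"
      have \<rho>: "emeasure (?\<rho> u) B = degree_into B u" if "B \<in> sets borel" for u B
        unfolding degree_into_def using that W_section_measurable by (intro emeasure_density) (auto simp: sets_\<mu>)
      define G where "G = {B\<in>\<B>. x \<notin> B \<and> y \<notin> B} \<union> Pow {x, y}"
      have G_sets: "B \<in> sets borel" if "B \<in> G" for B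
        using that \<B>_sets finite_subset[of B "{x, y}"] by (auto simp: G_def intro: finite_imp_closed borel_closed)
      have zero: "degree_into B u = 0" if "B \<in> Pow {x, y}" for B u
      proof -
        have "emeasure \<mu> {x, y} = 0"
        proof -
          have "emeasure \<mu> ({x} \<union> {y}) \<le> emeasure \<mu> {x} + emeasure \<mu> {y}"
            by (rule emeasure_subadditive) (simp_all add: sets_\<mu>)
          then show ?thesis using diffuse by (simp add: diffuse_def insert_commute)
        qed
        then have "emeasure \<mu> B = 0" using that emeasure_mono[of B "{x, y}" \<mu>] by (simp add: sets_\<mu>)
        moreover have "B \<in> sets borel" using that G_sets by (simp add: G_def)
        ultimately show ?thesis using degree_into_le[of B u] by simp
      qed
      have "sigma_sets UNIV {V. open V} \<subseteq> sigma_sets UNIV G"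
      proof (rule sigma_sets_mono, clarify)
        fix V :: "'a set" assume V: "open V"
        let ?C = "{B\<in>\<B>. x \<notin> B \<and> y \<notin> B \<and> B \<subseteq> V}"
        have "V = \<Union>?C \<union> V \<inter> {x, y}"
        proof (intro equalityI subsetI)
          fix z assume z: "z \<in> V"
          show "z \<in> \<Union>?C \<union> V \<inter> {x, y}"
          proof (cases "z \<in> {x, y}")
            case False
            have "open (V - {x, y})" using V by (intro open_Diff) auto
            then obtain B where "B \<in> \<B>" "z \<in> B" "B \<subseteq> V - {x, y}" using \<B>(4)[of "V - {x, y}" z] z False by auto
            then show ?thesis by blast
          qed (use z in blast)
        qed auto
        then have eq: "\<Union>?C \<union> V \<inter> {x, y} = V" by (rule sym)
        have "?C \<subseteq> \<B>" "?C \<subseteq> G" by (auto simp: G_def)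
        then have "\<Union>?C \<in> sigma_sets UNIV G"
          using countable_subset[OF _ \<B>(1)] by (intro sigma_sets_UNION sigma_sets.Basic) auto
        moreover have "V \<inter> {x, y} \<in> G" by (simp add: G_def)
        then have "V \<inter> {x, y} \<in> sigma_sets UNIV G" by (rule sigma_sets.Basic)
        ultimately have "\<Union>?C \<union> V \<inter> {x, y} \<in> sigma_sets UNIV G" by (rule sigma_sets_Un)
        then show "V \<in> sigma_sets UNIV G" by (simp only: eq)
      qed
      moreover have "sigma_sets UNIV G \<subseteq> sets borel"
        using G_sets sets.sigma_sets_subset[of G borel] by auto
      moreover have "sets (borel :: 'a measure) = sigma_sets UNIV {V. open V}"
        by (simp add: borel_def)
      ultimately have gen: "sets (borel :: 'a measure) = sigma_sets UNIV G" by blast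
      have cG: "countable G"
        using countable_subset[OF _ \<B>(1)] by (auto simp: G_def intro!: countable_finite)
      have "?\<rho> x = ?\<rho> y"
      proof (rule measure_eqI_generator_eq_countable[where E=G and \<Omega>=UNIV and A=G])
        show "Int_stable G"
        proof (rule Int_stableI)
          fix a b assume "a \<in> G" "b \<in> G"
          then show "a \<inter> b \<in> G" using Int_stableD[OF \<B>(2), of a b] by (auto simp: G_def)
        qed
        show "emeasure (?\<rho> x) B = emeasure (?\<rho> y) B" if "B \<in> G" for B
          using that elim zero[of B] \<rho>[OF G_sets[OF that]] by (auto simp: G_def)
        show "sets (?\<rho> x) = sigma_sets UNIV G" "sets (?\<rho> y) = sigma_sets UNIV G"
          using gen by (simp_all add: sets_\<mu>)
        show "\<Union>G = UNIV"
        proof -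
          have "z \<in> \<Union>G" for z
          proof (cases "z \<in> {x, y}")
            case False
            have "open (- {x, y})" by (simp add: open_Compl finite_imp_closed)
            then obtain B where "B \<in> \<B>" "z \<in> B" "B \<subseteq> - {x, y}" using \<B>(4)[of "- {x, y}" z] False by auto
            then show ?thesis by (auto simp: G_def)
          qed (auto simp: G_def)
          then show ?thesis by blast
        qed
        show "emeasure (?\<rho> x) B \<noteq> \<infinity>" if B: "B \<in> G" for B
        proof -
          have "emeasure (?\<rho> x) B < \<infinity>"
          proof (cases "B \<in> Pow {x, y}")
            case True
            then show ?thesis using zero[OF True] \<rho>[OF G_sets[OF B]] by simp
          next
            case False
            then have "bounded B" using B \<B>(3) by (auto simp: G_def)
            then show ?thesis
              using \<rho>[OF G_sets[OF B]] degree_into_le[OF G_sets[OF B], of x] \<mu>_bounded_finite[OF G_sets[OF B]]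
              by (simp add: le_less_trans)
          qed
          then show ?thesis by simp
        qed
      qed (use cG in auto)
      then have "AE z in \<mu>. ennreal (W (x, z)) = ennreal (W (y, z))"
        using W_section_measurable by (intro \<mu>.density_unique) auto
      then show ?case by eventually_elim (simp add: W_nonneg)
    qed
  qed
qed

text \<open>The kernel depends almost everywhere on its second argument only; by symmetry it depends on the first
  argument only, so it is constant.\<close>

theorem constant_if_exchangeable:
  assumes pos: "emeasure \<mu> (space \<mu>) > 0"
  shows "\<exists>c. AE z in \<mu> \<Otimes>\<^sub>M \<mu>. W z = c"
proof -
  have pair: "pair_sigma_finite \<mu> \<mu>" ..
  obtain x0 where x0: "AE y in \<mu>. AE z in \<mu>. W (x0, z) = W (y, z)"
    using AE_obtain[OF sections_eq pos] .
  define g where "g z = W (x0, z)" for z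
  have Wm: "W \<in> borel_measurable (\<mu> \<Otimes>\<^sub>M \<mu>)"
    by (subst measurable_cong_sets[OF sets_\<mu>_pair refl]) measurable
  have gm: "g \<in> borel_measurable \<mu>" using W_section_measurable[of x0] by (simp add: g_def[abs_def])
  have meas: "{p\<in>space (\<mu> \<Otimes>\<^sub>M \<mu>). W (fst p, snd p) = g (snd p)} \<in> sets (\<mu> \<Otimes>\<^sub>M \<mu>)"
  proof -
    note [measurable] = Wm gm
    have "{p\<in>space (\<mu> \<Otimes>\<^sub>M \<mu>). W p = g (snd p)} \<in> sets (\<mu> \<Otimes>\<^sub>M \<mu>)" by measurable
    then show ?thesis by simp
  qed
  have 1: "AE y in \<mu>. AE z in \<mu>. W (y, z) = g z" using x0 by (simp add: g_def eq_commute)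
  then have "AE z in \<mu>. AE y in \<mu>. W (y, z) = g z"
    using pair_sigma_finite.AE_commute[OF pair meas] by simp
  then have 2: "AE y in \<mu>. AE z in \<mu>. W (y, z) = g y"
    by (simp add: W_sym)
  from 1 2 have "AE y in \<mu>. AE z in \<mu>. g z = g y"
  proof eventually_elim
    case (elim y)
    then show ?case by eventually_elim simp
  qed
  then obtain y0 where y0: "AE z in \<mu>. g z = g y0" using AE_obtain[OF _ pos] by blast
  from 1 have "AE y in \<mu>. AE z in \<mu>. W (y, z) = g y0"
  proof eventually_elim
    case (elim y)
    then show ?case using y0 by eventually_elim simp
  qed
  moreover have "{p\<in>space (\<mu> \<Otimes>\<^sub>M \<mu>). W p = g y0} \<in> sets (\<mu> \<Otimes>\<^sub>M \<mu>)"
  proof -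
    note [measurable] = Wm
    show ?thesis by measurable
  qed
  ultimately have "AE p in \<mu> \<Otimes>\<^sub>M \<mu>. W p = g y0" by (intro pair_sigma_finite.AE_pair_measure[OF pair]) auto
  then show ?thesis ..
qed

end

end


section \<open>Characterization of exchangeability\<close>

theorem theorem16:
  fixes \<mu> :: "'a::polish_space measure"
    and W :: "'a \<times> 'a \<Rightarrow> real"
    and P :: "'w measure"
    and N :: "'w \<Rightarrow> enat"
    and S :: "nat \<Rightarrow> 'w \<Rightarrow> 'a"
    and A :: "nat \<Rightarrow> nat \<Rightarrow> 'w \<Rightarrow> bool"
    and \<xi> :: "'w \<Rightarrow> ('a \<times> 'a) measure"
  assumes "uncountable (UNIV :: 'a set)"
    and "sets \<mu> = sets borel"
    and "diffuse \<mu>" and "sigma_finite_measure \<mu>" and "locally_finite \<mu>"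
    and "emeasure \<mu> (space \<mu>) > 0"
    and "connection_kernel W"
    and "prob_space P"
    and "poisson_graph_process P \<mu> W N S A"
    and "random_measure P \<xi>"
    and "AE \<omega> in P. \<xi> \<omega> = edge_measure N S A \<omega>"
  shows "jointly_exchangeable P \<mu> \<xi> \<longleftrightarrow> (\<exists>c. AE z in \<mu> \<Otimes>\<^sub>M \<mu>. W z = c)"
proof -
  have graph: "poisson_graph P \<mu> N S W A"
    using assms(2-5,7-9)
    by (intro poisson_graph.intro poisson_points.intro poisson_points_axioms.intro poisson_graph_axioms.intro)
       (auto simp: poisson_graph_process_def)
  show ?thesis
  proof
    assume "jointly_exchangeable P \<mu> \<xi>"
    then show "\<exists>c. AE z in \<mu> \<Otimes>\<^sub>M \<mu>. W z = c"
      by (rule poisson_graph.constant_if_exchangeable[OF graph assms(11) _ assms(6)])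
  next
    assume "\<exists>c. AE z in \<mu> \<Otimes>\<^sub>M \<mu>. W z = c"
    then obtain c where c: "AE z in \<mu> \<Otimes>\<^sub>M \<mu>. W z = c" ..
    have "emeasure (\<mu> \<Otimes>\<^sub>M \<mu>) (space (\<mu> \<Otimes>\<^sub>M \<mu>)) > 0"
      using assms(6) unfolding space_pair_measure
      by (subst sigma_finite_measure.emeasure_pair_measure_Times[OF assms(4)]) (auto simp: zero_less_iff_neq_zero)
    then obtain z where "W z = c" using AE_obtain[OF c] by blast
    then have "0 \<le> c" "c \<le> 1"
      using assms(7) unfolding connection_kernel_def by (metis prod.collapse)+
    then show "jointly_exchangeable P \<mu> \<xi>"
      by (rule poisson_graph.exchangeable_if_constant[OF graph assms(10,11) c])
  qed
qed

end
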